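(* Let $R$ be an integral domain. The following statements are equivalent: (1) For all $r\in R$, all $R$-modules $M,N$ and all $R$-module homomorphisms $f:M\to N$, if $f$ is seemingly divisible by $r$, then there exists $g\in \mathrm{Hom}_R(M,N)$ with $f=r\cdot g$. (2) $R$ is a Dedekind domain.
   Context: An $R$-module homomorphism $f:M\to N$ is called seemingly divisible by $r\in R$ if for every $m\in M$ there is $n\in N$ with $f(m)=rn$, and $f(m)=0$ for every $m\in M$ with $rm=0$. Modules are arbitrary (not necessarily finitely generated), and $R$ is not assumed Noetherian. Fields are counted as Dedekind domains. *)

theory Defs
  imports "HOL-Algebra.Module" "HOL-Algebra.Polynomials" "HOL-Algebra.Ring_Divisibility"
begin

section \<open>Modules\<close>

definition linear_homs ::
  "('a, 'r) ring_scheme \<Rightarrow> ('a, 'm, 's) module_scheme \<Rightarrow> ('a, 'n, 't) module_scheme \<Rightarrow> ('m \<Rightarrow> 'n) set"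
  where "linear_homs R M N =
    {f. f \<in> carrier M \<rightarrow> carrier N \<and>
        (\<forall>x\<in>carrier M. \<forall>y\<in>carrier M. f (x \<oplus>\<^bsub>M\<^esub> y) = f x \<oplus>\<^bsub>N\<^esub> f y) \<and>
        (\<forall>a\<in>carrier R. \<forall>x\<in>carrier M. f (a \<odot>\<^bsub>M\<^esub> x) = a \<odot>\<^bsub>N\<^esub> f x)}"

definition seemingly_divisible ::
  "('a, 'm, 's) module_scheme \<Rightarrow> ('a, 'n, 't) module_scheme \<Rightarrow> ('m \<Rightarrow> 'n) \<Rightarrow> 'a \<Rightarrow> bool"
  where "seemingly_divisible M N f r \<longleftrightarrow>
    (\<forall>m\<in>carrier M. \<exists>n\<in>carrier N. f m = r \<odot>\<^bsub>N\<^esub> n) \<and>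
    (\<forall>m\<in>carrier M. r \<odot>\<^bsub>M\<^esub> m = \<zero>\<^bsub>M\<^esub> \<longrightarrow> f m = \<zero>\<^bsub>N\<^esub>)"

text \<open>HOL cannot quantify over all types inside a formula, so the types that carry the elements
  of the two modules are parameters. Over a domain \<open>R\<close>, instances carried by the type of \<open>R\<close> itself
  already detect Dedekind domains, while over a Dedekind domain every instance holds. Module elements are related only on the carriers, hence
  the equation between \<open>f\<close> and the multiple of \<open>g\<close> is stated there.\<close>

definition seemingly_divisible_imp_divisible ::
  "('a, 'r) ring_scheme \<Rightarrow> 'm itself \<Rightarrow> 'n itself \<Rightarrow> bool"
  where "seemingly_divisible_imp_divisible R _ _ \<longleftrightarrow>
    (\<forall>r\<in>carrier R. \<forall>(M :: ('a, 'm) module) (N :: ('a, 'n) module).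
       module R M \<longrightarrow> module R N \<longrightarrow>
       (\<forall>f\<in>linear_homs R M N. seemingly_divisible M N f r \<longrightarrow>
          (\<exists>g\<in>linear_homs R M N. \<forall>m\<in>carrier M. f m = r \<odot>\<^bsub>N\<^esub> g m)))"

section \<open>Dedekind domains\<close>

definition frac_rel :: "('a, 'r) ring_scheme \<Rightarrow> (('a \<times> 'a) \<times> ('a \<times> 'a)) set"
  where "frac_rel R =
    {((a, b), (c, d)) | a b c d. a \<in> carrier R \<and> b \<in> carrier R - {\<zero>\<^bsub>R\<^esub>} \<and>
       c \<in> carrier R \<and> d \<in> carrier R - {\<zero>\<^bsub>R\<^esub>} \<and> a \<otimes>\<^bsub>R\<^esub> d = c \<otimes>\<^bsub>R\<^esub> b}"

definition frac :: "('a, 'r) ring_scheme \<Rightarrow> 'a \<Rightarrow> 'a \<Rightarrow> ('a \<times> 'a) set"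
  where "frac R a b = frac_rel R `` {(a, b)}"

text \<open>The unions in the operations are over representatives; in a domain the united sets all coincide.\<close>

definition fraction_field :: "('a, 'r) ring_scheme \<Rightarrow> ('a \<times> 'a) set ring"
  where "fraction_field R =
    \<lparr>carrier = (carrier R \<times> (carrier R - {\<zero>\<^bsub>R\<^esub>})) // frac_rel R,
     mult = (\<lambda>S T. \<Union>(a, b)\<in>S. \<Union>(c, d)\<in>T. frac R (a \<otimes>\<^bsub>R\<^esub> c) (b \<otimes>\<^bsub>R\<^esub> d)),
     one = frac R \<one>\<^bsub>R\<^esub> \<one>\<^bsub>R\<^esub>,
     zero = frac R \<zero>\<^bsub>R\<^esub> \<one>\<^bsub>R\<^esub>,
     add = (\<lambda>S T. \<Union>(a, b)\<in>S. \<Union>(c, d)\<in>T.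
              frac R (a \<otimes>\<^bsub>R\<^esub> d \<oplus>\<^bsub>R\<^esub> c \<otimes>\<^bsub>R\<^esub> b) (b \<otimes>\<^bsub>R\<^esub> d))\<rparr>"

definition frac_embed :: "('a, 'r) ring_scheme \<Rightarrow> 'a \<Rightarrow> ('a \<times> 'a) set"
  where "frac_embed R a = frac R a \<one>\<^bsub>R\<^esub>"

definition integral_over :: "('k, 'r) ring_scheme \<Rightarrow> 'k set \<Rightarrow> 'k \<Rightarrow> bool"
  where "integral_over K A x \<longleftrightarrow>
    (\<exists>p\<in>carrier (A [X]\<^bsub>K\<^esub>). p \<noteq> [] \<and> lead_coeff p = \<one>\<^bsub>K\<^esub> \<and> ring.eval K p x = \<zero>\<^bsub>K\<^esub>)"

definition integrally_closed :: "('a, 'r) ring_scheme \<Rightarrow> bool"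
  where "integrally_closed R \<longleftrightarrow>
    (\<forall>x\<in>carrier (fraction_field R).
       integral_over (fraction_field R) (frac_embed R ` carrier R) x \<longrightarrow>
       x \<in> frac_embed R ` carrier R)"

text \<open>The dimension condition is vacuous for fields, which are therefore Dedekind domains.\<close>

locale dedekind_domain = noetherian_domain R for R (structure) +
  assumes integrally_closed: "integrally_closed R"
    and nonzero_prime_maximal: "\<lbrakk>primeideal P R; P \<noteq> {\<zero>}\<rbrakk> \<Longrightarrow> maximalideal P R"

end

theory Submission
  imports Defs "HOL-Algebra.Ideal_Product" "HOL-Library.Equipollence"
begin

text \<open>From divisibility to Dedekind: let \<open>I\<close> be an ideal, \<open>0 \<noteq> r \<in> I\<close>, \<open>F\<close> the free module on the set
  \<open>I\<close> with basis \<open>e\<^sub>i\<close>, and \<open>K\<close> the kernel of \<open>F \<rightarrow> I\<close>. The map \<open>I \<rightarrow> F / r K\<close>, \<open>i \<mapsto> r e\<^sub>i\<close>, is linear and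
  seemingly divisible by \<open>r\<close>. If it is \<open>r\<close> times \<open>g\<close> and \<open>g r\<close> is the class of \<open>G\<close>, then comparing
  \<open>r (g i) = i (g r)\<close> coordinatewise gives \<open>G\<^sub>j I \<subseteq> r R\<close>, while \<open>r = (\<Sum>j. G\<^sub>j j)\<close>; so \<open>I\<close> is invertible. If
  \<open>R\<close> is infinite, \<open>F / r K\<close> has at most as many elements as \<open>R\<close>; a finite domain is a field.

  From Dedekind to divisibility: let \<open>E\<close> be the module of all \<open>(m, n)\<close> with \<open>f m = r n\<close> and \<open>T\<close> its
  submodule of all \<open>(0, n)\<close>. A complement of \<open>T\<close> is the graph of some \<open>g\<close> with \<open>f = r g\<close>. Seeming
  divisibility makes \<open>T\<close> pure in \<open>E\<close>, and \<open>r T = 0\<close>. A submodule \<open>C\<close> maximal among those for which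
  \<open>T \<rightarrow> E / C\<close> is locally pure is a complement: otherwise some \<open>z \<notin> C + T\<close> has \<open>P z \<subseteq> C\<close> for a maximal
  ideal \<open>P\<close>, and one of maximal \<open>P\<close>-height can be added to \<open>C\<close>.\<close>

section \<open>The field of fractions and integral closedness\<close>

text \<open>In the first half the obstacle is the type of the modules: the hypothesis covers only
  modules on the type of \<open>R\<close>, while cosets of \<open>F\<close> live on another type. So
  \<open>F / r K\<close> is transported along an injection of \<open>F\<close> into the carrier of
  \<open>R\<close>. The factor \<open>r\<close> in \<open>r K\<close> is harmless because
  \<open>F\<close> is torsion-free: modulo \<open>r K\<close>, the class of \<open>r x\<close>
  determines exactly the image of \<open>x\<close> in \<open>I\<close>. In the second half the two
  parts of seeming divisibility have separate tasks: divisibility of the values of \<open>f\<close>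
  makes \<open>E \<rightarrow> M\<close> onto, and vanishing on \<open>r\<close>-torsion makes
  \<open>T\<close> pure. As \<open>E\<close> itself need not be bounded, \<open>C\<close> is sought
  among submodules containing \<open>r E\<close>; the exponent of \<open>P\<close> in
  \<open>r\<close> then bounds all heights modulo \<open>C\<close>, so that a maximal height exists.
  Integral closedness makes \<open>P\<close> locally principal, and the Noetherian condition with
  dimension one yields elements whose annihilator is maximal. Neither fractional ideals nor
  localizations are formed: inverse ideals are scaled into \<open>R\<close>, and inverting elements
  outside \<open>P\<close> is replaced by multiplying with them.\<close>

context domain
begin

lemma frac_rel_equiv: "equiv (carrier R \<times> (carrier R - {\<zero>})) (frac_rel R)"
proof (rule equivI)
  show "frac_rel R \<subseteq> (carrier R \<times> (carrier R - {\<zero>})) \<times> (carrier R \<times> (carrier R - {\<zero>}))"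
    by (auto simp: frac_rel_def)
  show "refl_on (carrier R \<times> (carrier R - {\<zero>})) (frac_rel R)"
    by (auto simp: refl_on_def frac_rel_def)
  show "sym (frac_rel R)"
    by (auto simp: sym_def frac_rel_def)
  show "trans (frac_rel R)"
  proof (rule transI)
    fix x y z assume "(x, y) \<in> frac_rel R" "(y, z) \<in> frac_rel R"
    then obtain a b c d e f where xyz: "x = (a, b)" "y = (c, d)" "z = (e, f)"
      and *: "a \<in> carrier R" "b \<in> carrier R" "c \<in> carrier R" "d \<in> carrier R" "e \<in> carrier R"
        "f \<in> carrier R" and nz: "b \<noteq> \<zero>" "d \<noteq> \<zero>" "f \<noteq> \<zero>"
      and eqs: "a \<otimes> d = c \<otimes> b" "c \<otimes> f = e \<otimes> d"
      unfolding frac_rel_def by auto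
    have "d \<otimes> (a \<otimes> f) = (a \<otimes> d) \<otimes> f" using * by (simp add: m_ac)
    also have "\<dots> = (c \<otimes> f) \<otimes> b" unfolding eqs(1) using * by (simp add: m_ac)
    also have "\<dots> = d \<otimes> (e \<otimes> b)" unfolding eqs(2) using * by (simp add: m_ac)
    finally have "a \<otimes> f = e \<otimes> b" using * nz by (simp add: m_lcancel)
    then show "(x, z) \<in> frac_rel R"
      using * nz unfolding xyz frac_rel_def by blast
  qed
qed

lemma frac_eq_iff:
  assumes "a \<in> carrier R" "b \<in> carrier R - {\<zero>}" "c \<in> carrier R" "d \<in> carrier R - {\<zero>}"
  shows "frac R a b = frac R c d \<longleftrightarrow> a \<otimes> d = c \<otimes> b"
  unfolding frac_def using assms by (subst eq_equiv_class_iff[OF frac_rel_equiv]) (auto simp: frac_rel_def)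

lemma frac_in_carrier:
  assumes "a \<in> carrier R" "b \<in> carrier R - {\<zero>}"
  shows "frac R a b \<in> carrier (fraction_field R)"
  using assms by (auto simp: fraction_field_def frac_def intro!: quotientI)

lemma fraction_fieldE:
  assumes "x \<in> carrier (fraction_field R)"
  obtains a b where "a \<in> carrier R" "b \<in> carrier R - {\<zero>}" "x = frac R a b"
  using assms by (auto simp: fraction_field_def frac_def elim!: quotientE)

text \<open>Well-definedness in reusable form: a union over a nonempty class of a family constant on
  the class is that constant. Two nested applications evaluate the operations of
  \<open>fraction_field\<close> on representatives.\<close>

lemma UN_frac:
  assumes "a \<in> carrier R" "b \<in> carrier R - {\<zero>}"
    and "\<And>c d. c \<in> carrier R \<Longrightarrow> d \<in> carrier R - {\<zero>} \<Longrightarrow> a \<otimes> d = c \<otimes> b \<Longrightarrow> f c d = S"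
  shows "(\<Union>(c, d)\<in>frac R a b. f c d) = S"
proof -
  have "(a, b) \<in> frac R a b"
    using assms(1,2) by (simp add: frac_def frac_rel_def)
  moreover have "\<forall>p\<in>frac R a b. (case p of (c, d) \<Rightarrow> f c d) = S"
    using assms by (simp add: frac_def frac_rel_def Image_def split_beta)
  ultimately show ?thesis by auto
qed

lemma frac_mult:
  assumes "a \<in> carrier R" "b \<in> carrier R - {\<zero>}" "c \<in> carrier R" "d \<in> carrier R - {\<zero>}"
  shows "frac R a b \<otimes>\<^bsub>fraction_field R\<^esub> frac R c d = frac R (a \<otimes> c) (b \<otimes> d)"
  unfolding fraction_field_def monoid.simps
proof (intro UN_frac)
  fix a' b' c' d'
  assume *: "a' \<in> carrier R" "b' \<in> carrier R - {\<zero>}" "a \<otimes> b' = a' \<otimes> b"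
    "c' \<in> carrier R" "d' \<in> carrier R - {\<zero>}" "c \<otimes> d' = c' \<otimes> d"
  note carr = assms *(1,2,4,5)
  have "(a' \<otimes> c') \<otimes> (b \<otimes> d) = (a' \<otimes> b) \<otimes> (c' \<otimes> d)" using carr by (simp add: m_ac)
  also have "\<dots> = (a \<otimes> b') \<otimes> (c \<otimes> d')" using * by simp
  also have "\<dots> = (a \<otimes> c) \<otimes> (b' \<otimes> d')" using carr by (simp add: m_ac)
  finally show "frac R (a' \<otimes> c') (b' \<otimes> d') = frac R (a \<otimes> c) (b \<otimes> d)"
    using * assms by (subst frac_eq_iff) (auto simp: integral_iff)
qed (use assms in auto)

lemma frac_add:
  assumes "a \<in> carrier R" "b \<in> carrier R - {\<zero>}" "c \<in> carrier R" "d \<in> carrier R - {\<zero>}"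
  shows "frac R a b \<oplus>\<^bsub>fraction_field R\<^esub> frac R c d = frac R (a \<otimes> d \<oplus> c \<otimes> b) (b \<otimes> d)"
  unfolding fraction_field_def ring_record_simps
proof (intro UN_frac)
  fix a' b' c' d'
  assume *: "a' \<in> carrier R" "b' \<in> carrier R - {\<zero>}" "a \<otimes> b' = a' \<otimes> b"
    "c' \<in> carrier R" "d' \<in> carrier R - {\<zero>}" "c \<otimes> d' = c' \<otimes> d"
  note carr = assms *(1,2,4,5)
  have "(a' \<otimes> d' \<oplus> c' \<otimes> b') \<otimes> (b \<otimes> d) = (a' \<otimes> b) \<otimes> (d \<otimes> d') \<oplus> (c' \<otimes> d) \<otimes> (b \<otimes> b')"
    using carr by (simp add: m_ac l_distr r_distr)
  also have "\<dots> = (a \<otimes> b') \<otimes> (d \<otimes> d') \<oplus> (c \<otimes> d') \<otimes> (b \<otimes> b')" using * by simp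
  also have "\<dots> = (a \<otimes> d \<oplus> c \<otimes> b) \<otimes> (b' \<otimes> d')" using carr by (simp add: m_ac l_distr r_distr)
  finally show "frac R (a' \<otimes> d' \<oplus> c' \<otimes> b') (b' \<otimes> d') = frac R (a \<otimes> d \<oplus> c \<otimes> b) (b \<otimes> d)"
    using * assms by (subst frac_eq_iff) (auto simp: integral_iff)
qed (use assms in auto)

lemma fraction_field_one: "\<one>\<^bsub>fraction_field R\<^esub> = frac R \<one> \<one>"
  and fraction_field_zero: "\<zero>\<^bsub>fraction_field R\<^esub> = frac R \<zero> \<one>"
  by (simp_all add: fraction_field_def)

lemma fraction_field_cring: "cring (fraction_field R)"
proof (rule cringI)
  show "abelian_group (fraction_field R)"
  proof (rule abelian_groupI)
    fix x y z assume "x \<in> carrier (fraction_field R)" "y \<in> carrier (fraction_field R)"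
      "z \<in> carrier (fraction_field R)"
    then show "x \<oplus>\<^bsub>fraction_field R\<^esub> y \<oplus>\<^bsub>fraction_field R\<^esub> z
             = x \<oplus>\<^bsub>fraction_field R\<^esub> (y \<oplus>\<^bsub>fraction_field R\<^esub> z)"
      by (elim fraction_fieldE) (simp add: frac_add integral_iff l_distr r_distr m_ac a_ac)
  next
    fix x assume "x \<in> carrier (fraction_field R)"
    then obtain a b where ab: "a \<in> carrier R" "b \<in> carrier R - {\<zero>}" "x = frac R a b"
      by (rule fraction_fieldE)
    show "\<exists>y\<in>carrier (fraction_field R). y \<oplus>\<^bsub>fraction_field R\<^esub> x = \<zero>\<^bsub>fraction_field R\<^esub>"
      using ab by (intro bexI[of _ "frac R (\<ominus> a) b"])
        (simp_all add: frac_add frac_in_carrier fraction_field_zero frac_eq_iff integral_iff l_minus l_neg)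
  next
    fix x y assume "x \<in> carrier (fraction_field R)" "y \<in> carrier (fraction_field R)"
    then show "x \<oplus>\<^bsub>fraction_field R\<^esub> y \<in> carrier (fraction_field R)"
      by (elim fraction_fieldE) (simp add: frac_add integral_iff frac_in_carrier)
  next
    fix x y assume "x \<in> carrier (fraction_field R)" "y \<in> carrier (fraction_field R)"
    then show "x \<oplus>\<^bsub>fraction_field R\<^esub> y = y \<oplus>\<^bsub>fraction_field R\<^esub> x"
      by (elim fraction_fieldE) (simp add: frac_add a_comm m_comm)
  next
    fix x assume "x \<in> carrier (fraction_field R)"
    then show "\<zero>\<^bsub>fraction_field R\<^esub> \<oplus>\<^bsub>fraction_field R\<^esub> x = x"
      by (elim fraction_fieldE) (simp add: frac_add fraction_field_zero)
  qed (simp add: fraction_field_zero frac_in_carrier)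
  show "comm_monoid (fraction_field R)"
    by (rule comm_monoidI; (elim fraction_fieldE)?)
      (auto simp: frac_mult integral_iff frac_in_carrier frac_eq_iff fraction_field_one m_ac)
next
  fix x y z assume "x \<in> carrier (fraction_field R)" "y \<in> carrier (fraction_field R)"
      "z \<in> carrier (fraction_field R)"
  then show "(x \<oplus>\<^bsub>fraction_field R\<^esub> y) \<otimes>\<^bsub>fraction_field R\<^esub> z
             = x \<otimes>\<^bsub>fraction_field R\<^esub> z \<oplus>\<^bsub>fraction_field R\<^esub> y \<otimes>\<^bsub>fraction_field R\<^esub> z"
    by (elim fraction_fieldE) (simp add: frac_add frac_mult frac_eq_iff integral_iff l_distr r_distr m_ac)
qed

lemma frac_embed_in_carrier: "a \<in> carrier R \<Longrightarrow> frac_embed R a \<in> carrier (fraction_field R)"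
  by (simp add: frac_embed_def frac_in_carrier)

lemma frac_embed_mult:
  "a \<in> carrier R \<Longrightarrow> b \<in> carrier R \<Longrightarrow>
   frac_embed R (a \<otimes> b) = frac_embed R a \<otimes>\<^bsub>fraction_field R\<^esub> frac_embed R b"
  by (simp add: frac_embed_def frac_mult)

lemma frac_embed_add:
  "a \<in> carrier R \<Longrightarrow> b \<in> carrier R \<Longrightarrow>
   frac_embed R (a \<oplus> b) = frac_embed R a \<oplus>\<^bsub>fraction_field R\<^esub> frac_embed R b"
  by (simp add: frac_embed_def frac_add)

lemma frac_embed_eq_iff:
  "a \<in> carrier R \<Longrightarrow> b \<in> carrier R \<Longrightarrow> frac_embed R a = frac_embed R b \<longleftrightarrow> a = b"
  by (simp add: frac_embed_def frac_eq_iff)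

lemma frac_embed_zero: "frac_embed R \<zero> = \<zero>\<^bsub>fraction_field R\<^esub>"
  and frac_embed_one: "frac_embed R \<one> = \<one>\<^bsub>fraction_field R\<^esub>"
  by (simp_all add: frac_embed_def fraction_field_def)

lemma frac_embed_mult_frac:
  assumes "a \<in> carrier R" "b \<in> carrier R - {\<zero>}"
  shows "frac_embed R b \<otimes>\<^bsub>fraction_field R\<^esub> frac R a b = frac_embed R a"
  using assms by (simp add: frac_embed_def frac_mult frac_eq_iff m_comm)

text \<open>Takes the place of inverses: clearing denominators only has to cancel nonzero elements
  of \<open>R\<close>.\<close>

lemma frac_embed_cancel:
  assumes "x \<in> carrier (fraction_field R)" "b \<in> carrier R - {\<zero>}"
    "frac_embed R b \<otimes>\<^bsub>fraction_field R\<^esub> x = \<zero>\<^bsub>fraction_field R\<^esub>"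
  shows "x = \<zero>\<^bsub>fraction_field R\<^esub>"
  using assms by (elim fraction_fieldE)
    (auto simp: frac_embed_def frac_mult frac_eq_iff fraction_field_zero integral_iff)

end

text \<open>For \<open>rs = [r\<^sub>1, \<dots>, r\<^sub>n]\<close> this is the form \<open>r\<^sub>1 a\<^sup>n\<^sup>-\<^sup>1 + r\<^sub>2 a\<^sup>n\<^sup>-\<^sup>2 b + \<dots> + r\<^sub>n b\<^sup>n\<^sup>-\<^sup>1\<close>.\<close>
primrec (in ring) homog_eval :: "'a list \<Rightarrow> 'a \<Rightarrow> 'a \<Rightarrow> 'a" where
  "homog_eval [] a b = \<zero>"
| "homog_eval (r # rs) a b = r \<otimes> a [^] length rs \<oplus> b \<otimes> homog_eval rs a b"

context cring
begin

lemma homog_eval_closed [simp]: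
  "set rs \<subseteq> carrier R \<Longrightarrow> a \<in> carrier R \<Longrightarrow> b \<in> carrier R \<Longrightarrow> homog_eval rs a b \<in> carrier R"
  by (induction rs) auto

text \<open>Together with \<open>homog_eval_smult\<close> this makes the values on coefficient lists
  of a fixed length closed under sums and multiples, which is how ideals arise from them.\<close>

lemma homog_eval_add:
  assumes "length rs = length ss" "set rs \<subseteq> carrier R" "set ss \<subseteq> carrier R"
    "a \<in> carrier R" "b \<in> carrier R"
  shows "homog_eval (map2 (\<oplus>) rs ss) a b = homog_eval rs a b \<oplus> homog_eval ss a b"
  using assms by (induction rs ss rule: list_induct2) (auto simp: l_distr r_distr a_ac)

lemma homog_eval_smult:
  assumes "set rs \<subseteq> carrier R" "a \<in> carrier R" "b \<in> carrier R" "c \<in> carrier R"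
  shows "homog_eval (map ((\<otimes>) c) rs) a b = c \<otimes> homog_eval rs a b"
  using assms by (induction rs) (auto simp: r_distr m_ac)

text \<open>Multiplication by \<open>a\<close> shifts the coefficients by one place; this is the
  action of \<open>a / b\<close> on \<open>R[a / b]\<close> with denominators cleared.\<close>

lemma homog_eval_snoc_zero:
  assumes "set rs \<subseteq> carrier R" "a \<in> carrier R" "b \<in> carrier R"
  shows "homog_eval (rs @ [\<zero>]) a b = a \<otimes> homog_eval rs a b"
  using assms by (induction rs) (auto simp: r_distr m_ac)

lemma homog_eval_zeros:
  assumes "a \<in> carrier R" "b \<in> carrier R"
  shows "homog_eval (replicate n \<zero>) a b = \<zero>"
  using assms by (induction n) auto

lemma homog_eval_zeros_snoc_one:
  assumes "a \<in> carrier R" "b \<in> carrier R"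
  shows "homog_eval (replicate n \<zero> @ [\<one>]) a b = b [^] n"
  using assms by (induction n) (auto simp: m_comm)

end

context domain
begin

lemma nat_pow_nonzero:
  "a \<in> carrier R - {\<zero>} \<Longrightarrow> a [^] (n::nat) \<in> carrier R - {\<zero>}"
  by (induction n) (auto simp: integral_iff)

interpretation K: cring "fraction_field R" by (rule fraction_field_cring)

lemma set_map_frac_embed:
  "set rs \<subseteq> carrier R \<Longrightarrow> set (map (frac_embed R) rs) \<subseteq> carrier (fraction_field R)"
  by (auto simp: frac_embed_in_carrier)

lemma frac_embed_pow:
  "a \<in> carrier R \<Longrightarrow> frac_embed R (a [^] (n::nat)) = frac_embed R a [^]\<^bsub>fraction_field R\<^esub> n"
  by (induction n) (auto simp: frac_embed_mult frac_embed_one)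

text \<open>Clearing denominators: \<open>n\<close> coefficients mean degree at most
  \<open>n - 1\<close>, so one factor \<open>b\<close> is left over on the right. Keeping it avoids
  a truncated exponent and covers the empty list.\<close>

lemma eval_frac:
  assumes "set rs \<subseteq> carrier R" "a \<in> carrier R" "b \<in> carrier R - {\<zero>}"
  shows "frac_embed R (b [^] length rs) \<otimes>\<^bsub>fraction_field R\<^esub>
           K.eval (map (frac_embed R) rs) (frac R a b) = frac_embed R (b \<otimes> homog_eval rs a b)"
  using assms(1)
proof (induction rs)
  case Nil
  then show ?case using assms(2,3) by (simp add: frac_embed_zero frac_embed_in_carrier)
next
  case (Cons r rs)
  let ?K = "fraction_field R" and ?e = "frac_embed R" and ?x = "frac R a b" and ?m = "length rs"
  let ?E = "K.eval (map ?e rs) ?x"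
  have c: "?e r \<in> carrier ?K" "?e b \<in> carrier ?K" "?x \<in> carrier ?K" "?E \<in> carrier ?K"
      "b \<in> carrier R" "r \<in> carrier R" "set rs \<subseteq> carrier R"
    using Cons.prems assms K.eval_in_carrier[OF set_map_frac_embed, of rs ?x]
    by (auto simp: frac_embed_in_carrier frac_in_carrier)
  have pw: "?e b [^]\<^bsub>?K\<^esub> ?m \<otimes>\<^bsub>?K\<^esub> ?x [^]\<^bsub>?K\<^esub> ?m = ?e a [^]\<^bsub>?K\<^esub> ?m"
    using c assms by (simp add: K.nat_pow_distrib[symmetric] frac_embed_mult_frac)
  have "?e (b [^] Suc ?m) \<otimes>\<^bsub>?K\<^esub> K.eval (map ?e (r # rs)) ?x
     = (?e b [^]\<^bsub>?K\<^esub> ?m \<otimes>\<^bsub>?K\<^esub> ?e b) \<otimes>\<^bsub>?K\<^esub> (?e r \<otimes>\<^bsub>?K\<^esub> ?x [^]\<^bsub>?K\<^esub> ?m \<oplus>\<^bsub>?K\<^esub> ?E)"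
    using c by (simp add: frac_embed_pow frac_embed_mult)
  also have "\<dots> = ?e b \<otimes>\<^bsub>?K\<^esub> (?e r \<otimes>\<^bsub>?K\<^esub> (?e b [^]\<^bsub>?K\<^esub> ?m \<otimes>\<^bsub>?K\<^esub> ?x [^]\<^bsub>?K\<^esub> ?m))
      \<oplus>\<^bsub>?K\<^esub> ?e b \<otimes>\<^bsub>?K\<^esub> (?e (b [^] ?m) \<otimes>\<^bsub>?K\<^esub> ?E)"
    using c by (simp add: frac_embed_pow K.r_distr K.m_ac)
  also have "?e (b [^] ?m) \<otimes>\<^bsub>?K\<^esub> ?E = ?e (b \<otimes> homog_eval rs a b)"
    using Cons by simp
  also have "?e b \<otimes>\<^bsub>?K\<^esub> (?e r \<otimes>\<^bsub>?K\<^esub> (?e b [^]\<^bsub>?K\<^esub> ?m \<otimes>\<^bsub>?K\<^esub> ?x [^]\<^bsub>?K\<^esub> ?m))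
      = ?e (b \<otimes> (r \<otimes> a [^] ?m))"
    unfolding pw using c assms by (simp add: frac_embed_mult frac_embed_pow)
  finally show ?case
    using c assms by (simp add: frac_embed_mult[symmetric] frac_embed_add[symmetric] r_distr)
qed

text \<open>The list \<open>rs\<close> holds the coefficients below the leading
  \<open>\<one>\<close>; the left side of the equation is
  \<open>homog_eval (\<one> # rs) a b\<close>.\<close>

lemma integral_over_frac_iff:
  assumes "a \<in> carrier R" "b \<in> carrier R - {\<zero>}"
  shows "integral_over (fraction_field R) (frac_embed R ` carrier R) (frac R a b) \<longleftrightarrow>
    (\<exists>rs. set rs \<subseteq> carrier R \<and> a [^] length rs \<oplus> b \<otimes> homog_eval rs a b = \<zero>)"
proof -
  let ?K = "fraction_field R" and ?e = "frac_embed R" and ?x = "frac R a b"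
  have eval_iff: "K.eval (map ?e rs) ?x = \<zero>\<^bsub>?K\<^esub> \<longleftrightarrow> homog_eval rs a b = \<zero>" if rs: "set rs \<subseteq> carrier R" for rs
  proof -
    have x: "K.eval (map ?e rs) ?x \<in> carrier ?K"
      using assms by (intro K.eval_in_carrier set_map_frac_embed rs frac_in_carrier)
    have "b [^] length rs \<in> carrier R - {\<zero>}"
      using assms nat_pow_nonzero by blast
    then have "K.eval (map ?e rs) ?x = \<zero>\<^bsub>?K\<^esub> \<longleftrightarrow>
        ?e (b [^] length rs) \<otimes>\<^bsub>?K\<^esub> K.eval (map ?e rs) ?x = \<zero>\<^bsub>?K\<^esub>"
      using frac_embed_cancel[OF x] by (auto simp: frac_embed_in_carrier)
    also have "\<dots> \<longleftrightarrow> ?e (b \<otimes> homog_eval rs a b) = ?e \<zero>"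
      by (simp only: eval_frac[OF rs assms] frac_embed_zero)
    also have "\<dots> \<longleftrightarrow> homog_eval rs a b = \<zero>"
      using assms rs by (subst frac_embed_eq_iff) (auto simp: integral_iff)
    finally show ?thesis .
  qed
  \<comment> \<open>\<open>polynomial\<close> demands a nonzero leading coefficient, so a monic list
    qualifies only if \<open>1\<close> differs from \<open>0\<close> in the fraction field.\<close>
  have one: "\<one>\<^bsub>?K\<^esub> \<noteq> \<zero>\<^bsub>?K\<^esub>"
    by (simp add: frac_embed_one[symmetric] frac_embed_zero[symmetric] frac_embed_eq_iff)
  show ?thesis
  proof
    assume "integral_over ?K (?e ` carrier R) ?x"
    then obtain p where p: "polynomial\<^bsub>?K\<^esub> (?e ` carrier R) p" "p \<noteq> []" "lead_coeff p = \<one>\<^bsub>?K\<^esub>"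
        "K.eval p ?x = \<zero>\<^bsub>?K\<^esub>"
      by (auto simp: integral_over_def univ_poly_carrier[symmetric])
    have "set (tl p) \<subseteq> ?e ` carrier R"
      using p by (auto simp: polynomial_def dest: list.set_sel(2))
    then have "tl p \<in> map ?e ` lists (carrier R)"
      by (auto simp: lists_image[symmetric])
    then obtain rs where rs: "tl p = map ?e rs" "set rs \<subseteq> carrier R"
      by (auto simp: lists_eq_set)
    have "p = map ?e (\<one> # rs)"
      using p(2,3) rs(1) by (cases p) (simp_all add: frac_embed_one)
    then have "K.eval (map ?e (\<one> # rs)) ?x = \<zero>\<^bsub>?K\<^esub>"
      using p(4) by (simp only:)
    then have "homog_eval (\<one> # rs) a b = \<zero>"
      using rs(2) by (subst (asm) eval_iff) simp_all
    then show "\<exists>rs. set rs \<subseteq> carrier R \<and> a [^] length rs \<oplus> b \<otimes> homog_eval rs a b = \<zero>"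
      using rs assms by (intro exI[of _ rs]) simp
  next
    assume "\<exists>rs. set rs \<subseteq> carrier R \<and> a [^] length rs \<oplus> b \<otimes> homog_eval rs a b = \<zero>"
    then obtain rs where rs: "set rs \<subseteq> carrier R" "a [^] length rs \<oplus> b \<otimes> homog_eval rs a b = \<zero>"
      by blast
    let ?p = "map ?e (\<one> # rs)"
    have "K.eval ?p ?x = \<zero>\<^bsub>?K\<^esub>"
      using rs assms by (subst eval_iff) auto
    moreover have "polynomial\<^bsub>?K\<^esub> (?e ` carrier R) ?p"
      using rs(1) one frac_embed_one unfolding polynomial_def by auto
    ultimately show "integral_over ?K (?e ` carrier R) ?x"
      unfolding integral_over_def
      by (intro bexI[of _ ?p]) (auto simp: frac_embed_one univ_poly_carrier[symmetric])
  qed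
qed

lemma frac_in_frac_embed_iff:
  assumes "a \<in> carrier R" "b \<in> carrier R - {\<zero>}"
  shows "frac R a b \<in> frac_embed R ` carrier R \<longleftrightarrow> b divides a"
  using assms by (auto simp: frac_embed_def frac_eq_iff factor_def m_comm image_iff)

text \<open>Eliminates the fraction field: integrality of \<open>a / b\<close> becomes an equation
  in \<open>R\<close>, and lying in \<open>R\<close> becomes divisibility.\<close>

lemma integrally_closed_iff:
  "integrally_closed R \<longleftrightarrow>
    (\<forall>a\<in>carrier R. \<forall>b\<in>carrier R - {\<zero>}. \<forall>rs. set rs \<subseteq> carrier R \<longrightarrow>
       a [^] length rs \<oplus> b \<otimes> homog_eval rs a b = \<zero> \<longrightarrow> b divides a)"
proof -
  have "carrier (fraction_field R) = (\<Union>a\<in>carrier R. \<Union>b\<in>carrier R - {\<zero>}. {frac R a b})"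
    by (auto intro: frac_in_carrier elim!: fraction_fieldE)
  then show ?thesis
    unfolding integrally_closed_def
    by (simp only: ball_simps UN_ball_bex_simps integral_over_frac_iff frac_in_frac_embed_iff cong: ball_cong) blast
qed

end

section \<open>Invertible ideals\<close>

definition (in ring) multipliers :: "'a \<Rightarrow> 'a set \<Rightarrow> 'a set"
  where "multipliers r I = {a \<in> carrier R. \<forall>i\<in>I. r divides a \<otimes> i}"

text \<open>For a nonzero ideal \<open>I\<close> this says \<open>I\<^sup>-\<^sup>1 I = R\<close>, since \<open>multipliers r I = r I\<^sup>-\<^sup>1\<close>.\<close>
definition (in ring) ideals_invertible :: bool where
  "ideals_invertible \<longleftrightarrow> (\<forall>I r. ideal I R \<longrightarrow> r \<in> I \<longrightarrow> r \<noteq> \<zero> \<longrightarrow> r \<in> multipliers r I \<cdot> I)"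

context domain
begin

text \<open>Write \<open>r\<close> as a finite sum of products \<open>d j\<close> with
  \<open>j \<in> I\<close> and \<open>d I \<subseteq> r R\<close>. For \<open>i \<in> I\<close> each
  \<open>d i\<close> is \<open>r c\<close>, so \<open>r i\<close> is \<open>r\<close> times a
  combination of the \<open>j\<close>; cancelling \<open>r\<close> shows that these finitely many
  \<open>j\<close> generate \<open>I\<close>.\<close>

lemma ideals_invertible_imp_noetherian:
  assumes inv: ideals_invertible
  shows "noetherian_ring R"
proof (rule noetherian_ringI)
  fix I assume I: "ideal I R"
  interpret I: ideal I R by fact
  show "\<exists>A\<subseteq>carrier R. finite A \<and> I = Idl A"
  proof (cases "I = {\<zero>}")
    case True
    then show ?thesis using genideal_zero by (intro exI[of _ "{\<zero>}"]) auto
  next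
    case False
    then obtain r where r: "r \<in> I" "r \<noteq> \<zero>" using I.zero_closed by blast
    \<comment> \<open>The induction over \<open>multipliers r I \<cdot> I\<close> collects in
      \<open>S\<close> the second factors that occur in \<open>z\<close>.\<close>
    have key: "z \<in> carrier R \<and> (\<exists>S\<subseteq>I. finite S \<and> (\<forall>i\<in>I. \<exists>c\<in>Idl S. z \<otimes> i = r \<otimes> c))"
      if "z \<in> multipliers r I \<cdot> I" for z
      using that
    proof induction
      case (prod d j)
      have "\<exists>c\<in>Idl {j}. d \<otimes> j \<otimes> i = r \<otimes> c" if i: "i \<in> I" for i
      proof -
        obtain c where c: "c \<in> carrier R" "d \<otimes> i = r \<otimes> c"
          using prod i by (auto simp: multipliers_def factor_def)
        have "d \<otimes> j \<otimes> i = d \<otimes> i \<otimes> j"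
          using prod i by (simp add: multipliers_def I.Icarr m_ac)
        also have "\<dots> = r \<otimes> (c \<otimes> j)"
          using c prod r by (simp add: I.Icarr m_assoc)
        finally show ?thesis
          using c prod by (intro bexI[of _ "c \<otimes> j"])
            (auto simp: I.Icarr intro!: ideal.I_l_closed genideal_ideal genideal_self')
      qed
      then show ?case
        using prod by (auto simp: multipliers_def I.Icarr intro!: exI[of _ "{j}"])
    next
      case (sum y z)
      then obtain S T where S: "S \<subseteq> I" "finite S" "\<forall>i\<in>I. \<exists>c\<in>Idl S. y \<otimes> i = r \<otimes> c"
        and T: "T \<subseteq> I" "finite T" "\<forall>i\<in>I. \<exists>c\<in>Idl T. z \<otimes> i = r \<otimes> c"
        by blast
      have ST: "S \<union> T \<subseteq> carrier R" using S T I.a_subset by blast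
      interpret ST: ideal "Idl (S \<union> T)" R by (rule genideal_ideal[OF ST])
      have yz: "\<exists>c\<in>Idl (S \<union> T). (y \<oplus> z) \<otimes> i = r \<otimes> c" if i: "i \<in> I" for i
      proof -
        obtain c d where cd: "c \<in> Idl S" "d \<in> Idl T" "y \<otimes> i = r \<otimes> c" "z \<otimes> i = r \<otimes> d"
          using S T i by blast
        have "Idl S \<subseteq> Idl (S \<union> T)" "Idl T \<subseteq> Idl (S \<union> T)"
          using genideal_self[OF ST] by (simp_all add: genideal_minimal ST.is_ideal)
        then have "c \<in> Idl (S \<union> T)" "d \<in> Idl (S \<union> T)" using cd by blast+
        then show ?thesis
          using cd sum r i by (intro bexI[of _ "c \<oplus> d"]) (auto simp: l_distr r_distr I.Icarr ST.Icarr)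
      qed
      show ?case
        using sum.IH S(1,2) T(1,2) yz by (intro conjI exI[of _ "S \<union> T"]) auto
    qed
    have "r \<in> multipliers r I \<cdot> I"
      using inv I r unfolding ideals_invertible_def by blast
    from key[OF this] obtain S where S: "S \<subseteq> I" "finite S" "\<forall>i\<in>I. \<exists>c\<in>Idl S. r \<otimes> i = r \<otimes> c"
      by blast
    have Sc: "S \<subseteq> carrier R" using S I.a_subset by blast
    interpret S: ideal "Idl S" R by (rule genideal_ideal[OF Sc])
    have "I \<subseteq> Idl S"
    proof
      fix i assume i: "i \<in> I"
      then obtain c where "c \<in> Idl S" "r \<otimes> i = r \<otimes> c" using S by blast
      then show "i \<in> Idl S" using r i by (simp add: m_lcancel I.Icarr S.Icarr)
    qed
    then have "I = Idl S"
      using genideal_minimal[OF I S(1)] by blast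
    then show ?thesis using S Sc by blast
  qed
qed

text \<open>Let \<open>M\<close> properly contain \<open>P\<close> and \<open>m \<in> M\<close> lie
  outside \<open>P\<close>. For \<open>x \<in> P\<close> and \<open>d\<close> with
  \<open>d M \<subseteq> m R\<close>, write \<open>d x = m c\<close>; primeness puts
  \<open>c\<close> in \<open>P\<close>. Summing over a representation of \<open>m\<close> gives
  \<open>x \<in> P M\<close>, so \<open>P \<subseteq> P M\<close>, and cancelling the invertible
  \<open>P\<close> gives \<open>\<one> \<in> M\<close>.\<close>

lemma ideals_invertible_imp_prime_maximal:
  assumes inv: ideals_invertible and P: "primeideal P R" "P \<noteq> {\<zero>}"
  shows "maximalideal P R"
proof -
  interpret P: primeideal P R by fact
  obtain s where s: "s \<in> P" "s \<noteq> \<zero>" using P P.zero_closed by blast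
  show ?thesis
  proof (rule maximalidealI[OF P.is_ideal P.I_notcarr], rule disjCI)
    fix M assume M: "ideal M R" "P \<subseteq> M" "M \<subseteq> carrier R" and "M \<noteq> carrier R"
    interpret M: ideal M R by fact
    have PM: "ideal (P \<cdot> M) R" by (rule ideal_prod_is_ideal[OF P.is_ideal M(1)])
    interpret PM: ideal "P \<cdot> M" R by fact
    show "M = P"
    proof (rule ccontr)
      assume "M \<noteq> P"
      then obtain m where m: "m \<in> M" "m \<notin> P" using M by blast
      then have m0: "m \<noteq> \<zero>" using P.zero_closed by blast
      have P_sub: "x \<in> P \<cdot> M" if x: "x \<in> P" for x
      proof -
        have "z \<in> carrier R \<and> (\<exists>w\<in>P \<cdot> M. x \<otimes> z = m \<otimes> w)" if "z \<in> multipliers m M \<cdot> M" for z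
          using that
        proof induction
          case (prod d j)
          obtain c where c: "c \<in> carrier R" "d \<otimes> x = m \<otimes> c"
            using prod x M(2) unfolding multipliers_def factor_def by blast
          have "m \<otimes> c \<in> P"
            using prod x by (simp add: c(2)[symmetric] multipliers_def P.I_l_closed)
          then have "c \<in> P" using m c P.I_prime M.Icarr by blast
          moreover have "x \<otimes> (d \<otimes> j) = d \<otimes> x \<otimes> j"
            using prod x by (simp add: multipliers_def M.Icarr P.Icarr m_ac)
          then have "x \<otimes> (d \<otimes> j) = m \<otimes> (c \<otimes> j)"
            using c prod m by (simp add: M.Icarr m_assoc)
          ultimately show ?case
            using prod by (auto simp: multipliers_def M.Icarr intro!: ideal_prod.prod)
        next
          case (sum y z)
          then obtain v w where "v \<in> P \<cdot> M" "w \<in> P \<cdot> M" "x \<otimes> y = m \<otimes> v" "x \<otimes> z = m \<otimes> w"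
            by blast
          then show ?case
            using sum x m by (auto intro!: bexI[of _ "v \<oplus> w"] simp: r_distr P.Icarr M.Icarr PM.Icarr)
        qed
        moreover have "m \<in> multipliers m M \<cdot> M"
          using inv M(1) m m0 unfolding ideals_invertible_def by blast
        ultimately obtain w where "w \<in> P \<cdot> M" "x \<otimes> m = m \<otimes> w"
          by blast
        then show ?thesis
          using m m0 x by (metis M.Icarr P.Icarr PM.Icarr m_comm m_lcancel)
      qed
      \<comment> \<open>This is \<open>P\<^sup>-\<^sup>1 (P M) \<subseteq> M\<close>, scaled by
        \<open>s\<close>.\<close>
      have ds: "\<exists>w\<in>M. d \<otimes> z = s \<otimes> w" if d: "d \<in> multipliers s P" and "z \<in> P \<cdot> M" for d z
        using that(2)
      proof induction
        case (prod i j)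
        obtain c where c: "c \<in> carrier R" "d \<otimes> i = s \<otimes> c"
          using prod d by (auto simp: multipliers_def factor_def)
        have "d \<otimes> (i \<otimes> j) = d \<otimes> i \<otimes> j"
          using prod d by (simp add: multipliers_def M.Icarr P.Icarr m_assoc)
        then show ?case
          using c prod s by (intro bexI[of _ "c \<otimes> j"]) (auto simp: M.Icarr P.Icarr m_assoc M.I_l_closed)
      next
        case (sum y z)
        then obtain v w where "v \<in> M" "w \<in> M" "d \<otimes> y = s \<otimes> v" "d \<otimes> z = s \<otimes> w"
          by blast
        then show ?case
          using sum d s by (intro bexI[of _ "v \<oplus> w"]) (auto simp: multipliers_def r_distr P.Icarr M.Icarr PM.Icarr)
      qed
      have "\<exists>w\<in>M. z = s \<otimes> w" if "z \<in> multipliers s P \<cdot> P" for z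
        using that
      proof induction
        case (prod i j)
        then show ?case using ds P_sub by blast
      next
        case (sum y z)
        then show ?case using s by (metis M.Icarr M.a_closed P.Icarr r_distr)
      qed
      moreover have "s \<in> multipliers s P \<cdot> P"
        using inv P.is_ideal s unfolding ideals_invertible_def by blast
      ultimately obtain w where w: "w \<in> M" "s = s \<otimes> w"
        by blast
      then have "w = \<one>" using s by (metis M.Icarr P.Icarr m_lcancel one_closed r_one)
      then show False using w M.one_imp_carrier \<open>M \<noteq> carrier R\<close> by blast
    qed
  qed
qed

text \<open>A fraction \<open>x\<close> with \<open>x I \<subseteq> I\<close> for an invertible
  ideal \<open>I\<close> satisfies \<open>x R = x I I\<^sup>-\<^sup>1 \<subseteq> I
  I\<^sup>-\<^sup>1 = R\<close>. Integrality supplies such an ideal.\<close>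

lemma ideals_invertible_imp_integrally_closed:
  assumes inv: ideals_invertible
  shows "integrally_closed R"
  unfolding integrally_closed_iff
proof (intro ballI allI impI)
  fix a b rs
  assume a: "a \<in> carrier R" and b: "b \<in> carrier R - {\<zero>}" and rs: "set rs \<subseteq> carrier R"
    and eq: "a [^] length rs \<oplus> b \<otimes> homog_eval rs a b = \<zero>"
  define n where "n = length rs"
  \<comment> \<open>The multiple of the fractional ideal \<open>R[a / b]\<close> by \<open>b\<^sup>n\<^sup>-\<^sup>1\<close>; it satisfies \<open>a I \<subseteq> b I\<close>.\<close>
  define I where "I = {homog_eval ss a b |ss. length ss = n \<and> set ss \<subseteq> carrier R}"
  have bc: "b \<in> carrier R" using b by blast
  \<comment> \<open>For the empty list the integral equation would read
    \<open>1 = 0\<close>.\<close>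
  have n0: "n \<noteq> 0"
  proof
    assume "n = 0"
    then have "rs = []" by (simp add: n_def)
    then show False using eq bc by simp
  qed
  have add_I: "x \<oplus> y \<in> I" if xy: "x \<in> I" "y \<in> I" for x y
  proof -
    obtain ss ts where "length ss = n" "set ss \<subseteq> carrier R" "x = homog_eval ss a b"
      "length ts = n" "set ts \<subseteq> carrier R" "y = homog_eval ts a b"
      using xy by (auto simp: I_def)
    moreover from this have "set (map2 (\<oplus>) ss ts) \<subseteq> carrier R"
      by (auto elim!: in_set_zipE)
    ultimately show ?thesis
      unfolding I_def using a bc by (auto intro!: exI[of _ "map2 (\<oplus>) ss ts"] simp: homog_eval_add)
  qed
  have smult_I: "c \<otimes> x \<in> I" if xc: "x \<in> I" "c \<in> carrier R" for x c
  proof -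
    obtain ss where "length ss = n" "set ss \<subseteq> carrier R" "x = homog_eval ss a b"
      using xc by (auto simp: I_def)
    moreover from this have "set (map ((\<otimes>) c) ss) \<subseteq> carrier R"
      using xc(2) by auto
    ultimately show ?thesis
      unfolding I_def using a bc xc(2)
      by (auto intro!: exI[of _ "map ((\<otimes>) c) ss"] simp: homog_eval_smult dest: subsetD)
  qed
  have I_carr: "I \<subseteq> carrier R"
    using a bc by (auto simp: I_def)
  have neg_I: "\<ominus> x \<in> I" if "x \<in> I" for x
    using smult_I[OF that, of "\<ominus> \<one>"] that I_carr by (auto simp: l_minus)
  \<comment> \<open>This is the element of \<open>I\<close> belonging to
    \<open>1 \<in> R[a / b]\<close>; it plays the part of \<open>r\<close> in
    \<open>ideals_invertible\<close>. Since \<open>n \<noteq> 0\<close>, the exponent is not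
    truncated.\<close>
  have r_I: "b [^] (n - 1) \<in> I"
    using homog_eval_zeros_snoc_one[OF a bc, of "n - 1"] n0
    by (auto simp: I_def intro!: exI[of _ "replicate (n - 1) \<zero> @ [\<one>]"])
  have I: "ideal I R"
  proof (rule idealI[OF ring_axioms])
    show "subgroup I (add_monoid R)"
      using I_carr r_I add_I neg_I by (intro add.subgroupI) (auto simp: a_inv_def[symmetric])
  qed (use smult_I I_carr in \<open>auto simp: m_comm subset_iff\<close>)
  interpret I: ideal I R by fact
  have aI: "\<exists>y\<in>I. a \<otimes> x = b \<otimes> y" if x: "x \<in> I" for x
  proof -
    obtain ss where ss: "length ss = n" "set ss \<subseteq> carrier R" "x = homog_eval ss a b"
      using x by (auto simp: I_def)
    then obtain s ss' where ss': "ss = s # ss'" using n0 by (cases ss) auto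
    \<comment> \<open>Multiplying by \<open>a\<close> turns the leading term of \<open>x\<close>
      into \<open>s a\<^sup>n\<close>, which the integral equation replaces by \<open>- b s\<close>
      times \<open>homog_eval rs a b\<close>. The remaining terms already contain a factor
      \<open>b\<close> and are shifted by the appended \<open>\<zero>\<close>.\<close>
    define y where "y = homog_eval (ss' @ [\<zero>]) a b \<oplus> \<ominus> s \<otimes> homog_eval rs a b"
    have c: "s \<in> carrier R" "set ss' \<subseteq> carrier R" using ss ss' by auto
    have n: "n = Suc (length ss')" using ss ss' by simp
    have "y \<in> I"
      unfolding y_def
    proof (intro add_I smult_I)
      show "homog_eval (ss' @ [\<zero>]) a b \<in> I"
        unfolding I_def using c n by (intro CollectI exI[of _ "ss' @ [\<zero>]"]) auto
      show "homog_eval rs a b \<in> I"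
        unfolding I_def using rs n_def by blast
    qed (use c in auto)
    moreover have "a \<otimes> x = b \<otimes> y"
    proof -
      have an: "a [^] n = \<ominus> (b \<otimes> homog_eval rs a b)"
        using eq a bc rs unfolding n_def by (intro sum_zero_eq_neg) auto
      have "a \<otimes> x = s \<otimes> a [^] n \<oplus> b \<otimes> (a \<otimes> homog_eval ss' a b)"
        using ss ss' c n a bc by (simp add: r_distr m_ac)
      also have "\<dots> = b \<otimes> y"
        unfolding y_def an using c a bc rs
        by (simp add: homog_eval_snoc_zero r_distr l_minus r_minus m_ac a_comm)
      finally show ?thesis .
    qed
    ultimately show ?thesis by blast
  qed
  let ?r = "b [^] (n - 1)"
  have r: "?r \<in> carrier R - {\<zero>}" using nat_pow_nonzero[OF b] .
  \<comment> \<open>For a product \<open>d j\<close>, first \<open>a j = b y\<close> with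
    \<open>y \<in> I\<close>, then \<open>d y\<close> is a multiple of \<open>?r\<close>. Taking
    \<open>z = ?r\<close> and cancelling will leave \<open>a = b c\<close>.\<close>
  have "z \<in> carrier R \<and> (\<exists>c\<in>carrier R. a \<otimes> z = b \<otimes> ?r \<otimes> c)" if "z \<in> multipliers ?r I \<cdot> I" for z
    using that
  proof induction
    case (prod d j)
    obtain y where y: "y \<in> I" "a \<otimes> j = b \<otimes> y" using aI prod by blast
    obtain c where c: "c \<in> carrier R" "d \<otimes> y = ?r \<otimes> c"
      using prod y by (auto simp: multipliers_def factor_def)
    have carr: "d \<in> carrier R" "j \<in> carrier R" "y \<in> carrier R"
      using prod y I_carr by (auto simp: multipliers_def)
    have "a \<otimes> (d \<otimes> j) = d \<otimes> (a \<otimes> j)" using carr a by (simp add: m_ac)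
    also have "\<dots> = b \<otimes> (d \<otimes> y)" unfolding y using carr bc by (simp add: m_ac)
    also have "\<dots> = b \<otimes> ?r \<otimes> c" unfolding c using c bc by (simp add: m_assoc)
    finally show ?case using c carr by auto
  next
    case (sum y z)
    then obtain c d where "c \<in> carrier R" "d \<in> carrier R" "a \<otimes> y = b \<otimes> ?r \<otimes> c" "a \<otimes> z = b \<otimes> ?r \<otimes> d"
      by blast
    then show ?case using sum a bc by (auto intro!: bexI[of _ "c \<oplus> d"] simp: r_distr)
  qed
  moreover have "?r \<in> multipliers ?r I \<cdot> I"
    using inv I r_I r unfolding ideals_invertible_def by blast
  ultimately obtain c where c: "c \<in> carrier R" "a \<otimes> ?r = b \<otimes> ?r \<otimes> c"
    by blast
  then have "?r \<otimes> a = ?r \<otimes> (b \<otimes> c)" using a bc by (simp add: m_ac)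
  then have "a = b \<otimes> c" using r a bc c by (simp add: m_lcancel)
  then show "b divides a" using c(1) by (rule dividesI[rotated])
qed

lemma ideals_invertible_imp_dedekind:
  assumes inv: ideals_invertible
  shows "dedekind_domain R"
  by (intro dedekind_domain.intro noetherian_domain.intro dedekind_domain_axioms.intro domain_axioms
      ideals_invertible_imp_noetherian ideals_invertible_imp_integrally_closed
      ideals_invertible_imp_prime_maximal inv)

end

section \<open>Quotients of free modules\<close>

lemma infinite_Times_self_eqpoll:
  assumes "infinite A"
  shows "A \<times> A \<approx> A"
  using card_of_Times_same_infinite[OF assms] unfolding eqpoll_def card_of_ordIso .

text \<open>Folding a list with an injection \<open>A \<times> A \<rightarrow> A\<close> is
  injective only among lists of equal length, because the empty list is coded by an element of
  \<open>A\<close>. The length is therefore paired in, through an injection of the naturals into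
  \<open>A\<close>.\<close>

lemma lists_lepoll_infinite:
  assumes "infinite A"
  shows "lists A \<lesssim> A"
proof -
  obtain g where g: "inj_on g (A \<times> A)" "g ` (A \<times> A) \<subseteq> A"
    using infinite_Times_self_eqpoll[OF assms] by (auto simp: eqpoll_def bij_betw_def)
  obtain h :: "nat \<Rightarrow> 'a" where h: "inj h" "range h \<subseteq> A"
    using infinite_countable_subset[OF assms] by blast
  define enc where "enc = rec_list (h 0) (\<lambda>x _ y. g (x, y))"
  have enc: "enc [] = h 0" "\<And>x xs. enc (x # xs) = g (x, enc xs)"
    by (simp_all add: enc_def)
  have enc_A: "enc xs \<in> A" if "xs \<in> lists A" for xs
    using that g h by (induction xs) (auto simp: enc)
  have enc_inj: "xs = ys" if "length xs = length ys" "xs \<in> lists A" "ys \<in> lists A" "enc xs = enc ys" for xs ys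
    using that
  proof (induction xs ys rule: list_induct2)
    case (Cons x xs y ys)
    then have "(x, enc xs) = (y, enc ys)"
      using enc_A by (intro inj_onD[OF g(1)]) (auto simp: enc)
    then show ?case using Cons by auto
  qed simp
  have "inj_on (\<lambda>xs. g (h (length xs), enc xs)) (lists A)"
  proof (rule inj_onI)
    fix xs ys assume *: "xs \<in> lists A" "ys \<in> lists A"
      "g (h (length xs), enc xs) = g (h (length ys), enc ys)"
    then have "(h (length xs), enc xs) = (h (length ys), enc ys)"
      using enc_A h by (intro inj_onD[OF g(1)]) auto
    then show "xs = ys" using * h enc_inj by (auto dest: injD)
  qed
  moreover have "(\<lambda>xs. g (h (length xs), enc xs)) ` lists A \<subseteq> A"
    using g h enc_A by blast
  ultimately show ?thesis unfolding lepoll_def by blast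
qed

text \<open>A finitely supported function is determined by its argument-value pairs on the support,
  a finite subset of \<open>A \<times> A\<close>. Such subsets are sets of lists over
  \<open>A \<times> A\<close>. The set bounded here will contain the free module.\<close>

lemma finite_support_lepoll_infinite:
  assumes "infinite A"
  shows "{f. (\<forall>x\<in>A. f x \<in> A) \<and> {x. f x \<noteq> c} \<subseteq> A \<and> finite {x. f x \<noteq> c}} \<lesssim> A"
proof -
  have "{f. (\<forall>x\<in>A. f x \<in> A) \<and> {x. f x \<noteq> c} \<subseteq> A \<and> finite {x. f x \<noteq> c}}
      \<subseteq> {f. f ` A \<subseteq> A \<and> {x. f x \<noteq> c} \<subseteq> A \<and> finite {x. f x \<noteq> c}}"
    by blast
  then have "{f. (\<forall>x\<in>A. f x \<in> A) \<and> {x. f x \<noteq> c} \<subseteq> A \<and> finite {x. f x \<noteq> c}} \<lesssim> Fpow (A \<times> A)"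
    using lepoll_trans[OF subset_imp_lepoll lepoll_restricted_funspace[of A A "\<lambda>_. c"]] by simp
  also have "Fpow (A \<times> A) = set ` lists (A \<times> A)"
    using finite_list by (fastforce simp: Fpow_def lists_eq_set image_iff)
  also have "set ` lists (A \<times> A) \<lesssim> lists (A \<times> A)"
    by (rule image_lepoll)
  also have "lists (A \<times> A) \<lesssim> lists A"
    using infinite_Times_self_eqpoll[OF assms] by (intro lists_lepoll_mono eqpoll_imp_lepoll)
  also have "lists A \<lesssim> A"
    by (rule lists_lepoll_infinite[OF assms])
  finally show ?thesis .
qed

section \<open>Quotient modules carried by a prescribed type\<close>

context abelian_group
begin

lemma minus_swap: "x \<in> carrier G \<Longrightarrow> y \<in> carrier G \<Longrightarrow> \<ominus> (x \<ominus> y) = y \<ominus> x"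
  by (simp add: minus_eq minus_add a_comm)

lemma minus_trans:
  assumes "x \<in> carrier G" "y \<in> carrier G" "z \<in> carrier G"
  shows "(x \<ominus> y) \<oplus> (y \<ominus> z) = x \<ominus> z"
  using assms by (simp add: minus_eq a_assoc r_neg1)

end

text \<open>One representative per coset is chosen inside \<open>F\<close> and carried over by
  \<open>\<phi>\<close>; the quotient thus lives on any type that \<open>carrier F\<close> injects
  into, instead of on a type of sets.\<close>

lemma exists_quotient_module:
  fixes F :: "('a, 'f, 'x) module_scheme" and \<phi> :: "'f \<Rightarrow> 'n"
  assumes "module R F" and L: "submodule L R F" and \<phi>: "inj_on \<phi> (carrier F)"
  obtains N :: "('a, 'n) module" and \<nu>
  where "module R N" "\<nu> \<in> linear_homs R F N" "\<nu> ` carrier F = carrier N"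
    "\<And>x y. x \<in> carrier F \<Longrightarrow> y \<in> carrier F \<Longrightarrow> \<nu> x = \<nu> y \<longleftrightarrow> (\<exists>l\<in>L. x = y \<oplus>\<^bsub>F\<^esub> l)"
proof -
  interpret F: module R F by fact
  note L_add = F.submoduleE(5)[OF L] and L_neg = F.submoduleE(3)[OF L]
    and L_smult = F.submoduleE(4)[OF L]
  have L_carr: "x \<in> carrier F" if "x \<in> L" for x using F.submoduleE(1)[OF L] that by blast
  have L_zero: "\<zero>\<^bsub>F\<^esub> \<in> L" using F.submoduleE(2)[OF L] L_smult[of "\<zero>\<^bsub>R\<^esub>"] L_carr by fastforce
  define \<rho> where "\<rho> x = (SOME y. y \<in> carrier F \<and> x \<ominus>\<^bsub>F\<^esub> y \<in> L)" for x
  have \<rho>: "\<rho> x \<in> carrier F \<and> x \<ominus>\<^bsub>F\<^esub> \<rho> x \<in> L" if "x \<in> carrier F" for x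
    unfolding \<rho>_def by (rule someI[of _ x]) (use that L_zero in \<open>simp add: F.M.minus_eq F.M.r_neg\<close>)
  have \<rho>_eq: "\<rho> x = \<rho> y \<longleftrightarrow> x \<ominus>\<^bsub>F\<^esub> y \<in> L" if xy: "x \<in> carrier F" "y \<in> carrier F" for x y
  proof
    assume "\<rho> x = \<rho> y"
    then have "(x \<ominus>\<^bsub>F\<^esub> \<rho> x) \<oplus>\<^bsub>F\<^esub> \<ominus>\<^bsub>F\<^esub> (y \<ominus>\<^bsub>F\<^esub> \<rho> x) \<in> L"
      using \<rho> xy by (metis L_add L_neg)
    moreover have "(x \<ominus>\<^bsub>F\<^esub> \<rho> x) \<oplus>\<^bsub>F\<^esub> \<ominus>\<^bsub>F\<^esub> (y \<ominus>\<^bsub>F\<^esub> \<rho> x) = x \<ominus>\<^bsub>F\<^esub> y"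
      using xy \<rho>[OF xy(1)] by (simp add: F.M.minus_swap F.M.minus_trans)
    ultimately show "x \<ominus>\<^bsub>F\<^esub> y \<in> L" by simp
  next
    assume *: "x \<ominus>\<^bsub>F\<^esub> y \<in> L"
    \<comment> \<open>The predicates that define \<open>\<rho> x\<close> and \<open>\<rho> y\<close>
      coincide, hence so do the choices.\<close>
    have "x \<ominus>\<^bsub>F\<^esub> z \<in> L \<longleftrightarrow> y \<ominus>\<^bsub>F\<^esub> z \<in> L" if z: "z \<in> carrier F" for z
    proof -
      have e: "x \<ominus>\<^bsub>F\<^esub> z = (x \<ominus>\<^bsub>F\<^esub> y) \<oplus>\<^bsub>F\<^esub> (y \<ominus>\<^bsub>F\<^esub> z)"
        "y \<ominus>\<^bsub>F\<^esub> z = \<ominus>\<^bsub>F\<^esub> (x \<ominus>\<^bsub>F\<^esub> y) \<oplus>\<^bsub>F\<^esub> (x \<ominus>\<^bsub>F\<^esub> z)"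
        using xy z by (simp_all add: F.M.minus_swap F.M.minus_trans)
      show ?thesis using * e L_add L_neg by metis
    qed
    then show "\<rho> x = \<rho> y" unfolding \<rho>_def by metis
  qed
  define \<nu> where "\<nu> x = \<phi> (\<rho> x)" for x
  have \<nu>_eq: "\<nu> x = \<nu> y \<longleftrightarrow> x \<ominus>\<^bsub>F\<^esub> y \<in> L" if "x \<in> carrier F" "y \<in> carrier F" for x y
    using \<rho>_eq[OF that] inj_on_eq_iff[OF \<phi>] \<rho> that by (simp add: \<nu>_def)
  \<comment> \<open>A preimage under \<open>\<nu>\<close> need not be the representative picked by
    \<open>\<rho>\<close>; it is congruent to it modulo \<open>L\<close>, which is all that the
    operations require.\<close>
  define rep where "rep = inv_into (carrier F) \<nu>"
  have rep: "rep (\<nu> x) \<in> carrier F" "rep (\<nu> x) \<ominus>\<^bsub>F\<^esub> x \<in> L" if "x \<in> carrier F" for x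
  proof -
    have "\<nu> (rep (\<nu> x)) = \<nu> x" "rep (\<nu> x) \<in> carrier F"
      using that by (simp_all add: rep_def f_inv_into_f inv_into_into)
    then show "rep (\<nu> x) \<in> carrier F" "rep (\<nu> x) \<ominus>\<^bsub>F\<^esub> x \<in> L"
      using \<nu>_eq that by auto
  qed
  define N :: "('a, 'n) module" where
    "N = \<lparr>carrier = \<nu> ` carrier F, mult = undefined, one = undefined, zero = \<nu> \<zero>\<^bsub>F\<^esub>,
      add = (\<lambda>m n. \<nu> (rep m \<oplus>\<^bsub>F\<^esub> rep n)), smult = (\<lambda>a n. \<nu> (a \<odot>\<^bsub>F\<^esub> rep n))\<rparr>"
  have add: "\<nu> x \<oplus>\<^bsub>N\<^esub> \<nu> y = \<nu> (x \<oplus>\<^bsub>F\<^esub> y)" if xy: "x \<in> carrier F" "y \<in> carrier F" for x y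
  proof -
    have "(rep (\<nu> x) \<oplus>\<^bsub>F\<^esub> rep (\<nu> y)) \<ominus>\<^bsub>F\<^esub> (x \<oplus>\<^bsub>F\<^esub> y)
      = (rep (\<nu> x) \<ominus>\<^bsub>F\<^esub> x) \<oplus>\<^bsub>F\<^esub> (rep (\<nu> y) \<ominus>\<^bsub>F\<^esub> y)"
      using rep(1)[OF xy(1)] rep(1)[OF xy(2)] xy by (simp add: F.M.minus_eq F.M.minus_add F.M.a_ac)
    also have "\<dots> \<in> L" using rep(2)[OF xy(1)] rep(2)[OF xy(2)] by (rule L_add)
    finally show ?thesis using rep xy by (simp add: N_def \<nu>_eq)
  qed
  have smult: "a \<odot>\<^bsub>N\<^esub> \<nu> x = \<nu> (a \<odot>\<^bsub>F\<^esub> x)" if ax: "a \<in> carrier R" "x \<in> carrier F" for a x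
  proof -
    have "a \<odot>\<^bsub>F\<^esub> rep (\<nu> x) \<ominus>\<^bsub>F\<^esub> a \<odot>\<^bsub>F\<^esub> x = a \<odot>\<^bsub>F\<^esub> (rep (\<nu> x) \<ominus>\<^bsub>F\<^esub> x)"
      using rep ax by (simp add: F.M.minus_eq F.smult_r_distr F.smult_r_minus)
    also have "\<dots> \<in> L" using rep(2) ax by (intro L_smult)
    finally show ?thesis using rep ax by (simp add: N_def \<nu>_eq)
  qed
  have carr: "carrier N = \<nu> ` carrier F" and zero: "\<zero>\<^bsub>N\<^esub> = \<nu> \<zero>\<^bsub>F\<^esub>"
    by (simp_all add: N_def)
  have "module R N"
  proof (rule moduleI)
    show "cring R" by (rule F.R.is_cring)
    show "abelian_group N"
    proof (rule abelian_groupI; (unfold carr zero)?)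
      fix x assume "x \<in> \<nu> ` carrier F"
      then obtain y where y: "y \<in> carrier F" "x = \<nu> y" by blast
      show "\<exists>y\<in>\<nu> ` carrier F. y \<oplus>\<^bsub>N\<^esub> x = \<nu> \<zero>\<^bsub>F\<^esub>"
        using y by (intro bexI[of _ "\<nu> (\<ominus>\<^bsub>F\<^esub> y)"]) (auto simp: add F.M.l_neg)
    qed (auto simp: add F.M.a_ac)
  qed (auto simp: carr add smult F.smult_l_distr F.smult_r_distr F.smult_assoc1)
  moreover have "\<nu> \<in> linear_homs R F N"
    by (auto simp: linear_homs_def carr add smult)
  moreover have "\<nu> x = \<nu> y \<longleftrightarrow> (\<exists>l\<in>L. x = y \<oplus>\<^bsub>F\<^esub> l)" if xy: "x \<in> carrier F" "y \<in> carrier F" for x y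
  proof -
    have "x \<ominus>\<^bsub>F\<^esub> y \<in> L \<longleftrightarrow> (\<exists>l\<in>L. x = y \<oplus>\<^bsub>F\<^esub> l)"
    proof
      assume "x \<ominus>\<^bsub>F\<^esub> y \<in> L"
      moreover have "x = y \<oplus>\<^bsub>F\<^esub> (x \<ominus>\<^bsub>F\<^esub> y)"
        using xy by (simp add: F.M.minus_eq F.M.a_lcomm F.M.r_neg)
      ultimately show "\<exists>l\<in>L. x = y \<oplus>\<^bsub>F\<^esub> l" by blast
    next
      assume "\<exists>l\<in>L. x = y \<oplus>\<^bsub>F\<^esub> l"
      then obtain l where l: "l \<in> L" "x = y \<oplus>\<^bsub>F\<^esub> l" by blast
      have "x \<ominus>\<^bsub>F\<^esub> y = l"
        unfolding l(2) using xy L_carr[OF l(1)] by (simp add: F.M.minus_eq F.M.a_ac F.M.r_neg1 F.M.r_neg)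
      then show "x \<ominus>\<^bsub>F\<^esub> y \<in> L" using l by simp
    qed
    then show ?thesis using \<nu>_eq[OF xy] by simp
  qed
  ultimately show ?thesis using that carr by blast
qed

text \<open>Families are total functions vanishing outside \<open>I\<close>, so equality of elements
  is equality of functions and can be tested at every coordinate. The elements of \<open>I\<close>
  index their own basis.\<close>

definition (in ring) free_module :: "'a set \<Rightarrow> ('a, 'a \<Rightarrow> 'a) module" where
  "free_module I =
    \<lparr>carrier = {x. (\<forall>j. x j \<in> carrier R) \<and> {j. x j \<noteq> \<zero>} \<subseteq> I \<and> finite {j. x j \<noteq> \<zero>}},
     mult = undefined, one = undefined, zero = (\<lambda>_. \<zero>), add = (\<lambda>x y j. x j \<oplus> y j),
     smult = (\<lambda>a x j. a \<otimes> x j)\<rparr>"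

text \<open>The map \<open>F \<rightarrow> I\<close> sending the basis vector of \<open>j\<close> to
  \<open>j\<close>. It sums over the support because \<open>finsum\<close> is meaningful only on
  finite sets.\<close>

definition (in ring) lin_comb :: "('a \<Rightarrow> 'a) \<Rightarrow> 'a"
  where "lin_comb x = (\<Oplus>j\<in>{j. x j \<noteq> \<zero>}. x j \<otimes> j)"

definition (in ring) unit_vec :: "'a \<Rightarrow> 'a \<Rightarrow> 'a"
  where "unit_vec i = (\<lambda>j. if j = i then \<one> else \<zero>)"

context cring
begin

lemma free_module_simps:
  "x \<in> carrier (free_module I) \<longleftrightarrow>
    (\<forall>j. x j \<in> carrier R) \<and> {j. x j \<noteq> \<zero>} \<subseteq> I \<and> finite {j. x j \<noteq> \<zero>}"
  "\<zero>\<^bsub>free_module I\<^esub> = (\<lambda>_. \<zero>)"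
  "x \<oplus>\<^bsub>free_module I\<^esub> y = (\<lambda>j. x j \<oplus> y j)"
  "a \<odot>\<^bsub>free_module I\<^esub> x = (\<lambda>j. a \<otimes> x j)"
  by (simp_all add: free_module_def)

lemma free_module_supportI:
  assumes "x \<in> carrier (free_module I)" "y \<in> carrier (free_module I)"
    "\<And>j. z j \<in> carrier R" "\<And>j. x j = \<zero> \<Longrightarrow> y j = \<zero> \<Longrightarrow> z j = \<zero>"
  shows "z \<in> carrier (free_module I)"
proof -
  have "{j. z j \<noteq> \<zero>} \<subseteq> {j. x j \<noteq> \<zero>} \<union> {j. y j \<noteq> \<zero>}"
    using assms(4) by blast
  then show ?thesis
    using assms(1-3) finite_subset[of "{j. z j \<noteq> \<zero>}" "{j. x j \<noteq> \<zero>} \<union> {j. y j \<noteq> \<zero>}"]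
    unfolding free_module_simps by blast
qed

lemma module_free_module: "module R (free_module I)"
proof (rule moduleI)
  let ?F = "free_module I"
  have carr: "x j \<in> carrier R" if "x \<in> carrier ?F" for x j
    using that by (simp add: free_module_simps)
  show "abelian_group ?F"
  proof (rule abelian_groupI)
    fix x y assume xy: "x \<in> carrier ?F" "y \<in> carrier ?F"
    then show "x \<oplus>\<^bsub>?F\<^esub> y \<in> carrier ?F"
      by (intro free_module_supportI[OF xy]) (auto simp: free_module_simps(3) carr)
    show "x \<oplus>\<^bsub>?F\<^esub> y = y \<oplus>\<^bsub>?F\<^esub> x"
      using xy by (auto simp: free_module_simps(3) carr a_comm)
  next
    fix x assume x: "x \<in> carrier ?F"
    then show "\<exists>y\<in>carrier ?F. y \<oplus>\<^bsub>?F\<^esub> x = \<zero>\<^bsub>?F\<^esub>"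
      by (intro bexI[of _ "\<lambda>j. \<ominus> x j"] free_module_supportI[OF x x])
        (auto simp: free_module_simps(2,3) carr l_neg minus_zero)
  next
    fix x y z assume "x \<in> carrier ?F" "y \<in> carrier ?F" "z \<in> carrier ?F"
    then show "x \<oplus>\<^bsub>?F\<^esub> y \<oplus>\<^bsub>?F\<^esub> z = x \<oplus>\<^bsub>?F\<^esub> (y \<oplus>\<^bsub>?F\<^esub> z)"
      by (simp add: free_module_simps(3) carr a_assoc)
  qed (auto simp: free_module_simps)
  show "cring R" by (rule is_cring)
  fix a x assume ax: "a \<in> carrier R" "x \<in> carrier ?F"
  then show "a \<odot>\<^bsub>?F\<^esub> x \<in> carrier ?F"
    by (intro free_module_supportI[OF ax(2) ax(2)]) (auto simp: free_module_simps(4) carr)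
qed (auto simp: free_module_simps l_distr r_distr m_assoc)

text \<open>Lets linear combinations with different supports be compared over one common finite
  index set.\<close>

lemma lin_comb_superset:
  assumes "finite A" "A \<subseteq> carrier R" "{j. x j \<noteq> \<zero>} \<subseteq> A" "\<And>j. x j \<in> carrier R"
  shows "lin_comb x = (\<Oplus>j\<in>A. x j \<otimes> j)"
  unfolding lin_comb_def
  by (rule add.finprod_mono_neutral_cong_left) (use assms in auto)

lemma lin_comb_add:
  assumes I: "I \<subseteq> carrier R" and x: "x \<in> carrier (free_module I)" and y: "y \<in> carrier (free_module I)"
  shows "lin_comb (\<lambda>j. x j \<oplus> y j) = lin_comb x \<oplus> lin_comb y"
proof -
  let ?A = "{j. x j \<noteq> \<zero>} \<union> {j. y j \<noteq> \<zero>}"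
  have A: "finite ?A" "?A \<subseteq> carrier R" and c: "\<And>j. x j \<in> carrier R" "\<And>j. y j \<in> carrier R"
    using I x y unfolding free_module_simps by blast+
  have "lin_comb (\<lambda>j. x j \<oplus> y j) = (\<Oplus>j\<in>?A. (x j \<oplus> y j) \<otimes> j)"
    using A c by (intro lin_comb_superset) auto
  also have "\<dots> = (\<Oplus>j\<in>?A. x j \<otimes> j \<oplus> y j \<otimes> j)"
    using A c by (intro finsum_cong') (auto simp: l_distr)
  also have "\<dots> = (\<Oplus>j\<in>?A. x j \<otimes> j) \<oplus> (\<Oplus>j\<in>?A. y j \<otimes> j)"
    using A c by (intro finsum_addf) auto
  also have "\<dots> = lin_comb x \<oplus> lin_comb y"
    using A c by (simp add: lin_comb_superset[of ?A])
  finally show ?thesis .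
qed

lemma lin_comb_closed:
  assumes "I \<subseteq> carrier R" "x \<in> carrier (free_module I)"
  shows "lin_comb x \<in> carrier R"
  unfolding lin_comb_def using assms by (intro finsum_closed) (auto simp: free_module_simps)

lemma lin_comb_smult:
  assumes "I \<subseteq> carrier R" "x \<in> carrier (free_module I)" "a \<in> carrier R"
  shows "lin_comb (\<lambda>j. a \<otimes> x j) = a \<otimes> lin_comb x"
proof -
  let ?A = "{j. x j \<noteq> \<zero>}"
  have A: "finite ?A" "?A \<subseteq> carrier R" and c: "\<And>j. x j \<in> carrier R"
    using assms unfolding free_module_simps by blast+
  have "lin_comb (\<lambda>j. a \<otimes> x j) = (\<Oplus>j\<in>?A. (a \<otimes> x j) \<otimes> j)"
    using A c assms by (intro lin_comb_superset) auto
  also have "\<dots> = (\<Oplus>j\<in>?A. a \<otimes> (x j \<otimes> j))"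
    using A c assms by (intro finsum_cong') (auto simp: m_assoc)
  also have "\<dots> = a \<otimes> lin_comb x"
    unfolding lin_comb_def using A c assms by (intro finsum_rdistr[symmetric]) auto
  finally show ?thesis .
qed

lemma unit_vec_in_free_module: "i \<in> I \<Longrightarrow> unit_vec i \<in> carrier (free_module I)"
proof -
  assume "i \<in> I"
  moreover have "{j. unit_vec i j \<noteq> \<zero>} \<subseteq> {i}" by (auto simp: unit_vec_def)
  ultimately show ?thesis
    using finite_subset[of "{j. unit_vec i j \<noteq> \<zero>}" "{i}"]
    by (auto simp: free_module_simps unit_vec_def)
qed

lemma lin_comb_unit_vec:
  assumes "i \<in> carrier R"
  shows "lin_comb (unit_vec i) = i"
proof -
  have "lin_comb (unit_vec i) = (\<Oplus>j\<in>{i}. unit_vec i j \<otimes> j)"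
    using assms by (intro lin_comb_superset) (auto simp: unit_vec_def)
  also have "\<dots> = i" using assms by (simp add: unit_vec_def)
  finally show ?thesis .
qed

lemma lin_comb_in_ideal_prod:
  assumes I: "ideal I R" and J: "J \<subseteq> carrier R" "\<zero> \<in> J"
    and x: "x \<in> carrier (free_module I)" "\<And>j. x j \<in> J"
  shows "lin_comb x \<in> J \<cdot> I"
proof -
  interpret I: ideal I R by fact
  have "(\<Oplus>j\<in>A. x j \<otimes> j) \<in> J \<cdot> I" if "finite A" "A \<subseteq> I" for A
    using that
  proof (induction A)
    case empty
    \<comment> \<open>The inductive definition of the product of ideals has no rule for zero, so the
      empty sum enters as a product.\<close>
    have "\<zero> \<otimes> \<zero> \<in> J \<cdot> I" using J I.zero_closed by (intro ideal_prod.prod)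
    then show ?case by simp
  next
    case (insert i A)
    then show ?case
      using x J by (subst finsum_insert) (auto simp: I.Icarr subset_iff intro!: ideal_prod.sum ideal_prod.prod)
  qed
  then show ?thesis
    using x unfolding lin_comb_def free_module_simps by blast
qed

end

section \<open>Divisibility of homomorphisms makes nonzero ideals invertible\<close>

context domain
begin

text \<open>Multiplication by \<open>r\<close> is injective on a finite carrier, hence onto. So
  \<open>r\<close> divides everything, \<open>\<one>\<close> is a multiplier, and
  \<open>r = \<one> \<otimes> r\<close> is in the product.\<close>

lemma finite_domain_ideals_invertible:
  assumes "finite (carrier R)"
  shows ideals_invertible
  unfolding ideals_invertible_def
proof (intro allI impI)
  fix I r assume I: "ideal I R" and r: "r \<in> I" "r \<noteq> \<zero>"
  interpret I: ideal I R by fact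
  have rc: "r \<in> carrier R" using r I.Icarr by blast
  have "inj_on (\<lambda>x. r \<otimes> x) (carrier R)"
    using rc r by (auto simp: inj_on_def m_lcancel)
  then have "(\<lambda>x. r \<otimes> x) ` carrier R = carrier R"
    using rc assms by (intro endo_inj_surj) auto
  then have r_div: "r divides x" if "x \<in> carrier R" for x
    using that unfolding factor_def by blast
  have "\<one> \<otimes> r \<in> multipliers r I \<cdot> I"
    using r by (intro ideal_prod.prod) (auto simp: multipliers_def I.Icarr intro: r_div)
  then show "r \<in> multipliers r I \<cdot> I" using rc by simp
qed

lemma infinite_domain_ideals_invertible:
  assumes inf: "infinite (carrier R)"
    and div: "seemingly_divisible_imp_divisible R TYPE('a) TYPE('a)"
  shows ideals_invertible
  unfolding ideals_invertible_def
proof (intro allI impI)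
  fix I r assume I: "ideal I R" and r: "r \<in> I" "r \<noteq> \<zero>"
  interpret I: ideal I R by fact
  have rc: "r \<in> carrier R" and Ic: "I \<subseteq> carrier R" using r I.Icarr by blast+
  define F where "F = free_module I"
  interpret F: module R F unfolding F_def by (rule module_free_module)
  have F_add: "x \<oplus>\<^bsub>F\<^esub> y = (\<lambda>j. x j \<oplus> y j)" and F_smult: "a \<odot>\<^bsub>F\<^esub> x = (\<lambda>j. a \<otimes> x j)" for x y a
    by (simp_all add: F_def free_module_simps)
  have Fc: "x j \<in> carrier R" if "x \<in> carrier F" for x j
    using that by (simp add: F_def free_module_simps)
  have lc_add: "lin_comb (x \<oplus>\<^bsub>F\<^esub> y) = lin_comb x \<oplus> lin_comb y"
    if "x \<in> carrier F" "y \<in> carrier F" for x y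
    unfolding F_add using that unfolding F_def by (rule lin_comb_add[OF Ic])
  have lc_smult: "lin_comb (a \<odot>\<^bsub>F\<^esub> x) = a \<otimes> lin_comb x"
    if "x \<in> carrier F" "a \<in> carrier R" for a x
    unfolding F_smult using that unfolding F_def by (rule lin_comb_smult[OF Ic])
  note lc_closed = lin_comb_closed[OF Ic, folded F_def]
    and unit_vec_F = unit_vec_in_free_module[of _ I, folded F_def]
  have lc_unit: "lin_comb (unit_vec i) = i" if "i \<in> I" for i
    using that by (intro lin_comb_unit_vec I.Icarr)
  define K where "K = {k \<in> carrier F. lin_comb k = \<zero>}"
  have lc_zero: "lin_comb \<zero>\<^bsub>F\<^esub> = \<zero>"
    using lc_smult[of "\<zero>\<^bsub>F\<^esub>" \<zero>] lc_closed by simp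
  have K: "submodule K R F"
  proof (rule F.submoduleI)
    fix a assume a: "a \<in> K"
    then have "\<ominus>\<^bsub>F\<^esub> a = (\<ominus> \<one>) \<odot>\<^bsub>F\<^esub> a"
      by (simp add: K_def F.smult_l_minus)
    then show "\<ominus>\<^bsub>F\<^esub> a \<in> K"
      using a by (simp add: K_def lc_smult del: F.smult_l_minus) 
  qed (auto simp: K_def lc_add lc_smult lc_zero)
  have K_carr: "K \<subseteq> carrier F" by (auto simp: K_def)
  define L where "L = (\<lambda>k. r \<odot>\<^bsub>F\<^esub> k) ` K"
  have L: "submodule L R F"
  proof (rule F.submoduleI)
    show "\<zero>\<^bsub>F\<^esub> \<in> L"
      unfolding L_def using rc lc_zero by (intro image_eqI[of _ _ "\<zero>\<^bsub>F\<^esub>"]) (auto simp: K_def)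
  next
    fix a assume "a \<in> L"
    then show "\<ominus>\<^bsub>F\<^esub> a \<in> L"
      unfolding L_def using rc K_carr F.submoduleE(3)[OF K] by (auto simp: F.smult_r_minus[symmetric])
  next
    fix a b assume "a \<in> L" "b \<in> L"
    then show "a \<oplus>\<^bsub>F\<^esub> b \<in> L"
      unfolding L_def using rc K_carr F.submoduleE(5)[OF K] 
      by (auto simp: F.smult_r_distr[symmetric] subset_iff)
  next
    fix a x assume "a \<in> carrier R" "x \<in> L"
    then show "a \<odot>\<^bsub>F\<^esub> x \<in> L"
      unfolding L_def using rc K_carr F.submoduleE(4)[OF K]
      by (auto simp: F.smult_assoc1[symmetric] subset_iff m_comm)
        (metis (no_types, lifting) F.smult_assoc1 image_eqI m_comm)
  qed (use rc K_carr in \<open>auto simp: L_def\<close>)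
  \<comment> \<open>Here the infinite carrier enters: it bounds the size of \<open>F\<close>, so the
    quotient by \<open>L\<close> can be built on the type of \<open>R\<close>, the only type for
    which \<open>div\<close> is given.\<close>
  have "carrier F \<subseteq> {f. (\<forall>x\<in>carrier R. f x \<in> carrier R) \<and> {x. f x \<noteq> \<zero>} \<subseteq> carrier R \<and> finite {x. f x \<noteq> \<zero>}}"
  proof
    fix x assume "x \<in> carrier F"
    then have "\<forall>j. x j \<in> carrier R" "{j. x j \<noteq> \<zero>} \<subseteq> I" "finite {j. x j \<noteq> \<zero>}"
      by (auto simp: F_def free_module_simps)
    then show "x \<in> {f. (\<forall>x\<in>carrier R. f x \<in> carrier R) \<and> {x. f x \<noteq> \<zero>} \<subseteq> carrier R \<and> finite {x. f x \<noteq> \<zero>}}"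
      using Ic by blast
  qed
  then have "carrier F \<lesssim> carrier R"
    using finite_support_lepoll_infinite[OF inf] by (rule lepoll_trans[OF subset_imp_lepoll])
  then obtain \<phi> :: "('a \<Rightarrow> 'a) \<Rightarrow> 'a" where \<phi>: "inj_on \<phi> (carrier F)"
    by (auto simp: lepoll_def)
  obtain N :: "('a, 'a) module" and \<nu> where N: "module R N" and \<nu>: "\<nu> \<in> linear_homs R F N"
    and \<nu>_surj: "\<nu> ` carrier F = carrier N"
    and \<nu>_eq: "\<And>x y. x \<in> carrier F \<Longrightarrow> y \<in> carrier F \<Longrightarrow> \<nu> x = \<nu> y \<longleftrightarrow> (\<exists>l\<in>L. x = y \<oplus>\<^bsub>F\<^esub> l)"
    using exists_quotient_module[OF F.module_axioms L \<phi>] by metis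
  interpret N: module R N by fact
  have \<nu>_closed: "\<nu> x \<in> carrier N" if "x \<in> carrier F" for x
    using \<nu>_surj that by blast
  have \<nu>_add: "\<nu> (x \<oplus>\<^bsub>F\<^esub> y) = \<nu> x \<oplus>\<^bsub>N\<^esub> \<nu> y" if "x \<in> carrier F" "y \<in> carrier F" for x y
    using \<nu> that by (simp add: linear_homs_def)
  have \<nu>_smult: "\<nu> (a \<odot>\<^bsub>F\<^esub> x) = a \<odot>\<^bsub>N\<^esub> \<nu> x" if "a \<in> carrier R" "x \<in> carrier F" for x a
    using \<nu> that by (simp add: linear_homs_def)
  \<comment> \<open>Cancelling \<open>r\<close> in every coordinate turns
    \<open>r u - r v \<in> r K\<close> into \<open>u - v \<in> K\<close>. Well-definedness,
    linearity of \<open>f\<close> and the evaluation of \<open>G\<close> all reduce to this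
    equivalence.\<close>
  have \<nu>_r: "\<nu> (r \<odot>\<^bsub>F\<^esub> u) = \<nu> (r \<odot>\<^bsub>F\<^esub> v) \<longleftrightarrow> lin_comb u = lin_comb v"
    if u: "u \<in> carrier F" and v: "v \<in> carrier F" for u v
  proof
    assume "\<nu> (r \<odot>\<^bsub>F\<^esub> u) = \<nu> (r \<odot>\<^bsub>F\<^esub> v)"
    then obtain k where k: "k \<in> K" "r \<odot>\<^bsub>F\<^esub> u = r \<odot>\<^bsub>F\<^esub> v \<oplus>\<^bsub>F\<^esub> r \<odot>\<^bsub>F\<^esub> k"
      using \<nu>_eq[of "r \<odot>\<^bsub>F\<^esub> u" "r \<odot>\<^bsub>F\<^esub> v"] u v rc by (auto simp: L_def)
    then have kF: "k \<in> carrier F" using K_carr by blast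
    have "u j = v j \<oplus> k j" for j
    proof -
      have "r \<otimes> u j = r \<otimes> (v j \<oplus> k j)"
        using fun_cong[OF k(2), of j] Fc[OF u] Fc[OF v] Fc[OF kF] rc by (simp add: F_add F_smult r_distr)
      then show ?thesis using Fc[OF u] Fc[OF v] Fc[OF kF] rc r by (simp add: m_lcancel)
    qed
    then have "u = v \<oplus>\<^bsub>F\<^esub> k" by (auto simp: F_add)
    then show "lin_comb u = lin_comb v"
      using lc_add[OF v kF] k lc_closed[OF v] by (simp add: K_def)
  next
    assume eq: "lin_comb u = lin_comb v"
    have "lin_comb (u \<ominus>\<^bsub>F\<^esub> v) \<oplus> lin_comb v = lin_comb v"
      using lc_add[of "u \<ominus>\<^bsub>F\<^esub> v" v] u v eq by (simp add: F.M.minus_eq F.M.a_assoc F.M.l_neg)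
    then have "lin_comb (u \<ominus>\<^bsub>F\<^esub> v) \<oplus> lin_comb v = \<zero> \<oplus> lin_comb v"
      using lc_closed[OF v] by simp
    then have "lin_comb (u \<ominus>\<^bsub>F\<^esub> v) = \<zero>"
      using lc_closed u v by (subst (asm) add.right_cancel) auto
    then have "r \<odot>\<^bsub>F\<^esub> (u \<ominus>\<^bsub>F\<^esub> v) \<in> L"
      unfolding L_def K_def using u v by (intro imageI CollectI conjI F.M.minus_closed)
    moreover have "r \<odot>\<^bsub>F\<^esub> u = r \<odot>\<^bsub>F\<^esub> v \<oplus>\<^bsub>F\<^esub> r \<odot>\<^bsub>F\<^esub> (u \<ominus>\<^bsub>F\<^esub> v)"
      using u v rc by (simp add: F.smult_r_distr[symmetric] F.M.minus_eq F.M.a_lcomm F.M.r_neg)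
    ultimately show "\<nu> (r \<odot>\<^bsub>F\<^esub> u) = \<nu> (r \<odot>\<^bsub>F\<^esub> v)"
      using \<nu>_eq[of "r \<odot>\<^bsub>F\<^esub> u" "r \<odot>\<^bsub>F\<^esub> v"] u v rc by auto
  qed
  define M :: "('a, 'a) module" where
    "M = \<lparr>carrier = I, mult = undefined, one = undefined, zero = \<zero>, add = (\<oplus>), smult = (\<otimes>)\<rparr>"
  have M_simps: "carrier M = I" "\<zero>\<^bsub>M\<^esub> = \<zero>" "x \<oplus>\<^bsub>M\<^esub> y = x \<oplus> y" "a \<odot>\<^bsub>M\<^esub> x = a \<otimes> x" for a x y
    by (simp_all add: M_def)
  have M: "module R M"
  proof (rule moduleI)
    show "abelian_group M"
      by (rule abelian_groupI)
        (auto simp: M_simps I.Icarr a_ac r_neg intro!: bexI[of _ "\<ominus> _"] I.a_inv_closed)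
  qed (auto simp: M_simps I.Icarr I.I_l_closed l_distr r_distr m_assoc is_cring)
  define f where "f i = \<nu> (r \<odot>\<^bsub>F\<^esub> unit_vec i)" for i
  have f: "f \<in> linear_homs R M N"
  proof -
    \<comment> \<open>Although \<open>i \<mapsto> unit_vec i\<close> is not additive, both sides
      have the same image under \<open>lin_comb\<close>, so their difference lies in
      \<open>K\<close> and vanishes after multiplication by \<open>r\<close> modulo
      \<open>r K\<close>.\<close>
    have "f (x \<oplus> y) = f x \<oplus>\<^bsub>N\<^esub> f y" if xy: "x \<in> I" "y \<in> I" for x y
    proof -
      have "f (x \<oplus> y) = \<nu> (r \<odot>\<^bsub>F\<^esub> (unit_vec x \<oplus>\<^bsub>F\<^esub> unit_vec y))"
        unfolding f_def using xy by (subst \<nu>_r) (auto simp: unit_vec_F lc_add lc_unit)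
      then show ?thesis using xy rc by (simp add: f_def F.smult_r_distr unit_vec_F \<nu>_add)
    qed
    moreover have "f (a \<otimes> x) = a \<odot>\<^bsub>N\<^esub> f x" if ax: "a \<in> carrier R" "x \<in> I" for a x
    proof -
      have "f (a \<otimes> x) = \<nu> (r \<odot>\<^bsub>F\<^esub> (a \<odot>\<^bsub>F\<^esub> unit_vec x))"
        unfolding f_def using ax by (subst \<nu>_r) (auto simp: unit_vec_F lc_smult lc_unit I.I_l_closed)
      also have "r \<odot>\<^bsub>F\<^esub> (a \<odot>\<^bsub>F\<^esub> unit_vec x) = a \<odot>\<^bsub>F\<^esub> (r \<odot>\<^bsub>F\<^esub> unit_vec x)"
        using ax rc by (simp add: unit_vec_F F.smult_assoc1[symmetric] m_comm)
      finally show ?thesis using ax rc by (simp add: f_def unit_vec_F \<nu>_smult)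
    qed
    ultimately show ?thesis
      using rc by (auto simp: linear_homs_def M_simps f_def unit_vec_F \<nu>_closed)
  qed
  \<comment> \<open>The class of \<open>unit_vec m\<close> divides \<open>f m\<close> by
    \<open>r\<close>, though it does not depend linearly on \<open>m\<close>. The torsion condition
    is trivial because \<open>I\<close> is torsion-free.\<close>
  have "seemingly_divisible M N f r"
  proof -
    have "\<exists>n\<in>carrier N. f m = r \<odot>\<^bsub>N\<^esub> n" if "m \<in> I" for m
      using that rc by (intro bexI[of _ "\<nu> (unit_vec m)"]) (auto simp: f_def \<nu>_smult unit_vec_F \<nu>_closed)
    moreover have "f m = \<zero>\<^bsub>N\<^esub>" if m: "m \<in> I" "r \<otimes> m = \<zero>" for m
    proof -
      have m0: "m = \<zero>" using m r rc by (auto simp: integral_iff I.Icarr)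
      have "f (\<zero> \<otimes> m) = \<zero> \<odot>\<^bsub>N\<^esub> f m" "f m \<in> carrier N"
        using f m(1) unfolding linear_homs_def M_simps by blast+
      then show ?thesis using m0 by simp
    qed
    ultimately show ?thesis by (auto simp: seemingly_divisible_def M_simps)
  qed
  then obtain g where g: "g \<in> linear_homs R M N" and fg: "\<And>i. i \<in> I \<Longrightarrow> f i = r \<odot>\<^bsub>N\<^esub> g i"
    using div[unfolded seemingly_divisible_imp_divisible_def, rule_format, OF rc M N f]
    unfolding M_simps by blast
  have lift: "\<exists>x\<in>carrier F. g i = \<nu> x" if "i \<in> I" for i
  proof -
    have "g i \<in> carrier N" using g that by (auto simp: linear_homs_def M_simps)
    then show ?thesis using \<nu>_surj by blast
  qed
  obtain G where G: "G \<in> carrier F" "g r = \<nu> G" using lift r by blast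
  \<comment> \<open>Evaluating \<open>f = r g\<close> at \<open>r\<close> itself fixes the value of
    \<open>lin_comb\<close> at \<open>G\<close>, the lift of \<open>g r\<close>.\<close>
  have "\<nu> (r \<odot>\<^bsub>F\<^esub> unit_vec r) = \<nu> (r \<odot>\<^bsub>F\<^esub> G)"
    using fg[OF r(1)] G rc by (simp add: f_def \<nu>_smult)
  then have lcG: "lin_comb G = r"
    using \<nu>_r[of "unit_vec r" G] G r by (simp add: unit_vec_F lc_unit)
  have "G j \<in> multipliers r I" for j
  proof -
    have "r divides G j \<otimes> i" if i: "i \<in> I" for i
    proof -
      obtain H where H: "H \<in> carrier F" "g i = \<nu> H" using lift i by blast
      have ic: "i \<in> carrier R" using i I.Icarr by blast
      have "r \<odot>\<^bsub>N\<^esub> g i = g (r \<otimes> i)" "i \<odot>\<^bsub>N\<^esub> g r = g (i \<otimes> r)"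
        using g i ic r rc by (auto simp: linear_homs_def M_simps)
      then have "\<nu> (i \<odot>\<^bsub>F\<^esub> G) = \<nu> (r \<odot>\<^bsub>F\<^esub> H)"
        using G H rc ic by (simp add: \<nu>_smult m_comm)
      then obtain k where k: "k \<in> K" "i \<odot>\<^bsub>F\<^esub> G = r \<odot>\<^bsub>F\<^esub> H \<oplus>\<^bsub>F\<^esub> r \<odot>\<^bsub>F\<^esub> k"
        using \<nu>_eq[of "i \<odot>\<^bsub>F\<^esub> G" "r \<odot>\<^bsub>F\<^esub> H"] G H rc ic by (auto simp: L_def)
      then have kF: "k \<in> carrier F" using K_carr by blast
      have "G j \<otimes> i = r \<otimes> (H j \<oplus> k j)"
        using fun_cong[OF k(2), of j] Fc[OF G(1)] Fc[OF H(1)] Fc[OF kF] rc ic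
        by (simp add: F_add F_smult r_distr m_comm)
      then show ?thesis using Fc[OF H(1)] Fc[OF kF] by (auto simp: factor_def)
    qed
    then show ?thesis using Fc[OF G(1)] by (simp add: multipliers_def)
  qed
  moreover have "\<zero> \<in> multipliers r I"
    using rc by (auto simp: multipliers_def I.Icarr divides_zero)
  ultimately show "r \<in> multipliers r I \<cdot> I"
    using lin_comb_in_ideal_prod[OF I, of "multipliers r I" G] G(1) lcG
    by (auto simp: multipliers_def F_def)
qed

end

section \<open>Localization at maximal ideals of a Dedekind domain\<close>

text \<open>The maximal condition in indexed form: each use needs the index that yields the maximal
  ideal, not only the ideal. In a Noetherian ring a nonempty chain of ideals contains its union,
  which gives Zorn its upper bounds.\<close>

lemma (in noetherian_ring) ideal_family_maximal:
  assumes "A \<noteq> {}" "\<And>a. a \<in> A \<Longrightarrow> ideal (I a) R"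
  shows "\<exists>a\<in>A. \<forall>b\<in>A. I a \<subseteq> I b \<longrightarrow> I b = I a"
proof -
  have "\<exists>M\<in>I ` A. \<forall>J\<in>I ` A. M \<subseteq> J \<longrightarrow> J = M"
  proof (rule subset_Zorn_nonempty)
    fix C assume C: "C \<noteq> {}" "subset.chain (I ` A) C"
    then have "subset.chain {J. ideal J R} C"
      using assms(2) by (auto simp: subset_chain_def)
    then have "\<Union>C \<in> C" by (rule ideal_chain_is_trivial[OF C(1)])
    then show "\<Union>C \<in> I ` A" using C(2) by (auto simp: subset_chain_def)
  qed (use assms(1) in simp)
  then show ?thesis by (simp only: bex_simps ball_simps)
qed

context domain
begin

lemma ideal_colon:
  assumes "a \<in> carrier R" "b \<in> carrier R"
  shows "ideal {y \<in> carrier R. a divides y \<otimes> b} R"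
proof (rule idealI[OF ring_axioms])
  show "subgroup {y \<in> carrier R. a divides y \<otimes> b} (add_monoid R)"
  proof (rule add.subgroupI)
    have "a divides \<zero> \<otimes> b" using assms by (auto simp: factor_def intro!: bexI[of _ \<zero>])
    then show "{y \<in> carrier R. a divides y \<otimes> b} \<noteq> {}" by blast
  next
    fix y assume "y \<in> {y \<in> carrier R. a divides y \<otimes> b}"
    then obtain c where "y \<in> carrier R" "c \<in> carrier R" "y \<otimes> b = a \<otimes> c"
      by (auto simp: factor_def)
    then have "\<ominus> y \<otimes> b = a \<otimes> \<ominus> c" "\<ominus> y \<in> carrier R" "\<ominus> c \<in> carrier R"
      using assms by (simp_all add: l_minus r_minus)
    then show "\<ominus> y \<in> {y \<in> carrier R. a divides y \<otimes> b}"
      unfolding factor_def by blast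
  next
    fix y z assume "y \<in> {y \<in> carrier R. a divides y \<otimes> b}" "z \<in> {y \<in> carrier R. a divides y \<otimes> b}"
    then show "y \<oplus> z \<in> {y \<in> carrier R. a divides y \<otimes> b}"
      using assms by (auto simp: factor_def l_distr r_distr[symmetric])
  qed auto
next
  fix y x assume "y \<in> {y \<in> carrier R. a divides y \<otimes> b}" "x \<in> carrier R"
  moreover from this obtain c where "c \<in> carrier R" "y \<otimes> b = a \<otimes> c" "y \<in> carrier R"
    by (auto simp: factor_def)
  moreover from calculation have "x \<otimes> y \<otimes> b = a \<otimes> (x \<otimes> c)"
    using assms by (simp add: m_assoc m_lcomm)
  ultimately show "x \<otimes> y \<in> {y \<in> carrier R. a divides y \<otimes> b}"
    and "y \<otimes> x \<in> {y \<in> carrier R. a divides y \<otimes> b}"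
    by (auto simp: factor_def m_comm intro!: bexI[of _ "x \<otimes> c"])
qed

text \<open>Formally \<open>homog_eval rs b a\<close> is \<open>a [^] (n - 1)\<close> times a
  combination of the powers \<open>(b / a) [^] k\<close> with \<open>k < n\<close>. One factor
  \<open>a\<close> completes the power \<open>a [^] n\<close>, the other remains: \<open>d\<close>
  is a combination of the elements \<open>a (b / a) [^] k\<close>.\<close>

lemma ideal_integral_combinations:
  assumes "a \<in> carrier R" "b \<in> carrier R"
  shows "ideal {d \<in> carrier R. \<exists>rs. length rs = n \<and> set rs \<subseteq> carrier R \<and>
    a [^] n \<otimes> d = a \<otimes> a \<otimes> homog_eval rs b a} R" (is "ideal ?I R")
proof -
  have smult: "x \<otimes> d \<in> ?I" if x: "d \<in> ?I" "x \<in> carrier R" for x d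
  proof -
    from x obtain rs where rs: "length rs = n" "set rs \<subseteq> carrier R"
      "a [^] n \<otimes> d = a \<otimes> a \<otimes> homog_eval rs b a" "d \<in> carrier R"
      by blast
    have "a [^] n \<otimes> (x \<otimes> d) = x \<otimes> (a [^] n \<otimes> d)"
      using assms rs(4) x(2) by (simp add: m_ac)
    also have "\<dots> = a \<otimes> a \<otimes> homog_eval (map ((\<otimes>) x) rs) b a"
      unfolding rs(3) using assms rs(2) x(2) by (simp add: homog_eval_smult m_ac)
    moreover have "set (map ((\<otimes>) x) rs) \<subseteq> carrier R" using rs x by auto
    ultimately show ?thesis
      using rs x by (auto intro!: exI[of _ "map ((\<otimes>) x) rs"])
  qed
  have zero: "\<zero> \<in> ?I"
    using assms by (auto intro!: exI[of _ "replicate n \<zero>"] simp: homog_eval_zeros)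
  have add: "d \<oplus> e \<in> ?I" if de: "d \<in> ?I" "e \<in> ?I" for d e
  proof -
    obtain rs where rs: "length rs = n" "set rs \<subseteq> carrier R"
      "a [^] n \<otimes> d = a \<otimes> a \<otimes> homog_eval rs b a" "d \<in> carrier R"
      using de by blast
    obtain ss where ss: "length ss = n" "set ss \<subseteq> carrier R"
      "a [^] n \<otimes> e = a \<otimes> a \<otimes> homog_eval ss b a" "e \<in> carrier R"
      using de by blast
    have "a [^] n \<otimes> (d \<oplus> e) = a \<otimes> a \<otimes> homog_eval (map2 (\<oplus>) rs ss) b a"
      using assms rs ss by (simp add: r_distr homog_eval_add)
    moreover have "set (map2 (\<oplus>) rs ss) \<subseteq> carrier R"
      using rs ss by (auto elim!: in_set_zipE)
    ultimately show ?thesis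
      using rs ss by (auto intro!: exI[of _ "map2 (\<oplus>) rs ss"])
  qed
  have neg: "\<ominus> d \<in> ?I" if "d \<in> ?I" for d
    using smult[OF that, of "\<ominus> \<one>"] that by (simp add: l_minus)
  show ?thesis
  proof (rule idealI[OF ring_axioms])
    show "subgroup ?I (add_monoid R)"
      using zero add neg by (intro add.subgroupI) (auto simp: a_inv_def[symmetric])
    fix d x assume "d \<in> ?I" "x \<in> carrier R"
    then show "x \<otimes> d \<in> ?I" by (rule smult)
    then show "d \<otimes> x \<in> ?I" using \<open>d \<in> ?I\<close> \<open>x \<in> carrier R\<close> by (simp add: m_comm)
  qed
qed

end

context dedekind_domain
begin

lemma integrally_closed_divides:
  assumes "a \<in> carrier R" "b \<in> carrier R - {\<zero>}" "set rs \<subseteq> carrier R"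
    "a [^] length rs = b \<otimes> homog_eval rs a b"
  shows "b divides a"
proof -
  let ?rs = "map ((\<otimes>) (\<ominus> \<one>)) rs"
  have "a [^] length ?rs \<oplus> b \<otimes> homog_eval ?rs a b = \<zero>"
    using assms by (simp add: homog_eval_smult l_minus r_minus r_neg)
  moreover have "set ?rs \<subseteq> carrier R" using assms by auto
  ultimately show ?thesis
    using integrally_closed assms unfolding integrally_closed_iff by blast
qed

text \<open>If all \<open>(b / a)\<^sup>k c\<close> lie in the Noetherian ring \<open>R\<close>, then the ideals
  \<open>R c + \<dots> + R (b / a)\<^sup>k c\<close> become stationary, which makes \<open>b / a\<close> integral; here \<open>c = a\<close>.\<close>
lemma almost_integral_divides:
  assumes a: "a \<in> carrier R" "a \<noteq> \<zero>" and b: "b \<in> carrier R"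
    and c: "\<And>k::nat. \<exists>d\<in>carrier R. a [^] k \<otimes> d = b [^] k \<otimes> a"
  shows "a divides b"
proof -
  define I where "I n = {d \<in> carrier R. \<exists>rs. length rs = n \<and> set rs \<subseteq> carrier R \<and>
    a [^] n \<otimes> d = a \<otimes> a \<otimes> homog_eval rs b a}" for n
  have I: "ideal (I n) R" for n
    unfolding I_def by (rule ideal_integral_combinations[OF a(1) b])
  have "\<exists>n\<in>UNIV. \<forall>m\<in>UNIV. I n \<subseteq> I m \<longrightarrow> I m = I n"
    by (rule ideal_family_maximal) (use I in auto)
  then obtain n where n: "\<And>m. I n \<subseteq> I m \<Longrightarrow> I m = I n" by blast
  \<comment> \<open>A leading coefficient \<open>\<zero>\<close> turns a combination of
    \<open>n\<close> powers into one of \<open>n + 1\<close> powers.\<close>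
  have "I n \<subseteq> I (Suc n)"
  proof
    fix d assume "d \<in> I n"
    then obtain rs where rs: "length rs = n" "set rs \<subseteq> carrier R"
      "a [^] n \<otimes> d = a \<otimes> a \<otimes> homog_eval rs b a" "d \<in> carrier R"
      by (auto simp: I_def)
    have "a [^] Suc n \<otimes> d = a \<otimes> (a [^] n \<otimes> d)"
      using a rs(4) by (simp add: m_ac)
    also have "\<dots> = a \<otimes> a \<otimes> homog_eval (\<zero> # rs) b a"
      unfolding rs(3) using a b rs by (simp add: m_ac)
    finally show "d \<in> I (Suc n)"
      using rs by (auto simp: I_def intro!: exI[of _ "\<zero> # rs"])
  qed
  then have eq: "I (Suc n) = I n" using n by blast
  \<comment> \<open>Formally \<open>d = a (b / a) [^] n\<close>, the generator added in
    \<open>I (Suc n)\<close>. Stationarity puts it into \<open>I n\<close>, which expresses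
    \<open>(b / a) [^] n\<close> by lower powers: an integral equation for
    \<open>b / a\<close>.\<close>
  obtain d where d: "d \<in> carrier R" "a [^] n \<otimes> d = b [^] n \<otimes> a" using c by blast
  have "a [^] Suc n \<otimes> d = a \<otimes> (a [^] n \<otimes> d)" using a d(1) by (simp add: m_ac)
  also have "\<dots> = a \<otimes> a \<otimes> homog_eval (\<one> # replicate n \<zero>) b a"
    unfolding d(2) using a b by (simp add: homog_eval_zeros m_ac)
  finally have "d \<in> I (Suc n)"
    using d by (auto simp: I_def intro!: exI[of _ "\<one> # replicate n \<zero>"])
  then obtain rs where rs: "length rs = n" "set rs \<subseteq> carrier R"
    "a [^] n \<otimes> d = a \<otimes> a \<otimes> homog_eval rs b a"
    unfolding eq by (auto simp: I_def)
  have "a \<otimes> b [^] n = a \<otimes> (a \<otimes> homog_eval rs b a)"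
    using rs d a b by (simp add: m_ac)
  then have "b [^] length rs = a \<otimes> homog_eval rs b a"
    using a b rs by (simp add: m_lcancel)
  then show ?thesis using a b rs by (intro integrally_closed_divides) auto
qed

text \<open>The elements \<open>p\<close> and \<open>s\<close> witness \<open>P R\<^sub>P = p R\<^sub>P\<close> without forming the localization.\<close>
lemma local_uniformizer:
  assumes P: "maximalideal P R" "P \<noteq> {\<zero>}"
  obtains p s where "p \<in> P" "s \<in> carrier R - P" "\<And>x. x \<in> P \<Longrightarrow> p divides s \<otimes> x"
proof -
  interpret P: maximalideal P R by fact
  interpret PP: primeideal P R by (rule maximalideal_prime[OF P(1)])
  have one_P: "\<one> \<notin> P" using P.one_imp_carrier P.I_notcarr by blast
  have mult_P: "x \<otimes> y \<in> carrier R - P" if "x \<in> carrier R - P" "y \<in> carrier R - P" for x y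
    using that PP.I_prime by blast
  obtain a where aP: "a \<in> P" and a: "a \<in> carrier R" "a \<noteq> \<zero>"
    using P(2) P.zero_closed P.Icarr by blast
  \<comment> \<open>The elements outside \<open>a R\<^sub>P\<close>; a maximal \<open>aR : b\<close> among them is prime, hence equal to \<open>P\<close>.\<close>
  define B where "B = {b \<in> carrier R. \<forall>u\<in>carrier R - P. \<not> a divides u \<otimes> b}"
  define colon where "colon b = {y \<in> carrier R. a divides y \<otimes> b}" for b
  have one_B: "\<one> \<in> B"
    using aP a by (auto simp: B_def factor_def P.I_r_closed)
  have colon_ideal: "ideal (colon b) R" if "b \<in> B" for b
    using that a unfolding colon_def B_def by (intro ideal_colon) auto
  have "\<exists>b\<in>B. \<forall>c\<in>B. colon b \<subseteq> colon c \<longrightarrow> colon c = colon b"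
    by (rule ideal_family_maximal) (use one_B colon_ideal in auto)
  then obtain b Q where b: "b \<in> B" "Q = colon b"
    and Q: "\<And>c. c \<in> B \<Longrightarrow> Q \<subseteq> colon c \<Longrightarrow> colon c = Q" by blast
  then have bc: "b \<in> carrier R" by (simp add: B_def)
  have nd: "\<not> a divides b"
    using b one_P bc unfolding B_def by (metis (no_types, lifting) CollectD DiffI l_one one_closed)
  have Q_P: "Q \<subseteq> P"
    using b by (auto simp: B_def colon_def)
  have Qi: "ideal Q R"
    unfolding b(2) colon_def by (rule ideal_colon[OF a(1) bc])
  \<comment> \<open>Multiplying \<open>b\<close> by \<open>u\<close> can only enlarge the colon
    ideal; by maximality it stays equal to \<open>Q\<close> as long as \<open>u \<otimes> b\<close>
    remains in \<open>B\<close>.\<close>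
  have Q_colon: "Q \<subseteq> colon (u \<otimes> b)" if u: "u \<in> carrier R" for u
  proof
    fix x assume "x \<in> Q"
    then obtain c where x: "x \<in> carrier R" and c: "c \<in> carrier R" "x \<otimes> b = a \<otimes> c"
      by (auto simp: b(2) colon_def factor_def)
    have "x \<otimes> (u \<otimes> b) = u \<otimes> (x \<otimes> b)" using x u bc by (simp add: m_lcomm)
    also have "\<dots> = a \<otimes> (u \<otimes> c)" unfolding c(2) using u c(1) a by (simp add: m_lcomm)
    finally show "x \<in> colon (u \<otimes> b)"
      using x u c(1) by (auto simp: colon_def factor_def)
  qed
  have "primeideal Q R"
  proof (rule primeidealI[OF Qi is_cring])
    show "carrier R \<noteq> Q" using Q_P one_P by blast
    fix y z assume y: "y \<in> carrier R" and z: "z \<in> carrier R" and yz: "y \<otimes> z \<in> Q"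
    show "y \<in> Q \<or> z \<in> Q"
    \<comment> \<open>If \<open>y b\<close> is still in \<open>B\<close>, its colon ideal is
      \<open>Q\<close> and contains \<open>z\<close>. If not, some \<open>u\<close> outside
      \<open>P\<close> has \<open>a\<close> dividing \<open>u y b\<close>; then \<open>u b\<close>
      is in \<open>B\<close>, its colon ideal is \<open>Q\<close>, and it contains
      \<open>y\<close>.\<close>
    proof (cases "y \<otimes> b \<in> B")
      case True
      have "Q \<subseteq> colon (y \<otimes> b)"
        using y by (rule Q_colon)
      then have "colon (y \<otimes> b) = Q" using Q True by blast
      moreover have "z \<in> colon (y \<otimes> b)"
        using yz z y bc by (simp add: b(2) colon_def m_ac)
      ultimately show ?thesis by blast
    next
      case False
      then obtain u where u: "u \<in> carrier R - P" "a divides u \<otimes> (y \<otimes> b)"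
        using y bc by (auto simp: B_def)
      have "\<not> a divides v \<otimes> (u \<otimes> b)" if v: "v \<in> carrier R - P" for v
      proof -
        have "\<not> a divides (v \<otimes> u) \<otimes> b" using b(1) mult_P[OF v u(1)] by (auto simp: B_def)
        then show ?thesis using v u bc by (simp add: m_assoc)
      qed
      then have uB: "u \<otimes> b \<in> B" using u bc by (simp add: B_def)
      have "Q \<subseteq> colon (u \<otimes> b)"
        using u by (intro Q_colon) blast
      then have "colon (u \<otimes> b) = Q" using Q uB by blast
      moreover have "y \<in> colon (u \<otimes> b)"
        using u y bc by (simp add: colon_def m_lcomm)
      ultimately show ?thesis by blast
    qed
  qed
  moreover have "a \<in> Q"
    using a bc by (auto simp: b(2) colon_def)
  ultimately have "maximalideal Q R"
    using a by (intro nonzero_prime_maximal) auto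
  then have PQ: "P = Q"
    using maximalideal.I_maximal[of Q R P] P.is_ideal Q_P P.a_subset P.I_notcarr by blast
  have aPb: "a divides y \<otimes> b" if "y \<in> P" for y
    using that unfolding PQ b(2) colon_def by blast
  \<comment> \<open>Multiplication by \<open>b / a\<close> maps \<open>P\<close> into
    \<open>R\<close>. If it mapped \<open>P\<close> into itself, all \<open>(b / a) [^] k a\<close>
    would lie in \<open>P\<close>, so \<open>b / a\<close> would be in \<open>R\<close> by
    \<open>almost_integral_divides\<close>. Hence it sends some \<open>p \<in> P\<close> to an
    \<open>s\<close> outside \<open>P\<close>.\<close>
  have "\<exists>p\<in>P. \<exists>y\<in>carrier R - P. b \<otimes> p = a \<otimes> y"
  proof (rule ccontr)
    assume neg: "\<not> ?thesis"
    have step: "\<exists>y\<in>P. b \<otimes> p = a \<otimes> y" if p: "p \<in> P" for p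
    proof -
      obtain y where "y \<in> carrier R" "p \<otimes> b = a \<otimes> y"
        using aPb[OF p] by (auto simp: factor_def)
      then have "y \<in> carrier R" "b \<otimes> p = a \<otimes> y"
        using bc P.Icarr[OF p] by (simp_all add: m_comm)
      then show ?thesis using neg p by blast
    qed
    have "\<exists>d\<in>P. a [^] k \<otimes> d = b [^] k \<otimes> a" for k :: nat
    proof (induction k)
      case 0
      then show ?case using aP by auto
    next
      case (Suc k)
      then obtain d where d: "d \<in> P" "a [^] k \<otimes> d = b [^] k \<otimes> a" by blast
      then obtain e where e: "e \<in> P" "b \<otimes> d = a \<otimes> e" using step by blast
      have "a [^] Suc k \<otimes> e = a [^] k \<otimes> (a \<otimes> e)" using a e(1) P.Icarr by (simp add: m_assoc)
      also have "\<dots> = b \<otimes> (a [^] k \<otimes> d)" unfolding e(2)[symmetric] using a bc d(1) P.Icarr by (simp add: m_lcomm)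
      also have "\<dots> = b [^] Suc k \<otimes> a" unfolding d(2) using a bc by (simp add: m_ac)
      finally show ?case using e by blast
    qed
    then have "a divides b"
      using P.Icarr by (intro almost_integral_divides a bc) blast
    then show False using nd by blast
  qed
  then obtain p s where ps: "p \<in> P" "s \<in> carrier R - P" "b \<otimes> p = a \<otimes> s" by blast
  \<comment> \<open>Since \<open>s = (b / a) p\<close>, the product \<open>s x\<close> equals
    \<open>p\<close> times \<open>(b / a) x\<close>, which is in \<open>R\<close>.\<close>
  have "p divides s \<otimes> x" if x: "x \<in> P" for x
  proof -
    obtain c where c: "c \<in> carrier R" "x \<otimes> b = a \<otimes> c"
      using aPb[OF x] by (auto simp: factor_def)
    have carr: "x \<in> carrier R" "p \<in> carrier R" "s \<in> carrier R" using x ps P.Icarr by auto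
    have "a \<otimes> (s \<otimes> x) = (a \<otimes> s) \<otimes> x" using a carr by (simp add: m_assoc)
    also have "\<dots> = p \<otimes> (x \<otimes> b)" unfolding ps(3)[symmetric] using carr bc by (simp add: m_ac)
    also have "\<dots> = a \<otimes> (p \<otimes> c)" unfolding c(2) using a carr c(1) by (simp add: m_ac)
    finally have "s \<otimes> x = p \<otimes> c" using a carr c(1) by (simp add: m_lcancel)
    then show ?thesis using c(1) by (auto simp: factor_def)
  qed
  then show ?thesis using that ps by blast
qed

text \<open>Division of \<open>a\<close> by \<open>p\<close> in the localization must stop: a
  quotient \<open>y\<close> with maximal \<open>J y\<close> admits no further division. The exponent
  \<open>n\<close> is the valuation of \<open>a\<close> at \<open>P\<close>, and \<open>u\<close>,
  \<open>w\<close> are units there.\<close>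

lemma local_factorization:
  assumes P: "maximalideal P R"
    and p: "p \<in> P" "s \<in> carrier R - P" "\<And>x. x \<in> P \<Longrightarrow> p divides s \<otimes> x"
    and a: "a \<in> carrier R" "a \<noteq> \<zero>"
  obtains n :: nat and u w where "u \<in> carrier R - P" "w \<in> carrier R - P" "u \<otimes> a = p [^] n \<otimes> w"
proof -
  interpret P: maximalideal P R by fact
  interpret PP: primeideal P R by (rule maximalideal_prime[OF P])
  have one_P: "\<one> \<in> carrier R - P" using P.one_imp_carrier P.I_notcarr by blast
  have mult_P: "x \<otimes> y \<in> carrier R - P" if "x \<in> carrier R - P" "y \<in> carrier R - P" for x y
    using that PP.I_prime by blast
  have pc: "p \<in> carrier R" using p P.Icarr by blast
  \<comment> \<open>\<open>Y\<close> collects the quotients of \<open>a\<close> by powers of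
    \<open>p\<close>, up to local units; \<open>J y\<close> is the contraction to \<open>R\<close>
    of the ideal generated by \<open>y\<close> in the localization.\<close>
  define Y where "Y = {y \<in> carrier R. \<exists>n::nat. \<exists>u\<in>carrier R - P. u \<otimes> a = p [^] n \<otimes> y}"
  define J where "J y = {z \<in> carrier R. \<exists>u\<in>carrier R - P. y divides u \<otimes> z}" for y
  have J_ideal: "ideal (J y) R" if y: "y \<in> carrier R" for y
  proof -
    have smult: "x \<otimes> z \<in> J y" if zx: "z \<in> J y" "x \<in> carrier R" for x z
    proof -
      obtain u c where u: "u \<in> carrier R - P" "c \<in> carrier R" "u \<otimes> z = y \<otimes> c" "z \<in> carrier R"
        using zx by (auto simp: J_def factor_def)
      have "u \<otimes> (x \<otimes> z) = x \<otimes> (u \<otimes> z)" using u(1,4) zx(2) by (simp add: m_lcomm)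
      also have "\<dots> = y \<otimes> (x \<otimes> c)" unfolding u(3) using u(2) zx(2) y by (simp add: m_lcomm)
      finally have "y divides u \<otimes> (x \<otimes> z)" using u(2) zx(2) by (auto simp: factor_def)
      then show ?thesis using u(1,4) zx(2) unfolding J_def by blast
    qed
    have add: "z \<oplus> z' \<in> J y" if zz: "z \<in> J y" "z' \<in> J y" for z z'
    proof -
      obtain u c where u: "u \<in> carrier R - P" "c \<in> carrier R" "u \<otimes> z = y \<otimes> c" "z \<in> carrier R"
        using zz by (auto simp: J_def factor_def)
      obtain u' c' where u': "u' \<in> carrier R - P" "c' \<in> carrier R" "u' \<otimes> z' = y \<otimes> c'" "z' \<in> carrier R"
        using zz by (auto simp: J_def factor_def)
      have carr: "u \<in> carrier R" "u' \<in> carrier R" using u u' by auto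
      have "u \<otimes> u' \<otimes> (z \<oplus> z') = u' \<otimes> (u \<otimes> z) \<oplus> u \<otimes> (u' \<otimes> z')"
        using carr u(4) u'(4) by (simp add: r_distr m_ac)
      also have "\<dots> = y \<otimes> (u' \<otimes> c \<oplus> u \<otimes> c')"
        unfolding u(3) u'(3) using carr u(2) u'(2) y by (simp add: r_distr m_ac)
      finally have "y divides u \<otimes> u' \<otimes> (z \<oplus> z')" using carr u(2) u'(2) by (auto simp: factor_def)
      then show ?thesis using mult_P[OF u(1) u'(1)] u(4) u'(4) by (auto simp: J_def)
    qed
    have zero: "\<zero> \<in> J y" using one_P y by (auto simp: J_def factor_def intro!: bexI[of _ \<one>] bexI[of _ \<zero>])
    have neg: "\<ominus> z \<in> J y" if z: "z \<in> J y" for z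
    proof -
      have "z \<in> carrier R" using z by (simp add: J_def)
      then show ?thesis using smult[OF z, of "\<ominus> \<one>"] by (simp add: l_minus)
    qed
    have Jc: "J y \<subseteq> carrier R" by (auto simp: J_def)
    show ?thesis
    proof (rule idealI[OF ring_axioms])
      show "subgroup (J y) (add_monoid R)"
        using zero add neg Jc by (intro add.subgroupI) (auto simp: a_inv_def[symmetric])
      fix z x assume zx: "z \<in> J y" "x \<in> carrier R"
      then show "x \<otimes> z \<in> J y" by (rule smult)
      then show "z \<otimes> x \<in> J y" using zx Jc by (simp add: m_comm subset_iff)
    qed
  qed
  have a_Y: "a \<in> Y" using a one_P by (auto simp: Y_def intro!: exI[of _ "0::nat"] bexI[of _ \<one>])
  have "\<exists>y\<in>Y. \<forall>z\<in>Y. J y \<subseteq> J z \<longrightarrow> J z = J y"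
    by (rule ideal_family_maximal) (use a_Y J_ideal in \<open>auto simp: Y_def\<close>)
  then obtain y where y: "y \<in> Y" and y_max: "\<And>z. z \<in> Y \<Longrightarrow> J y \<subseteq> J z \<Longrightarrow> J z = J y" by blast
  then obtain n :: nat and u where u: "u \<in> carrier R - P" "u \<otimes> a = p [^] n \<otimes> y" and yc: "y \<in> carrier R"
    by (auto simp: Y_def)
  \<comment> \<open>Otherwise \<open>s y = p y'\<close> gives a further quotient \<open>y'\<close>
    with \<open>J y \<subseteq> J y'\<close>. Equality makes \<open>y'\<close> locally a multiple of
    \<open>y\<close>, so \<open>p\<close> would divide \<open>s v\<close>, an element outside
    \<open>P\<close>.\<close>
  have "y \<notin> P"
  proof
    assume "y \<in> P"
    then obtain y' where y': "y' \<in> carrier R" "s \<otimes> y = p \<otimes> y'"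
      using p(3) by (auto simp: factor_def)
    have sc: "s \<in> carrier R" and uc: "u \<in> carrier R" using p(2) u(1) by auto
    have "y \<noteq> \<zero>" using u a pc P.zero_closed by (auto simp: integral_iff)
    moreover have "s \<noteq> \<zero>" using p(2) P.zero_closed by blast
    ultimately have y'0: "y' \<noteq> \<zero>" using y'(2) sc yc pc by (metis integral_iff r_null)
    have "(s \<otimes> u) \<otimes> a = p [^] n \<otimes> (s \<otimes> y)"
      using sc uc a pc yc u(2) by (metis m_assoc m_lcomm nat_pow_closed)
    also have "\<dots> = p [^] Suc n \<otimes> y'"
      unfolding y'(2) using pc y'(1) by (simp add: m_assoc)
    finally have "y' \<in> Y" using mult_P[OF p(2) u(1)] y'(1) unfolding Y_def by blast
    moreover have "J y \<subseteq> J y'"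
    proof
      fix z assume "z \<in> J y"
      then obtain v c where v: "v \<in> carrier R - P" "c \<in> carrier R" "v \<otimes> z = y \<otimes> c" "z \<in> carrier R"
        by (auto simp: J_def factor_def)
      have "s \<otimes> v \<otimes> z = (s \<otimes> y) \<otimes> c" using sc yc v by (simp add: m_assoc)
      also have "\<dots> = y' \<otimes> (p \<otimes> c)" unfolding y'(2) using pc y'(1) v(2) by (simp add: m_ac)
      finally have "y' divides s \<otimes> v \<otimes> z" using pc v(2) by (auto simp: factor_def)
      then show "z \<in> J y'" using mult_P[OF p(2) v(1)] v(4) unfolding J_def by blast
    qed
    ultimately have "J y' = J y" using y_max by blast
    moreover have "y' \<in> J y'" using y'(1) one_P by (auto simp: J_def intro!: bexI[of _ \<one>])
    ultimately obtain v c where v: "v \<in> carrier R - P" "c \<in> carrier R" "v \<otimes> y' = y \<otimes> c"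
      by (auto simp: J_def factor_def)
    have "y' \<otimes> (s \<otimes> v) = s \<otimes> (v \<otimes> y')" using y'(1) sc v(1) by (simp add: m_ac)
    also have "\<dots> = (s \<otimes> y) \<otimes> c" unfolding v(3) using sc yc v(2) by (simp add: m_assoc)
    also have "\<dots> = y' \<otimes> (p \<otimes> c)" unfolding y'(2) using pc y'(1) v(2) by (simp add: m_ac)
    finally have "s \<otimes> v = p \<otimes> c" using y' y'0 sc v pc by (simp add: m_lcancel)
    moreover have "p \<otimes> c \<in> P" using p(1) v(2) by (rule P.I_r_closed)
    ultimately show False using mult_P[OF p(2) v(1)] by auto
  qed
  then have "y \<in> carrier R - P" using yc by blast
  then show ?thesis using that u by blast
qed

end

section \<open>Complements of pure bounded submodules\<close>

context module
begin

lemma submodule_mem_carrier: "submodule S R M \<Longrightarrow> x \<in> S \<Longrightarrow> x \<in> carrier M"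
  using submoduleE(1) by blast

lemma submodule_zero: "submodule S R M \<Longrightarrow> \<zero>\<^bsub>M\<^esub> \<in> S"
  using submoduleE(2,4) submodule_mem_carrier
  by (metis R.zero_closed ex_in_conv smult_l_null)

lemma submodule_minus:
  "submodule S R M \<Longrightarrow> x \<in> S \<Longrightarrow> y \<in> S \<Longrightarrow> x \<ominus>\<^bsub>M\<^esub> y \<in> S"
  unfolding M.minus_eq by (intro submoduleE(3,5))

lemma submodule_add_cancel:
  assumes "submodule S R M" "y \<in> S" "x \<in> carrier M" "x \<oplus>\<^bsub>M\<^esub> y \<in> S"
  shows "x \<in> S"
proof -
  have y: "y \<in> carrier M" using assms submodule_mem_carrier by blast
  have "(x \<oplus>\<^bsub>M\<^esub> y) \<ominus>\<^bsub>M\<^esub> y = x"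
    using assms(3) y by (simp add: M.minus_eq M.a_assoc M.r_neg)
  then show ?thesis using submodule_minus[OF assms(1,4,2)] by simp
qed

lemma submodule_minus_cancel:
  assumes "submodule S R M" "y \<in> S" "x \<in> carrier M" "x \<ominus>\<^bsub>M\<^esub> y \<in> S"
  shows "x \<in> S"
  using assms submodule_add_cancel[of S "\<ominus>\<^bsub>M\<^esub> y" x] submoduleE(3)[OF assms(1)]
  by (simp add: M.minus_eq)

lemma mem_set_add_iff: "x \<in> A <+>\<^bsub>M\<^esub> B \<longleftrightarrow> (\<exists>a\<in>A. \<exists>b\<in>B. x = a \<oplus>\<^bsub>M\<^esub> b)"
  by (auto simp: set_add_def')

lemma submodule_set_add:
  assumes A: "submodule A R M" and B: "submodule B R M"
  shows "submodule (A <+>\<^bsub>M\<^esub> B) R M"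
proof (rule submoduleI)
  note A_carr = submodule_mem_carrier[OF A] and B_carr = submodule_mem_carrier[OF B]
  show "A <+>\<^bsub>M\<^esub> B \<subseteq> carrier M"
    using A_carr B_carr by (auto simp: mem_set_add_iff)
  show "\<zero>\<^bsub>M\<^esub> \<in> A <+>\<^bsub>M\<^esub> B"
    unfolding mem_set_add_iff using submodule_zero[OF A] submodule_zero[OF B]
    by (metis M.l_zero M.zero_closed)
  fix x assume "x \<in> A <+>\<^bsub>M\<^esub> B"
  then obtain a b where ab: "a \<in> A" "b \<in> B" "x = a \<oplus>\<^bsub>M\<^esub> b" by (auto simp: mem_set_add_iff)
  have "\<ominus>\<^bsub>M\<^esub> x = \<ominus>\<^bsub>M\<^esub> a \<oplus>\<^bsub>M\<^esub> \<ominus>\<^bsub>M\<^esub> b"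
    using ab A_carr B_carr by (simp add: M.minus_add)
  then show "\<ominus>\<^bsub>M\<^esub> x \<in> A <+>\<^bsub>M\<^esub> B"
    unfolding mem_set_add_iff using ab submoduleE(3)[OF A] submoduleE(3)[OF B] by blast
  {
    fix y assume "y \<in> A <+>\<^bsub>M\<^esub> B"
    then obtain a' b' where ab': "a' \<in> A" "b' \<in> B" "y = a' \<oplus>\<^bsub>M\<^esub> b'" by (auto simp: mem_set_add_iff)
    have "x \<oplus>\<^bsub>M\<^esub> y = (a \<oplus>\<^bsub>M\<^esub> a') \<oplus>\<^bsub>M\<^esub> (b \<oplus>\<^bsub>M\<^esub> b')"
      using ab ab' A_carr B_carr by (simp add: M.a_ac)
    then show "x \<oplus>\<^bsub>M\<^esub> y \<in> A <+>\<^bsub>M\<^esub> B"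
      unfolding mem_set_add_iff using ab ab' submoduleE(5)[OF A] submoduleE(5)[OF B] by blast
  }
  fix c assume c: "c \<in> carrier R"
  have "c \<odot>\<^bsub>M\<^esub> x = c \<odot>\<^bsub>M\<^esub> a \<oplus>\<^bsub>M\<^esub> c \<odot>\<^bsub>M\<^esub> b"
    using ab c A_carr B_carr by (simp add: smult_r_distr)
  then show "c \<odot>\<^bsub>M\<^esub> x \<in> A <+>\<^bsub>M\<^esub> B"
    unfolding mem_set_add_iff using ab c submoduleE(4)[OF A] submoduleE(4)[OF B] by blast
qed

lemma set_add_left: "submodule B R M \<Longrightarrow> a \<in> A \<Longrightarrow> a \<in> carrier M \<Longrightarrow> a \<in> A <+>\<^bsub>M\<^esub> B"
  unfolding mem_set_add_iff using submodule_zero by (metis M.r_zero)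

lemma set_add_right: "submodule A R M \<Longrightarrow> b \<in> B \<Longrightarrow> b \<in> carrier M \<Longrightarrow> b \<in> A <+>\<^bsub>M\<^esub> B"
  unfolding mem_set_add_iff using submodule_zero by (metis M.l_zero)

lemma submodule_smult_carrier:
  assumes a: "a \<in> carrier R"
  shows "submodule ((\<lambda>x. a \<odot>\<^bsub>M\<^esub> x) ` carrier M) R M"
proof (rule submoduleI)
  show "\<zero>\<^bsub>M\<^esub> \<in> (\<lambda>x. a \<odot>\<^bsub>M\<^esub> x) ` carrier M"
    using a by (intro image_eqI[of _ _ "\<zero>\<^bsub>M\<^esub>"]) auto
next
  fix x assume "x \<in> (\<lambda>x. a \<odot>\<^bsub>M\<^esub> x) ` carrier M"
  then obtain y where y: "y \<in> carrier M" "x = a \<odot>\<^bsub>M\<^esub> y" by blast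
  show "\<ominus>\<^bsub>M\<^esub> x \<in> (\<lambda>x. a \<odot>\<^bsub>M\<^esub> x) ` carrier M"
    using y a by (intro image_eqI[of _ _ "\<ominus>\<^bsub>M\<^esub> y"]) (auto simp: smult_r_minus)
  fix c assume c: "c \<in> carrier R"
  show "c \<odot>\<^bsub>M\<^esub> x \<in> (\<lambda>x. a \<odot>\<^bsub>M\<^esub> x) ` carrier M"
    using y a c by (intro image_eqI[of _ _ "c \<odot>\<^bsub>M\<^esub> y"]) (auto simp: smult_assoc1[symmetric] m_comm)
next
  fix x y assume "x \<in> (\<lambda>x. a \<odot>\<^bsub>M\<^esub> x) ` carrier M" "y \<in> (\<lambda>x. a \<odot>\<^bsub>M\<^esub> x) ` carrier M"
  then show "x \<oplus>\<^bsub>M\<^esub> y \<in> (\<lambda>x. a \<odot>\<^bsub>M\<^esub> x) ` carrier M"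
    using a by (auto simp: smult_r_distr[symmetric])
qed (use a in auto)

lemma submodule_cyclic:
  assumes x: "x \<in> carrier M"
  shows "submodule ((\<lambda>a. a \<odot>\<^bsub>M\<^esub> x) ` carrier R) R M"
proof (rule submoduleI)
  show "\<zero>\<^bsub>M\<^esub> \<in> (\<lambda>a. a \<odot>\<^bsub>M\<^esub> x) ` carrier R"
    using x by (intro image_eqI[of _ _ "\<zero>\<^bsub>R\<^esub>"]) auto
next
  fix y assume "y \<in> (\<lambda>a. a \<odot>\<^bsub>M\<^esub> x) ` carrier R"
  then obtain a where a: "a \<in> carrier R" "y = a \<odot>\<^bsub>M\<^esub> x" by blast
  show "\<ominus>\<^bsub>M\<^esub> y \<in> (\<lambda>a. a \<odot>\<^bsub>M\<^esub> x) ` carrier R"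
    using x a by (intro image_eqI[of _ _ "\<ominus> a"]) (auto simp: smult_l_minus)
  fix c assume c: "c \<in> carrier R"
  show "c \<odot>\<^bsub>M\<^esub> y \<in> (\<lambda>a. a \<odot>\<^bsub>M\<^esub> x) ` carrier R"
    using x a c by (intro image_eqI[of _ _ "c \<otimes> a"]) (auto simp: smult_assoc1)
next
  fix y z assume "y \<in> (\<lambda>a. a \<odot>\<^bsub>M\<^esub> x) ` carrier R" "z \<in> (\<lambda>a. a \<odot>\<^bsub>M\<^esub> x) ` carrier R"
  then show "y \<oplus>\<^bsub>M\<^esub> z \<in> (\<lambda>a. a \<odot>\<^bsub>M\<^esub> x) ` carrier R"
    using x by (auto simp: smult_l_distr[symmetric])
qed (use x in auto)

text \<open>The annihilator of the class of \<open>x\<close> in \<open>M / S\<close>, expressed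
  inside \<open>M\<close> so that no quotient has to be built.\<close>

definition annihilator_mod :: "'c set \<Rightarrow> 'c \<Rightarrow> 'a set" where
  "annihilator_mod S x = {a \<in> carrier R. a \<odot>\<^bsub>M\<^esub> x \<in> S}"

lemma ideal_annihilator_mod:
  assumes S: "submodule S R M" and x: "x \<in> carrier M"
  shows "ideal (annihilator_mod S x) R"
proof (rule idealI[OF R.ring_axioms])
  show "subgroup (annihilator_mod S x) (add_monoid R)"
  proof (rule R.add.subgroupI)
    have "\<zero> \<in> annihilator_mod S x"
      using x submodule_zero[OF S] by (simp add: annihilator_mod_def)
    then show "annihilator_mod S x \<noteq> {}" by blast
  next
    fix a assume "a \<in> annihilator_mod S x"
    then show "\<ominus> a \<in> annihilator_mod S x"
      using x submoduleE(3)[OF S] by (simp add: annihilator_mod_def smult_l_minus)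
  next
    fix a b assume "a \<in> annihilator_mod S x" "b \<in> annihilator_mod S x"
    then show "a \<oplus> b \<in> annihilator_mod S x"
      using x submoduleE(5)[OF S] by (simp add: annihilator_mod_def smult_l_distr)
  qed (auto simp: annihilator_mod_def)
  fix a c assume "a \<in> annihilator_mod S x" "c \<in> carrier R"
  then show "c \<otimes> a \<in> annihilator_mod S x"
    using x submoduleE(4)[OF S] by (auto simp: annihilator_mod_def smult_assoc1)
  then show "a \<otimes> c \<in> annihilator_mod S x"
    using \<open>a \<in> annihilator_mod S x\<close> \<open>c \<in> carrier R\<close> by (simp add: annihilator_mod_def R.m_comm)
qed

text \<open>The class of \<open>x\<close> is killed by \<open>P\<close> and by \<open>u\<close>,
  hence by the ideal they generate, which is \<open>R\<close>. This is how factors outside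
  \<open>P\<close> are cancelled without localizing.\<close>

lemma smult_cancel_mod_maximal:
  assumes S: "submodule S R M" and x: "x \<in> carrier M" and P: "maximalideal P R"
    and PS: "P \<subseteq> annihilator_mod S x" and u: "u \<in> carrier R - P" "u \<odot>\<^bsub>M\<^esub> x \<in> S"
  shows "x \<in> S"
proof -
  interpret A: ideal "annihilator_mod S x" R by (rule ideal_annihilator_mod[OF S x])
  have "u \<in> annihilator_mod S x" using u unfolding annihilator_mod_def by blast
  then have "annihilator_mod S x = carrier R"
    using maximalideal.I_maximal[OF P A.is_ideal PS A.a_subset] u(1) by blast
  then have "\<one> \<odot>\<^bsub>M\<^esub> x \<in> S" using R.one_closed unfolding annihilator_mod_def by blast
  then show ?thesis using x by simp
qed

end

text \<open>A maximal one among the annihilators of nonzero multiples of a class is prime: if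
  \<open>b\<close> is outside it, multiplying the class by \<open>b\<close> gives a nonzero class
  with the same annihilator. It contains \<open>r \<noteq> \<zero>\<close>, so dimension one makes
  it maximal.\<close>

lemma (in dedekind_domain) exists_maximal_annihilator:
  assumes M: "module R M" and S: "submodule S R M" and x: "x \<in> carrier M" "x \<notin> S"
    and r: "r \<in> carrier R" "r \<noteq> \<zero>" "r \<odot>\<^bsub>M\<^esub> x \<in> S"
  obtains a where "a \<in> carrier R" "a \<odot>\<^bsub>M\<^esub> x \<notin> S"
    "maximalideal (module.annihilator_mod R M S (a \<odot>\<^bsub>M\<^esub> x)) R"
    "module.annihilator_mod R M S (a \<odot>\<^bsub>M\<^esub> x) \<noteq> {\<zero>}"
proof -
  interpret M: module R M by fact
  let ?A = "{a \<in> carrier R. a \<odot>\<^bsub>M\<^esub> x \<notin> S}" and ?ann = "M.annihilator_mod S"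
  have one_A: "\<one> \<in> ?A" using x by simp
  have "\<exists>a\<in>?A. \<forall>b\<in>?A. ?ann (a \<odot>\<^bsub>M\<^esub> x) \<subseteq> ?ann (b \<odot>\<^bsub>M\<^esub> x) \<longrightarrow> ?ann (b \<odot>\<^bsub>M\<^esub> x) = ?ann (a \<odot>\<^bsub>M\<^esub> x)"
  proof (rule ideal_family_maximal)
    show "?A \<noteq> {}" using one_A by blast
    show "ideal (?ann (a \<odot>\<^bsub>M\<^esub> x)) R" if "a \<in> ?A" for a
      using that x by (intro M.ideal_annihilator_mod[OF S] M.smult_closed) auto
  qed
  then obtain a where a: "a \<in> carrier R" "a \<odot>\<^bsub>M\<^esub> x \<notin> S"
    and a_max: "\<And>b. b \<in> carrier R \<Longrightarrow> b \<odot>\<^bsub>M\<^esub> x \<notin> S \<Longrightarrow>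
      ?ann (a \<odot>\<^bsub>M\<^esub> x) \<subseteq> ?ann (b \<odot>\<^bsub>M\<^esub> x) \<Longrightarrow> ?ann (b \<odot>\<^bsub>M\<^esub> x) = ?ann (a \<odot>\<^bsub>M\<^esub> x)"
    by blast
  let ?P = "?ann (a \<odot>\<^bsub>M\<^esub> x)"
  have P: "ideal ?P R" using a x by (intro M.ideal_annihilator_mod S) auto
  have "primeideal ?P R"
  proof (rule primeidealI[OF P is_cring])
    have "\<one> \<notin> ?P" using a x by (simp add: M.annihilator_mod_def)
    then show "carrier R \<noteq> ?P" using one_closed by blast
    fix b c assume b: "b \<in> carrier R" and c: "c \<in> carrier R" and bc: "b \<otimes> c \<in> ?P"
    show "b \<in> ?P \<or> c \<in> ?P"
    proof (cases "b \<in> ?P")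
      case False
      then have "(b \<otimes> a) \<odot>\<^bsub>M\<^esub> x \<notin> S"
        using b a x by (simp add: M.annihilator_mod_def M.smult_assoc1)
      moreover have "?P \<subseteq> ?ann ((b \<otimes> a) \<odot>\<^bsub>M\<^esub> x)"
      proof
        fix d assume d: "d \<in> ?P"
        then have dc: "d \<in> carrier R" by (simp add: M.annihilator_mod_def)
        have "d \<odot>\<^bsub>M\<^esub> ((b \<otimes> a) \<odot>\<^bsub>M\<^esub> x) = b \<odot>\<^bsub>M\<^esub> (d \<odot>\<^bsub>M\<^esub> (a \<odot>\<^bsub>M\<^esub> x))"
          using a b dc x by (simp add: M.smult_assoc1[symmetric] m_ac)
        also have "\<dots> \<in> S" using d b M.submoduleE(4)[OF S] by (simp add: M.annihilator_mod_def)
        finally show "d \<in> ?ann ((b \<otimes> a) \<odot>\<^bsub>M\<^esub> x)" using dc by (simp add: M.annihilator_mod_def)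
      qed
      ultimately have eq: "?ann ((b \<otimes> a) \<odot>\<^bsub>M\<^esub> x) = ?P" using a_max a b by blast
      have "c \<odot>\<^bsub>M\<^esub> ((b \<otimes> a) \<odot>\<^bsub>M\<^esub> x) = (b \<otimes> c) \<odot>\<^bsub>M\<^esub> (a \<odot>\<^bsub>M\<^esub> x)"
        using a b c x by (simp add: M.smult_assoc1[symmetric] m_ac)
      then have "c \<in> ?ann ((b \<otimes> a) \<odot>\<^bsub>M\<^esub> x)"
        using bc c by (simp add: M.annihilator_mod_def)
      then show ?thesis using eq by blast
    qed blast
  qed
  moreover have "r \<in> ?P"
  proof -
    have "r \<odot>\<^bsub>M\<^esub> (a \<odot>\<^bsub>M\<^esub> x) = a \<odot>\<^bsub>M\<^esub> (r \<odot>\<^bsub>M\<^esub> x)"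
      using a r x by (simp add: M.smult_assoc1[symmetric] m_comm)
    then show ?thesis using a r M.submoduleE(4)[OF S] by (simp add: M.annihilator_mod_def)
  qed
  then have "?P \<noteq> {\<zero>}" using r by blast
  ultimately show ?thesis using that a nonzero_prime_maximal by blast
qed

context dedekind_domain
begin

text \<open>The last assumption is purity of \<open>T\<close>: a coset of \<open>T\<close> killed by \<open>r\<close> contains an element with
  the same annihilator as the coset.\<close>
lemma pure_bounded_complement:
  assumes M: "module R M" and T: "submodule T R M"
    and r: "r \<in> carrier R" "r \<noteq> \<zero>" "\<And>t. t \<in> T \<Longrightarrow> r \<odot>\<^bsub>M\<^esub> t = \<zero>\<^bsub>M\<^esub>"
    and pure: "\<And>e. e \<in> carrier M \<Longrightarrow> r \<odot>\<^bsub>M\<^esub> e \<in> T \<Longrightarrow>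
      \<exists>t\<in>T. \<forall>a\<in>carrier R. a \<odot>\<^bsub>M\<^esub> e \<in> T \<longrightarrow> a \<odot>\<^bsub>M\<^esub> e = a \<odot>\<^bsub>M\<^esub> t"
  obtains C where "submodule C R M" "C \<inter> T \<subseteq> {\<zero>\<^bsub>M\<^esub>}" "C <+>\<^bsub>M\<^esub> T = carrier M"
proof -
  interpret M: module R M by fact
  define \<M> where "\<M> = {P. maximalideal P R \<and> P \<noteq> {\<zero>}}"
  have maxideal: "maximalideal P R" if "P \<in> \<M>" for P
    using that by (simp add: \<M>_def)
  have max_carr: "x \<in> carrier R" if "P \<in> \<M>" "x \<in> P" for P x
    using ideal.Icarr[OF maximalideal.axioms(1)[OF maxideal[OF that(1)]] that(2)] .
  have max_mult: "x \<otimes> y \<in> carrier R - P" if P: "P \<in> \<M>" and "x \<in> carrier R - P" "y \<in> carrier R - P" for P x y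
    using that(2,3) primeideal.I_prime[OF maximalideal_prime[OF maxideal[OF P]]] by blast
  have max_one: "\<one> \<in> carrier R - P" if "P \<in> \<M>" for P
    using maximalideal.I_notcarr[OF maxideal[OF that]]
      ideal.one_imp_carrier[OF maximalideal.axioms(1)[OF maxideal[OF that]]] by blast
  have "\<forall>P. \<exists>ps. P \<in> \<M> \<longrightarrow> fst ps \<in> P \<and> snd ps \<in> carrier R - P \<and> (\<forall>x\<in>P. fst ps divides snd ps \<otimes> x)"
  proof
    fix P
    show "\<exists>ps. P \<in> \<M> \<longrightarrow> fst ps \<in> P \<and> snd ps \<in> carrier R - P \<and> (\<forall>x\<in>P. fst ps divides snd ps \<otimes> x)"
    proof (cases "P \<in> \<M>")
      case True
      then have "maximalideal P R" "P \<noteq> {\<zero>}" by (auto simp: \<M>_def)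
      then obtain p s where "p \<in> P" "s \<in> carrier R - P" "\<And>x. x \<in> P \<Longrightarrow> p divides s \<otimes> x"
        by (rule local_uniformizer) (rule that)
      then show ?thesis by (intro exI[of _ "(p, s)"]) simp
    qed blast
  qed
  then obtain ps where ps: "\<And>P. P \<in> \<M> \<Longrightarrow>
      fst (ps P) \<in> P \<and> snd (ps P) \<in> carrier R - P \<and> (\<forall>x\<in>P. fst (ps P) divides snd (ps P) \<otimes> x)"
    by metis
  define \<pi> where "\<pi> P = fst (ps P)" for P
  define \<sigma> where "\<sigma> P = snd (ps P)" for P
  have \<pi>: "\<pi> P \<in> P" and \<sigma>: "\<sigma> P \<in> carrier R - P" and \<pi>_div: "\<And>x. x \<in> P \<Longrightarrow> \<pi> P divides \<sigma> P \<otimes> x"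
    if "P \<in> \<M>" for P
    using ps[OF that] by (auto simp: \<pi>_def \<sigma>_def)
  have \<pi>_carr [simp]: "\<pi> P \<in> carrier R" if "P \<in> \<M>" for P
    using max_carr[OF that \<pi>[OF that]] .
  \<comment> \<open>The exponent \<open>n\<close> is the valuation of \<open>r\<close> at
    \<open>P\<close>: locally \<open>r\<close> and \<open>\<pi> P [^] n\<close> differ by a unit, so
    \<open>\<pi> P [^] n\<close> kills \<open>T\<close> and carries \<open>M\<close> into
    \<open>r M\<close>.\<close>
  have r_factor: "\<exists>n::nat. \<exists>u\<in>carrier R - P. \<exists>w\<in>carrier R - P. u \<otimes> r = \<pi> P [^] n \<otimes> w" if P: "P \<in> \<M>" for P
    using local_factorization[OF maxideal[OF P] \<pi>[OF P] \<sigma>[OF P] \<pi>_div[OF P] r(1,2)] by metis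
  note T_carr = M.submodule_mem_carrier[OF T]
  define E where "E P k = (\<lambda>x. \<pi> P [^] (k::nat) \<odot>\<^bsub>M\<^esub> x) ` carrier M" for P k
  have E: "submodule (E P k) R M" if "P \<in> \<M>" for P k
    unfolding E_def using that by (intro M.submodule_smult_carrier) simp
  \<comment> \<open>\<open>P\<^sup>k (M / C) \<inter> T = P\<^sup>k T\<close> after localizing at any maximal \<open>P\<close>; the case of large \<open>k\<close> forces \<open>C \<inter> T = 0\<close>.\<close>
  define Pure where "Pure C \<longleftrightarrow> submodule C R M \<and> (\<forall>x\<in>carrier M. r \<odot>\<^bsub>M\<^esub> x \<in> C) \<and>
    (\<forall>P\<in>\<M>. \<forall>k. \<forall>u\<in>carrier R - P. \<forall>t\<in>T. u \<odot>\<^bsub>M\<^esub> t \<in> C <+>\<^bsub>M\<^esub> E P k \<longrightarrow>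
      (\<exists>v\<in>carrier R - P. \<exists>t'\<in>T. v \<odot>\<^bsub>M\<^esub> t = \<pi> P [^] k \<odot>\<^bsub>M\<^esub> t'))" for C
  \<comment> \<open>The least admissible submodule starts Zorn's lemma; only here is the assumption
    \<open>pure\<close> used.\<close>
  have Pure_rM: "Pure ((\<lambda>x. r \<odot>\<^bsub>M\<^esub> x) ` carrier M)"
    unfolding Pure_def
  proof (intro conjI ballI allI impI M.submodule_smult_carrier r(1))
    fix P k u t
    assume P: "P \<in> \<M>" and u: "u \<in> carrier R - P" and t: "t \<in> T"
      and "u \<odot>\<^bsub>M\<^esub> t \<in> (\<lambda>x. r \<odot>\<^bsub>M\<^esub> x) ` carrier M <+>\<^bsub>M\<^esub> E P k"
    then obtain x y where x: "x \<in> carrier M" and y: "y \<in> carrier M"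
      and ut: "u \<odot>\<^bsub>M\<^esub> t = r \<odot>\<^bsub>M\<^esub> x \<oplus>\<^bsub>M\<^esub> \<pi> P [^] k \<odot>\<^bsub>M\<^esub> y"
      unfolding E_def M.mem_set_add_iff by blast
    define q where "q = \<pi> P [^] k"
    have q: "q \<in> carrier R" using P by (simp add: q_def)
    have tc: "t \<in> carrier M" using T_carr t .
    have uc: "u \<in> carrier R" using u by blast
    obtain n :: nat and u' w where u': "u' \<in> carrier R - P" and w: "w \<in> carrier R - P"
      and fac: "u' \<otimes> r = \<pi> P [^] n \<otimes> w"
      using r_factor[OF P] by blast
    have u'c: "u' \<in> carrier R" and wc: "w \<in> carrier R" using u' w by auto
    show "\<exists>v\<in>carrier R - P. \<exists>t'\<in>T. v \<odot>\<^bsub>M\<^esub> t = \<pi> P [^] k \<odot>\<^bsub>M\<^esub> t'"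
    proof (cases "k \<le> n")
      \<comment> \<open>Locally \<open>\<pi> P [^] k\<close> divides \<open>r\<close>, so a multiple
        of \<open>t\<close> is \<open>q e\<close>. Purity needs an element carried into
        \<open>T\<close> by \<open>r\<close>; this is \<open>u' e\<close>, since
        \<open>r u' = w' q\<close>. That is why \<open>u'\<close> occurs twice in the final
        multiplier.\<close>
      case True
      define w' where "w' = \<pi> P [^] (n - k) \<otimes> w"
      have w': "w' \<in> carrier R" using P wc by (simp add: w'_def)
      have "\<pi> P [^] k \<otimes> \<pi> P [^] (n - k) = \<pi> P [^] n"
        using True P by (simp add: nat_pow_mult)
      then have fac': "u' \<otimes> r = q \<otimes> w'"
        using fac P wc by (simp add: q_def w'_def m_assoc[symmetric])
      define e where "e = w' \<odot>\<^bsub>M\<^esub> x \<oplus>\<^bsub>M\<^esub> u' \<odot>\<^bsub>M\<^esub> y"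
      have e: "e \<in> carrier M" using w' u'c x y by (simp add: e_def)
      have "(u' \<otimes> u) \<odot>\<^bsub>M\<^esub> t = (u' \<otimes> r) \<odot>\<^bsub>M\<^esub> x \<oplus>\<^bsub>M\<^esub> (q \<otimes> u') \<odot>\<^bsub>M\<^esub> y"
        using u'c uc tc ut r(1) q x y
        by (simp add: M.smult_assoc1 M.smult_r_distr q_def[symmetric] m_comm[of q])
      also have "\<dots> = q \<odot>\<^bsub>M\<^esub> e"
        unfolding fac' e_def using u'c w' q x y by (simp add: M.smult_assoc1 M.smult_r_distr)
      finally have qe: "(u' \<otimes> u) \<odot>\<^bsub>M\<^esub> t = q \<odot>\<^bsub>M\<^esub> e" .
      have qeT: "q \<odot>\<^bsub>M\<^esub> e \<in> T"
        unfolding qe[symmetric] using u'c uc t M.submoduleE(4)[OF T] by simp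
      have "r \<odot>\<^bsub>M\<^esub> (u' \<odot>\<^bsub>M\<^esub> e) = w' \<odot>\<^bsub>M\<^esub> (q \<odot>\<^bsub>M\<^esub> e)"
        using fac' r(1) u'c q w' e by (simp add: M.smult_assoc1[symmetric] m_comm)
      also have "\<dots> \<in> T" using qeT w' M.submoduleE(4)[OF T] by simp
      finally have "r \<odot>\<^bsub>M\<^esub> (u' \<odot>\<^bsub>M\<^esub> e) \<in> T" .
      then obtain t' where t': "t' \<in> T"
        and lift: "\<And>a. a \<in> carrier R \<Longrightarrow> a \<odot>\<^bsub>M\<^esub> (u' \<odot>\<^bsub>M\<^esub> e) \<in> T \<Longrightarrow> a \<odot>\<^bsub>M\<^esub> (u' \<odot>\<^bsub>M\<^esub> e) = a \<odot>\<^bsub>M\<^esub> t'"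
        using pure[of "u' \<odot>\<^bsub>M\<^esub> e"] u'c e by blast
      have sw: "q \<odot>\<^bsub>M\<^esub> (u' \<odot>\<^bsub>M\<^esub> e) = u' \<odot>\<^bsub>M\<^esub> (q \<odot>\<^bsub>M\<^esub> e)"
        using q u'c e by (simp add: M.smult_assoc1[symmetric] m_comm)
      have "(u' \<otimes> (u' \<otimes> u)) \<odot>\<^bsub>M\<^esub> t = u' \<odot>\<^bsub>M\<^esub> (q \<odot>\<^bsub>M\<^esub> e)"
        using u'c uc tc by (simp add: M.smult_assoc1[of u' "u' \<otimes> u"] qe)
      also have "\<dots> = q \<odot>\<^bsub>M\<^esub> t'"
        using lift[OF q] qeT u'c M.submoduleE(4)[OF T] by (simp add: sw)
      finally show ?thesis
        using t' max_mult[OF P u' max_mult[OF P u' u]] unfolding q_def by blast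
    next
      \<comment> \<open>Locally \<open>\<pi> P [^] k\<close> is now a multiple of \<open>r\<close>,
        so a multiple of \<open>t\<close> is \<open>r e\<close>. Purity replaces \<open>e\<close> by
        an element of \<open>T\<close>, and \<open>r T = 0\<close> makes that multiple zero.\<close>
      case False
      define z where "z = \<pi> P [^] (k - n) \<otimes> u'"
      have z: "z \<in> carrier R" using P u'c by (simp add: z_def)
      have "\<pi> P [^] n \<otimes> \<pi> P [^] (k - n) = q"
        using False P by (simp add: nat_pow_mult q_def)
      then have "w \<otimes> q = \<pi> P [^] (k - n) \<otimes> (u' \<otimes> r)"
        unfolding fac using P wc by (metis \<pi>_carr m_comm m_lcomm nat_pow_closed)
      then have wq: "w \<otimes> q = r \<otimes> z"
        using P u'c r(1) by (simp add: z_def m_ac)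
      define e where "e = w \<odot>\<^bsub>M\<^esub> x \<oplus>\<^bsub>M\<^esub> z \<odot>\<^bsub>M\<^esub> y"
      have e: "e \<in> carrier M" using wc z x y by (simp add: e_def)
      have "(w \<otimes> u) \<odot>\<^bsub>M\<^esub> t = (r \<otimes> w) \<odot>\<^bsub>M\<^esub> x \<oplus>\<^bsub>M\<^esub> (w \<otimes> q) \<odot>\<^bsub>M\<^esub> y"
        using wc uc tc ut r(1) q x y
        by (simp add: M.smult_assoc1 M.smult_r_distr q_def[symmetric] m_comm[of r])
      also have "\<dots> = r \<odot>\<^bsub>M\<^esub> e"
        unfolding wq e_def using wc z r(1) x y by (simp add: M.smult_assoc1 M.smult_r_distr)
      finally have re: "(w \<otimes> u) \<odot>\<^bsub>M\<^esub> t = r \<odot>\<^bsub>M\<^esub> e" .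
      have "r \<odot>\<^bsub>M\<^esub> e \<in> T"
        unfolding re[symmetric] using wc uc t M.submoduleE(4)[OF T] by simp
      then obtain t' where "t' \<in> T" "r \<odot>\<^bsub>M\<^esub> e = r \<odot>\<^bsub>M\<^esub> t'"
        using pure[OF e] r(1) by blast
      then have "(w \<otimes> u) \<odot>\<^bsub>M\<^esub> t = \<pi> P [^] k \<odot>\<^bsub>M\<^esub> \<zero>\<^bsub>M\<^esub>"
        using re r(3) P by simp
      then show ?thesis
        using max_mult[OF P w u] M.submodule_zero[OF T] by blast
    qed
  qed blast
  have "\<exists>C\<in>Collect Pure. \<forall>D\<in>Collect Pure. C \<subseteq> D \<longrightarrow> D = C"
  proof (rule subset_Zorn_nonempty)
    fix \<C> assume ne: "\<C> \<noteq> {}" and chain: "subset.chain (Collect Pure) \<C>"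
    have P: "Pure C" if "C \<in> \<C>" for C using chain that by (auto simp: subset_chain_def)
    have sub: "submodule C R M" if "C \<in> \<C>" for C using P[OF that] by (simp add: Pure_def)
    have lin: "C \<subseteq> D \<or> D \<subseteq> C" if "C \<in> \<C>" "D \<in> \<C>" for C D
      using chain that by (auto simp: subset_chain_def)
    have "submodule (\<Union>\<C>) R M"
    proof (rule M.submoduleI)
      show "\<Union>\<C> \<subseteq> carrier M" using M.submodule_mem_carrier[OF sub] by blast
      show "\<zero>\<^bsub>M\<^esub> \<in> \<Union>\<C>" using ne M.submodule_zero[OF sub] by blast
      fix x y assume "x \<in> \<Union>\<C>" "y \<in> \<Union>\<C>"
      then obtain C where "C \<in> \<C>" "x \<in> C" "y \<in> C" using lin by blast
      then show "x \<oplus>\<^bsub>M\<^esub> y \<in> \<Union>\<C>" using M.submoduleE(5)[OF sub] by blast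
    next
      fix x assume "x \<in> \<Union>\<C>"
      then show "\<ominus>\<^bsub>M\<^esub> x \<in> \<Union>\<C>" using M.submoduleE(3)[OF sub] by blast
      fix a assume "a \<in> carrier R"
      then show "a \<odot>\<^bsub>M\<^esub> x \<in> \<Union>\<C>" using \<open>x \<in> \<Union>\<C>\<close> M.submoduleE(4)[OF sub] by blast
    qed
    moreover have "\<forall>x\<in>carrier M. r \<odot>\<^bsub>M\<^esub> x \<in> \<Union>\<C>"
      using ne P unfolding Pure_def by blast
    moreover have "\<exists>v\<in>carrier R - P. \<exists>t'\<in>T. v \<odot>\<^bsub>M\<^esub> t = \<pi> P [^] k \<odot>\<^bsub>M\<^esub> t'"
      if *: "P \<in> \<M>" "u \<in> carrier R - P" "t \<in> T" "u \<odot>\<^bsub>M\<^esub> t \<in> \<Union>\<C> <+>\<^bsub>M\<^esub> E P k" for P k u t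
    proof -
      obtain C where C: "C \<in> \<C>" "u \<odot>\<^bsub>M\<^esub> t \<in> C <+>\<^bsub>M\<^esub> E P k"
        using *(4) unfolding M.mem_set_add_iff by blast
      show ?thesis using P[OF C(1)] C(2) *(1-3) unfolding Pure_def by blast
    qed
    ultimately show "\<Union>\<C> \<in> Collect Pure" unfolding Pure_def by blast
  qed (use Pure_rM in blast)
  then obtain C where "Pure C" and C_max: "\<And>D. Pure D \<Longrightarrow> C \<subseteq> D \<Longrightarrow> D = C" by blast
  then have C: "submodule C R M" and rC: "\<And>x. x \<in> carrier M \<Longrightarrow> r \<odot>\<^bsub>M\<^esub> x \<in> C"
    and C_pure: "\<And>P k u t. P \<in> \<M> \<Longrightarrow> u \<in> carrier R - P \<Longrightarrow> t \<in> T \<Longrightarrow> u \<odot>\<^bsub>M\<^esub> t \<in> C <+>\<^bsub>M\<^esub> E P k \<Longrightarrow>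
      \<exists>v\<in>carrier R - P. \<exists>t'\<in>T. v \<odot>\<^bsub>M\<^esub> t = \<pi> P [^] k \<odot>\<^bsub>M\<^esub> t'"
    unfolding Pure_def by blast+
  note C_carr = M.submodule_mem_carrier[OF C]
  have S: "submodule (C <+>\<^bsub>M\<^esub> E P k) R M" if "P \<in> \<M>" for P k
    by (rule M.submodule_set_add[OF C E[OF that]])
  have C_S: "x \<in> C <+>\<^bsub>M\<^esub> E P k" if "P \<in> \<M>" "x \<in> C" for P k x
    using M.set_add_left[OF E[OF that(1)] that(2) C_carr[OF that(2)]] .
  have E_S: "\<pi> P [^] k \<odot>\<^bsub>M\<^esub> x \<in> C <+>\<^bsub>M\<^esub> E P k" if "P \<in> \<M>" "x \<in> carrier M" for P k x
    using that by (intro M.set_add_right[OF C]) (auto simp: E_def)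
  have CT: "submodule (C <+>\<^bsub>M\<^esub> T) R M" by (rule M.submodule_set_add[OF C T])
  have C_CT: "x \<in> C <+>\<^bsub>M\<^esub> T" if "x \<in> C" for x
    using M.set_add_left[OF T that C_carr[OF that]] .
  have T_CT: "x \<in> C <+>\<^bsub>M\<^esub> T" if "x \<in> T" for x
    using M.set_add_right[OF C that T_carr[OF that]] .
  \<comment> \<open>Take a nonzero multiple \<open>y\<close> of a common element with maximal
    annihilator \<open>P\<close>, and \<open>k = n\<close>, the exponent of \<open>r\<close> at
    \<open>P\<close>. Purity makes a multiple of \<open>y\<close> equal to
    \<open>\<pi> P [^] n t'\<close>, which is killed by \<open>w\<close> because
    \<open>r T = 0\<close>. Then \<open>w v \<in> P\<close> although both factors are outside
    \<open>P\<close>.\<close>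
  have "C \<inter> T \<subseteq> {\<zero>\<^bsub>M\<^esub>}"
  proof (rule ccontr)
    assume "\<not> ?thesis"
    then obtain t where t: "t \<in> C" "t \<in> T" "t \<notin> {\<zero>\<^bsub>M\<^esub>}" by blast
    have Z: "submodule {\<zero>\<^bsub>M\<^esub>} R M" by (rule M.submoduleI) auto
    obtain a where a: "a \<in> carrier R" "a \<odot>\<^bsub>M\<^esub> t \<notin> {\<zero>\<^bsub>M\<^esub>}"
      "maximalideal (M.annihilator_mod {\<zero>\<^bsub>M\<^esub>} (a \<odot>\<^bsub>M\<^esub> t)) R"
      "M.annihilator_mod {\<zero>\<^bsub>M\<^esub>} (a \<odot>\<^bsub>M\<^esub> t) \<noteq> {\<zero>}"
      by (rule exists_maximal_annihilator[OF M Z T_carr[OF t(2)] t(3) r(1,2)])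
        (use r(3)[OF t(2)] in auto)
    define y where "y = a \<odot>\<^bsub>M\<^esub> t"
    define P where "P = M.annihilator_mod {\<zero>\<^bsub>M\<^esub>} y"
    have P: "P \<in> \<M>" using a by (simp add: \<M>_def P_def y_def)
    have y: "y \<in> C" "y \<in> T" "y \<in> carrier M"
      unfolding y_def using a t M.submoduleE(4)[OF C] M.submoduleE(4)[OF T] T_carr by auto
    obtain n :: nat and u w where u: "u \<in> carrier R - P" and w: "w \<in> carrier R - P"
      and fac: "u \<otimes> r = \<pi> P [^] n \<otimes> w"
      using r_factor[OF P] by blast
    have uc: "u \<in> carrier R" and wc: "w \<in> carrier R" using u w by auto
    have "\<one> \<odot>\<^bsub>M\<^esub> y \<in> C <+>\<^bsub>M\<^esub> E P n" using C_S[OF P y(1)] y(3) by simp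
    then obtain v t' where v: "v \<in> carrier R - P" "t' \<in> T" "v \<odot>\<^bsub>M\<^esub> y = \<pi> P [^] n \<odot>\<^bsub>M\<^esub> t'"
      using C_pure[OF P max_one[OF P] y(2)] by blast
    have t'c: "t' \<in> carrier M" using T_carr v(2) .
    have "(w \<otimes> v) \<odot>\<^bsub>M\<^esub> y = w \<odot>\<^bsub>M\<^esub> (\<pi> P [^] n \<odot>\<^bsub>M\<^esub> t')"
      using wc v y by (simp add: M.smult_assoc1)
    also have "\<dots> = u \<odot>\<^bsub>M\<^esub> (r \<odot>\<^bsub>M\<^esub> t')"
      using wc uc r(1) P t'c fac by (simp add: M.smult_assoc1[symmetric] m_comm)
    also have "\<dots> = \<zero>\<^bsub>M\<^esub>" using r(3)[OF v(2)] uc by simp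
    finally have "w \<otimes> v \<in> P"
      using wc v(1) unfolding P_def M.annihilator_mod_def by simp
    then show False using max_mult[OF P w v(1)] by blast
  qed
  moreover have "C <+>\<^bsub>M\<^esub> T = carrier M"
  proof (rule ccontr)
    assume "C <+>\<^bsub>M\<^esub> T \<noteq> carrier M"
    then obtain x where x: "x \<in> carrier M" "x \<notin> C <+>\<^bsub>M\<^esub> T"
      using M.submodule_mem_carrier[OF CT] by blast
    obtain a where a: "a \<in> carrier R" "a \<odot>\<^bsub>M\<^esub> x \<notin> C <+>\<^bsub>M\<^esub> T"
      "maximalideal (M.annihilator_mod (C <+>\<^bsub>M\<^esub> T) (a \<odot>\<^bsub>M\<^esub> x)) R"
      "M.annihilator_mod (C <+>\<^bsub>M\<^esub> T) (a \<odot>\<^bsub>M\<^esub> x) \<noteq> {\<zero>}"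
      by (rule exists_maximal_annihilator[OF M CT x r(1,2) C_CT[OF rC[OF x(1)]]])
    define y where "y = a \<odot>\<^bsub>M\<^esub> x"
    define P where "P = M.annihilator_mod (C <+>\<^bsub>M\<^esub> T) y"
    have P: "P \<in> \<M>" using a by (simp add: \<M>_def P_def y_def)
    note mP = maxideal[OF P]
    have y: "y \<in> carrier M" "y \<notin> C <+>\<^bsub>M\<^esub> T" using a x by (simp_all add: y_def)
    define p where "p = \<pi> P"
    define s where "s = \<sigma> P"
    have p: "p \<in> P" "p \<in> carrier R" and s: "s \<in> carrier R - P" "s \<in> carrier R"
      using \<pi>[OF P] \<sigma>[OF P] \<pi>_carr[OF P] by (auto simp: p_def s_def)
    \<comment> \<open>The annihilator condition is modulo \<open>C\<close>, not just modulo
      \<open>C + T\<close>: then \<open>C + R z\<close> exceeds \<open>C\<close> only by a module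
      killed by \<open>P\<close>, and purity is at stake only at \<open>P\<close>.\<close>
    define H where "H = {z \<in> carrier M. z \<notin> C <+>\<^bsub>M\<^esub> T \<and> P \<subseteq> M.annihilator_mod C z}"
    have cancel_CT: "z \<in> C <+>\<^bsub>M\<^esub> T"
      if "z \<in> carrier M" "P \<subseteq> M.annihilator_mod (C <+>\<^bsub>M\<^esub> T) z" "u \<in> carrier R - P" "u \<odot>\<^bsub>M\<^esub> z \<in> C <+>\<^bsub>M\<^esub> T" for z u
      using M.smult_cancel_mod_maximal[OF CT that(1) mP that(2-4)] .
    have ann_CT: "P \<subseteq> M.annihilator_mod (C <+>\<^bsub>M\<^esub> T) z" if "P \<subseteq> M.annihilator_mod C z" for z
      using that C_CT unfolding M.annihilator_mod_def by blast
    \<comment> \<open>The element \<open>p\<close> generates \<open>P\<close> only locally;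
      multiplying by \<open>s\<close> turns annihilation by \<open>p\<close> into annihilation by
      all of \<open>P\<close>.\<close>
    have ann_s: "P \<subseteq> M.annihilator_mod C (s \<odot>\<^bsub>M\<^esub> z)" if z: "z \<in> carrier M" "p \<odot>\<^bsub>M\<^esub> z \<in> C" for z
    proof
      fix q assume q: "q \<in> P"
      then have qc: "q \<in> carrier R" using max_carr[OF P] by blast
      obtain c where c: "c \<in> carrier R" "s \<otimes> q = p \<otimes> c"
        using \<pi>_div[OF P q] by (auto simp: factor_def p_def s_def)
      have "q \<odot>\<^bsub>M\<^esub> (s \<odot>\<^bsub>M\<^esub> z) = (s \<otimes> q) \<odot>\<^bsub>M\<^esub> z"
        using qc s(2) z(1) by (simp add: M.smult_assoc1[symmetric] m_comm)
      also have "\<dots> = c \<odot>\<^bsub>M\<^esub> (p \<odot>\<^bsub>M\<^esub> z)"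
        unfolding c(2) using c(1) p(2) z(1) by (simp add: M.smult_assoc1[symmetric] m_comm)
      also have "\<dots> \<in> C" using c(1) z(2) M.submoduleE(4)[OF C] by blast
      finally show "q \<in> M.annihilator_mod C (s \<odot>\<^bsub>M\<^esub> z)" using qc by (simp add: M.annihilator_mod_def)
    qed
    \<comment> \<open>Subtracting \<open>t\<close> does not change the class modulo
      \<open>T\<close>, and \<open>s\<close>, \<open>v\<close> are outside \<open>P\<close>, so the
      new element stays outside \<open>C + T\<close>. The correction \<open>t\<close> serves to
      bring the \<open>p\<close>-multiple into \<open>C\<close>.\<close>
    have H_intro: "s \<odot>\<^bsub>M\<^esub> (v \<odot>\<^bsub>M\<^esub> z \<ominus>\<^bsub>M\<^esub> t) \<in> H"
      if z: "z \<in> carrier M" "z \<notin> C <+>\<^bsub>M\<^esub> T" "P \<subseteq> M.annihilator_mod (C <+>\<^bsub>M\<^esub> T) z"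
        and v: "v \<in> carrier R - P" and t: "t \<in> T" and pz: "p \<odot>\<^bsub>M\<^esub> (v \<odot>\<^bsub>M\<^esub> z \<ominus>\<^bsub>M\<^esub> t) \<in> C" for z v t
    proof -
      have tc: "t \<in> carrier M" and vc: "v \<in> carrier R" using T_carr t v by auto
      have "s \<odot>\<^bsub>M\<^esub> (v \<odot>\<^bsub>M\<^esub> z \<ominus>\<^bsub>M\<^esub> t) \<notin> C <+>\<^bsub>M\<^esub> T"
      proof
        assume "s \<odot>\<^bsub>M\<^esub> (v \<odot>\<^bsub>M\<^esub> z \<ominus>\<^bsub>M\<^esub> t) \<in> C <+>\<^bsub>M\<^esub> T"
        moreover have "s \<odot>\<^bsub>M\<^esub> (v \<odot>\<^bsub>M\<^esub> z \<ominus>\<^bsub>M\<^esub> t) = (s \<otimes> v) \<odot>\<^bsub>M\<^esub> z \<ominus>\<^bsub>M\<^esub> s \<odot>\<^bsub>M\<^esub> t"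
          using s(2) vc z(1) tc by (simp add: M.M.minus_eq M.smult_r_distr M.smult_r_minus M.smult_assoc1)
        moreover have "s \<odot>\<^bsub>M\<^esub> t \<in> C <+>\<^bsub>M\<^esub> T" using T_CT M.submoduleE(4)[OF T s(2) t] by blast
        moreover have "(s \<otimes> v) \<odot>\<^bsub>M\<^esub> z \<in> carrier M" using s(2) vc z(1) by simp
        ultimately have "(s \<otimes> v) \<odot>\<^bsub>M\<^esub> z \<in> C <+>\<^bsub>M\<^esub> T"
          using M.submodule_minus_cancel[OF CT] by metis
        then show False using cancel_CT[OF z(1,3) max_mult[OF P s(1) v]] z(2) by blast
      qed
      then show ?thesis
        unfolding H_def using ann_s[OF _ pz] s(2) vc z(1) tc by simp
    qed
    \<comment> \<open>If \<open>p y = c + t\<close>, then \<open>t\<close> is in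
      \<open>C + p M\<close>. Purity for \<open>k = 1\<close> gives \<open>v t = p t'\<close>, and
      subtracting \<open>t'\<close> from \<open>v y\<close> removes the \<open>T\<close>-part of the
      \<open>p\<close>-multiple.\<close>
    have "\<exists>z. z \<in> H"
    proof -
      have "p \<odot>\<^bsub>M\<^esub> y \<in> C <+>\<^bsub>M\<^esub> T"
        using p(1) by (simp add: P_def M.annihilator_mod_def)
      then obtain c t where c: "c \<in> C" and t: "t \<in> T" and py: "p \<odot>\<^bsub>M\<^esub> y = c \<oplus>\<^bsub>M\<^esub> t"
        unfolding M.mem_set_add_iff by blast
      have cc: "c \<in> carrier M" and tc: "t \<in> carrier M" using C_carr[OF c] T_carr[OF t] .
      have "t \<oplus>\<^bsub>M\<^esub> c \<in> C <+>\<^bsub>M\<^esub> E P 1"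
        using E_S[OF P y(1), of 1] py cc tc p(2) by (simp add: p_def M.M.a_comm)
      then have "\<one> \<odot>\<^bsub>M\<^esub> t \<in> C <+>\<^bsub>M\<^esub> E P 1"
        using M.submodule_add_cancel[OF S[OF P] C_S[OF P c] tc] tc by simp
      then obtain v t' where v: "v \<in> carrier R - P" "t' \<in> T" "v \<odot>\<^bsub>M\<^esub> t = \<pi> P [^] (1::nat) \<odot>\<^bsub>M\<^esub> t'"
        using C_pure[OF P max_one[OF P] t] by blast
      have vt: "v \<odot>\<^bsub>M\<^esub> t = p \<odot>\<^bsub>M\<^esub> t'" using v(3) p(2) by (simp add: p_def)
      have vc: "v \<in> carrier R" and t'c: "t' \<in> carrier M" using v T_carr by auto
      have "p \<odot>\<^bsub>M\<^esub> (v \<odot>\<^bsub>M\<^esub> y \<ominus>\<^bsub>M\<^esub> t') = v \<odot>\<^bsub>M\<^esub> (p \<odot>\<^bsub>M\<^esub> y) \<ominus>\<^bsub>M\<^esub> p \<odot>\<^bsub>M\<^esub> t'"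
        using p(2) vc y(1) t'c
        by (simp add: M.M.minus_eq M.smult_r_distr M.smult_r_minus M.smult_assoc1[symmetric] m_comm)
      also have "\<dots> = v \<odot>\<^bsub>M\<^esub> c"
        unfolding py using vc cc tc p(2) t'c
        by (simp add: M.smult_r_distr vt M.M.minus_eq M.M.a_assoc M.M.r_neg)
      also have "\<dots> \<in> C" using M.submoduleE(4)[OF C vc c] .
      finally have "s \<odot>\<^bsub>M\<^esub> (v \<odot>\<^bsub>M\<^esub> y \<ominus>\<^bsub>M\<^esub> t') \<in> H"
        using H_intro[OF y _ v(1,2)] unfolding P_def by blast
      then show ?thesis by blast
    qed
    then obtain z0 where z0: "z0 \<in> H" by blast
    obtain n :: nat and u w where u: "u \<in> carrier R - P" and w: "w \<in> carrier R - P"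
      and fac: "u \<otimes> r = \<pi> P [^] n \<otimes> w"
      using r_factor[OF P] by blast
    have uc: "u \<in> carrier R" and wc: "w \<in> carrier R" using u w by auto
    \<comment> \<open>For \<open>k \<ge> n\<close> the \<open>\<pi> P [^] k\<close>-part of
      \<open>z\<close> is locally in \<open>r M \<subseteq> C\<close>, so
      \<open>w z \<in> C\<close>. As \<open>P z \<subseteq> C\<close> and
      \<open>w \<notin> P\<close>, this forces \<open>z \<in> C\<close>.\<close>
    have height: "k < n" if z: "z \<in> H" "z \<in> C <+>\<^bsub>M\<^esub> E P k" for z k
    proof (rule ccontr)
      assume "\<not> k < n"
      then have k: "\<pi> P [^] n \<otimes> \<pi> P [^] (k - n) = \<pi> P [^] k"
        using P by (simp add: nat_pow_mult)
      obtain c e where c: "c \<in> C" and e: "e \<in> carrier M" and ze: "z = c \<oplus>\<^bsub>M\<^esub> \<pi> P [^] k \<odot>\<^bsub>M\<^esub> e"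
        using z(2) unfolding M.mem_set_add_iff E_def by blast
      have cc: "c \<in> carrier M" using C_carr[OF c] .
      define e' where "e' = \<pi> P [^] (k - n) \<odot>\<^bsub>M\<^esub> e"
      have e': "e' \<in> carrier M" using P e by (simp add: e'_def)
      have "\<pi> P [^] k \<odot>\<^bsub>M\<^esub> e = \<pi> P [^] n \<odot>\<^bsub>M\<^esub> e'"
        unfolding e'_def k[symmetric] using P e by (simp add: M.smult_assoc1)
      then have "w \<odot>\<^bsub>M\<^esub> z = w \<odot>\<^bsub>M\<^esub> c \<oplus>\<^bsub>M\<^esub> w \<odot>\<^bsub>M\<^esub> (\<pi> P [^] n \<odot>\<^bsub>M\<^esub> e')"
        unfolding ze using wc cc P e' by (simp add: M.smult_r_distr)
      also have "w \<odot>\<^bsub>M\<^esub> (\<pi> P [^] n \<odot>\<^bsub>M\<^esub> e') = r \<odot>\<^bsub>M\<^esub> (u \<odot>\<^bsub>M\<^esub> e')"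
        using wc uc r(1) P e' fac by (simp add: M.smult_assoc1[symmetric] m_comm)
      also have "w \<odot>\<^bsub>M\<^esub> c \<oplus>\<^bsub>M\<^esub> r \<odot>\<^bsub>M\<^esub> (u \<odot>\<^bsub>M\<^esub> e') \<in> C"
        using M.submoduleE(5)[OF C M.submoduleE(4)[OF C wc c] rC] uc e' by simp
      finally have "z \<in> C"
        using M.smult_cancel_mod_maximal[OF C _ mP _ w] z(1) unfolding H_def by blast
      then show False using C_CT z(1) unfolding H_def by blast
    qed
    \<comment> \<open>The lower bounds for \<open>P\<close>-heights modulo \<open>C\<close> attained
      in \<open>H\<close>. The set contains \<open>0\<close> because \<open>E P 0\<close> is all of
      \<open>M\<close>, and \<open>height\<close> makes it finite, so its maximum \<open>h\<close>
      exists.\<close>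
    define K where "K = {k. \<exists>z\<in>H. z \<in> C <+>\<^bsub>M\<^esub> E P k}"
    have "K \<subseteq> {..<n}" using height by (auto simp: K_def)
    then have finK: "finite K" by (rule finite_subset) simp
    have "0 \<in> K"
    proof -
      have "z0 \<in> C <+>\<^bsub>M\<^esub> E P 0" using E_S[OF P, of z0 0] z0 by (simp add: H_def)
      then show ?thesis using z0 by (auto simp: K_def)
    qed
    define h where "h = Max K"
    have "h \<in> K" using finK \<open>0 \<in> K\<close> unfolding h_def by (intro Max_in) auto
    have h_max: "k \<le> h" if "k \<in> K" for k using Max_ge[OF finK that] by (simp add: h_def)
    obtain z where "z \<in> H" and zh: "z \<in> C <+>\<^bsub>M\<^esub> E P h" using \<open>h \<in> K\<close> by (auto simp: K_def)
    then have z: "z \<in> carrier M" "z \<notin> C <+>\<^bsub>M\<^esub> T" "P \<subseteq> M.annihilator_mod C z"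
      by (auto simp: H_def)
    define D where "D = C <+>\<^bsub>M\<^esub> (\<lambda>a. a \<odot>\<^bsub>M\<^esub> z) ` carrier R"
    have cyc: "submodule ((\<lambda>a. a \<odot>\<^bsub>M\<^esub> z) ` carrier R) R M" by (rule M.submodule_cyclic[OF z(1)])
    have D: "submodule D R M" unfolding D_def by (rule M.submodule_set_add[OF C cyc])
    have CD: "C \<subseteq> D" unfolding D_def using M.set_add_left[OF cyc] C_carr by blast
    have "z = \<one> \<odot>\<^bsub>M\<^esub> z" using z(1) by simp
    then have "z \<in> D" unfolding D_def using z(1) by (intro M.set_add_right[OF C]) blast+
    have "Pure D"
      unfolding Pure_def
    proof (intro conjI ballI allI impI D)
      show "r \<odot>\<^bsub>M\<^esub> x \<in> D" if "x \<in> carrier M" for x using rC[OF that] CD by blast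
      fix Q k u t
      assume Q: "Q \<in> \<M>" and u: "u \<in> carrier R - Q" and t: "t \<in> T"
        and "u \<odot>\<^bsub>M\<^esub> t \<in> D <+>\<^bsub>M\<^esub> E Q k"
      then obtain d e where d: "d \<in> D" and e: "e \<in> carrier M"
        and "u \<odot>\<^bsub>M\<^esub> t = d \<oplus>\<^bsub>M\<^esub> \<pi> Q [^] k \<odot>\<^bsub>M\<^esub> e"
        unfolding M.mem_set_add_iff E_def by blast
      then obtain c a where c: "c \<in> C" and a: "a \<in> carrier R"
        and ut: "u \<odot>\<^bsub>M\<^esub> t = (c \<oplus>\<^bsub>M\<^esub> a \<odot>\<^bsub>M\<^esub> z) \<oplus>\<^bsub>M\<^esub> \<pi> Q [^] k \<odot>\<^bsub>M\<^esub> e"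
        unfolding D_def M.mem_set_add_iff by blast
      have cc: "c \<in> carrier M" and tc: "t \<in> carrier M" and uc: "u \<in> carrier R"
        using C_carr[OF c] T_carr[OF t] u by auto
      let ?S = "C <+>\<^bsub>M\<^esub> E Q k"
      note S_add = M.submoduleE(5)[OF S[OF Q]] and S_smult = M.submoduleE(4)[OF S[OF Q]]
      \<comment> \<open>Purity of \<open>D\<close> reduces to that of \<open>C\<close> once the
        contribution \<open>a z\<close> is absorbed into \<open>C + E Q k\<close> by a factor
        outside \<open>Q\<close>.\<close>
      have goal: "\<exists>v\<in>carrier R - Q. \<exists>t'\<in>T. v \<odot>\<^bsub>M\<^esub> t = \<pi> Q [^] k \<odot>\<^bsub>M\<^esub> t'"
        if v: "v \<in> carrier R - Q" and vaz: "v \<odot>\<^bsub>M\<^esub> (a \<odot>\<^bsub>M\<^esub> z) \<in> ?S" for v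
      proof -
        have vc: "v \<in> carrier R" using v by blast
        have "(v \<otimes> u) \<odot>\<^bsub>M\<^esub> t = (v \<odot>\<^bsub>M\<^esub> c \<oplus>\<^bsub>M\<^esub> v \<odot>\<^bsub>M\<^esub> (a \<odot>\<^bsub>M\<^esub> z)) \<oplus>\<^bsub>M\<^esub> v \<odot>\<^bsub>M\<^esub> (\<pi> Q [^] k \<odot>\<^bsub>M\<^esub> e)"
          using vc uc tc cc a z(1) Q e by (simp add: M.smult_assoc1[of v u] ut M.smult_r_distr)
        also have "\<dots> \<in> ?S"
          by (intro S_add vaz S_smult[OF vc] C_S[OF Q c] E_S[OF Q e])
        finally show ?thesis using C_pure[OF Q max_mult[OF Q v u] t] by blast
      qed
      have P_az: "q \<odot>\<^bsub>M\<^esub> (a \<odot>\<^bsub>M\<^esub> z) \<in> C" if q: "q \<in> P" for q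
      proof -
        have qc: "q \<in> carrier R" and qz: "q \<odot>\<^bsub>M\<^esub> z \<in> C"
          using z(3) q max_carr[OF P] unfolding M.annihilator_mod_def by blast+
        have "q \<odot>\<^bsub>M\<^esub> (a \<odot>\<^bsub>M\<^esub> z) = a \<odot>\<^bsub>M\<^esub> (q \<odot>\<^bsub>M\<^esub> z)"
          using qc a z(1) by (simp add: M.smult_assoc1[symmetric] m_comm)
        then show ?thesis using M.submoduleE(4)[OF C a qz] by simp
      qed
      show "\<exists>v\<in>carrier R - Q. \<exists>t'\<in>T. v \<odot>\<^bsub>M\<^esub> t = \<pi> Q [^] k \<odot>\<^bsub>M\<^esub> t'"
      proof (cases "Q = P")
        \<comment> \<open>Any \<open>v \<in> P\<close> outside \<open>Q\<close> carries
          \<open>a z\<close> into \<open>C\<close>.\<close>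
        case False
        have "\<not> P \<subseteq> Q"
          using maximalideal.I_maximal[OF mP maximalideal.axioms(1)[OF maxideal[OF Q]]]
            maximalideal.I_notcarr[OF maxideal[OF Q]] False max_carr[OF Q] by blast
        then obtain v where v: "v \<in> P" "v \<notin> Q" by blast
        show ?thesis
          using goal[of v] C_S[OF Q P_az[OF v(1)]] v max_carr[OF P] by blast
      next
        case QP: True
        show ?thesis
        proof (cases "a \<in> P")
          case True
          then have "\<one> \<odot>\<^bsub>M\<^esub> (a \<odot>\<^bsub>M\<^esub> z) \<in> ?S"
            using z a C_S[OF Q] unfolding M.annihilator_mod_def by auto
          then show ?thesis using goal max_one[OF Q] by blast
        next
          \<comment> \<open>Since \<open>a\<close> is outside \<open>P\<close>, the element
            \<open>y = a z\<close> inherits everything from \<open>z\<close>: outside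
            \<open>C + T\<close>, killed by \<open>P\<close> modulo \<open>C\<close>, of height at
            least \<open>h\<close>.\<close>
          case False
          then have aP: "a \<in> carrier R - P" using a by blast
          define y where "y = a \<odot>\<^bsub>M\<^esub> z"
          have yc: "y \<in> carrier M" using a z(1) by (simp add: y_def)
          have y_ann: "P \<subseteq> M.annihilator_mod C y"
            using P_az max_carr[OF P] unfolding M.annihilator_mod_def y_def by blast
          have yCT: "y \<notin> C <+>\<^bsub>M\<^esub> T"
            using cancel_CT[OF z(1) ann_CT[OF z(3)] aP] z(2) unfolding y_def by blast
          have yh: "y \<in> C <+>\<^bsub>M\<^esub> E P h"
            unfolding y_def by (rule M.submoduleE(4)[OF S[OF P] a zh])
          show ?thesis
          proof (cases "k \<le> h")
            case True
            have "\<pi> P [^] h \<odot>\<^bsub>M\<^esub> e' \<in> ?S" if "e' \<in> carrier M" for e'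
            proof -
              have "\<pi> P [^] k \<otimes> \<pi> P [^] (h - k) = \<pi> P [^] h"
                using True P by (simp add: nat_pow_mult)
              then have "\<pi> P [^] h \<odot>\<^bsub>M\<^esub> e' = \<pi> P [^] k \<odot>\<^bsub>M\<^esub> (\<pi> P [^] (h - k) \<odot>\<^bsub>M\<^esub> e')"
                using P that by (simp add: M.smult_assoc1[symmetric])
              then show ?thesis
                using E_S[OF P, of "\<pi> P [^] (h - k) \<odot>\<^bsub>M\<^esub> e'" k] P that QP by simp
            qed
            moreover obtain c' e' where "c' \<in> C" "e' \<in> carrier M" "y = c' \<oplus>\<^bsub>M\<^esub> \<pi> P [^] h \<odot>\<^bsub>M\<^esub> e'"
              using yh unfolding M.mem_set_add_iff E_def by blast
            ultimately have "y \<in> ?S" using S_add C_S[OF Q] by blast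
            then show ?thesis
              using goal[OF max_one[OF Q]] yc unfolding y_def by simp
          next
            \<comment> \<open>As \<open>p c\<close> and \<open>p y\<close> lie in \<open>C\<close>,
              purity of \<open>C\<close> at \<open>k + 1\<close> gives
              \<open>v p u t = p [^] Suc k t'\<close>. Then \<open>g = v u t - p [^] k t'\<close> is
              in \<open>T\<close> and killed by \<open>p\<close>, so \<open>s (v y - g)\<close>
              belongs to \<open>H\<close>. By \<open>e_eq\<close> its height is at least
              \<open>k > h\<close>, contradicting the choice of \<open>h\<close>.\<close>
            case False
            have pkc: "p [^] k \<in> carrier R" using p(2) by simp
            have ut': "u \<odot>\<^bsub>M\<^esub> t = (c \<oplus>\<^bsub>M\<^esub> y) \<oplus>\<^bsub>M\<^esub> p [^] k \<odot>\<^bsub>M\<^esub> e"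
              using ut by (simp add: y_def p_def QP)
            have py: "p \<odot>\<^bsub>M\<^esub> y \<in> C"
              using y_ann p(1) unfolding M.annihilator_mod_def by blast
            have "p \<odot>\<^bsub>M\<^esub> (u \<odot>\<^bsub>M\<^esub> t) = (p \<odot>\<^bsub>M\<^esub> c \<oplus>\<^bsub>M\<^esub> p \<odot>\<^bsub>M\<^esub> y) \<oplus>\<^bsub>M\<^esub> \<pi> P [^] Suc k \<odot>\<^bsub>M\<^esub> e"
              unfolding ut' using p(2) cc yc e pkc
              by (simp add: M.smult_r_distr p_def[symmetric] M.smult_assoc1[symmetric] m_comm)
            also have "\<dots> \<in> C <+>\<^bsub>M\<^esub> E P (Suc k)"
              by (intro M.submoduleE(5)[OF S[OF P]] C_S[OF P] E_S[OF P e] py M.submoduleE(4)[OF C p(2) c])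
            finally have "\<one> \<odot>\<^bsub>M\<^esub> (p \<odot>\<^bsub>M\<^esub> (u \<odot>\<^bsub>M\<^esub> t)) \<in> C <+>\<^bsub>M\<^esub> E P (Suc k)"
              using p(2) uc tc by simp
            moreover have "p \<odot>\<^bsub>M\<^esub> (u \<odot>\<^bsub>M\<^esub> t) \<in> T"
              by (intro M.submoduleE(4)[OF T] p(2) uc t)
            ultimately obtain v t' where v: "v \<in> carrier R - P" "t' \<in> T"
              and vt: "v \<odot>\<^bsub>M\<^esub> (p \<odot>\<^bsub>M\<^esub> (u \<odot>\<^bsub>M\<^esub> t)) = \<pi> P [^] Suc k \<odot>\<^bsub>M\<^esub> t'"
              using C_pure[OF P max_one[OF P]] by blast
            have vc: "v \<in> carrier R" and t'c: "t' \<in> carrier M" using v T_carr by auto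
            define g where "g = v \<odot>\<^bsub>M\<^esub> (u \<odot>\<^bsub>M\<^esub> t) \<ominus>\<^bsub>M\<^esub> p [^] k \<odot>\<^bsub>M\<^esub> t'"
            have g: "g \<in> T"
              unfolding g_def
              by (intro M.submodule_minus[OF T] M.submoduleE(4)[OF T] pkc vc uc t v(2))
            have gc: "g \<in> carrier M" using T_carr g .
            have pg: "p \<odot>\<^bsub>M\<^esub> g = \<zero>\<^bsub>M\<^esub>"
            proof -
              have "p \<odot>\<^bsub>M\<^esub> g = v \<odot>\<^bsub>M\<^esub> (p \<odot>\<^bsub>M\<^esub> (u \<odot>\<^bsub>M\<^esub> t)) \<ominus>\<^bsub>M\<^esub> p [^] Suc k \<odot>\<^bsub>M\<^esub> t'"
                unfolding g_def using p(2) vc uc tc t'c pkc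
                by (simp add: M.M.minus_eq M.smult_r_distr M.smult_r_minus M.smult_assoc1[symmetric] m_ac)
              then show ?thesis
                unfolding vt using p(2) t'c by (simp add: p_def[symmetric] M.M.minus_eq M.M.r_neg)
            qed
            have "p \<odot>\<^bsub>M\<^esub> (v \<odot>\<^bsub>M\<^esub> y \<ominus>\<^bsub>M\<^esub> g) = v \<odot>\<^bsub>M\<^esub> (p \<odot>\<^bsub>M\<^esub> y)"
              using p(2) vc yc gc pg
              by (simp add: M.M.minus_eq M.smult_r_distr M.smult_r_minus M.smult_assoc1[symmetric] m_comm M.M.r_neg)
            also have "\<dots> \<in> C" by (rule M.submoduleE(4)[OF C vc py])
            finally have inH: "s \<odot>\<^bsub>M\<^esub> (v \<odot>\<^bsub>M\<^esub> y \<ominus>\<^bsub>M\<^esub> g) \<in> H"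
              by (intro H_intro[OF yc yCT ann_CT[OF y_ann] v(1) g])
            have e_eq: "v \<odot>\<^bsub>M\<^esub> c \<oplus>\<^bsub>M\<^esub> p [^] k \<odot>\<^bsub>M\<^esub> (v \<odot>\<^bsub>M\<^esub> e \<ominus>\<^bsub>M\<^esub> t') = g \<ominus>\<^bsub>M\<^esub> v \<odot>\<^bsub>M\<^esub> y"
            proof -
              have sw: "p [^] k \<odot>\<^bsub>M\<^esub> (v \<odot>\<^bsub>M\<^esub> e) = v \<odot>\<^bsub>M\<^esub> (p [^] k \<odot>\<^bsub>M\<^esub> e)"
                using pkc vc e by (simp add: M.smult_assoc1[symmetric] m_comm)
              have "g \<ominus>\<^bsub>M\<^esub> v \<odot>\<^bsub>M\<^esub> y = v \<odot>\<^bsub>M\<^esub> c \<oplus>\<^bsub>M\<^esub> (v \<odot>\<^bsub>M\<^esub> (p [^] k \<odot>\<^bsub>M\<^esub> e) \<ominus>\<^bsub>M\<^esub> p [^] k \<odot>\<^bsub>M\<^esub> t')"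
                unfolding g_def ut' using vc cc yc pkc e t'c
                by (simp add: M.M.minus_eq M.smult_r_distr M.M.a_ac M.M.r_neg M.M.r_neg1 M.M.r_neg2)
              then show ?thesis
                using vc e t'c pkc by (simp add: M.M.minus_eq M.smult_r_distr M.smult_r_minus sw)
            qed
            have "g \<ominus>\<^bsub>M\<^esub> v \<odot>\<^bsub>M\<^esub> y \<in> C <+>\<^bsub>M\<^esub> E P k"
              unfolding e_eq[symmetric] p_def using vc e t'c
              by (intro M.submoduleE(5)[OF S[OF P]] C_S[OF P] E_S[OF P] M.submoduleE(4)[OF C vc c]) simp
            then have "\<ominus>\<^bsub>M\<^esub> (g \<ominus>\<^bsub>M\<^esub> v \<odot>\<^bsub>M\<^esub> y) \<in> C <+>\<^bsub>M\<^esub> E P k"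
              by (rule M.submoduleE(3)[OF S[OF P]])
            then have "v \<odot>\<^bsub>M\<^esub> y \<ominus>\<^bsub>M\<^esub> g \<in> C <+>\<^bsub>M\<^esub> E P k"
              using gc vc yc by (simp add: M.M.minus_eq M.M.minus_add M.M.a_comm)
            then have "s \<odot>\<^bsub>M\<^esub> (v \<odot>\<^bsub>M\<^esub> y \<ominus>\<^bsub>M\<^esub> g) \<in> C <+>\<^bsub>M\<^esub> E P k"
              by (rule M.submoduleE(4)[OF S[OF P] s(2)])
            then have "k \<in> K" using inH by (auto simp: K_def)
            then show ?thesis using h_max False by blast
          qed
        qed
      qed
    qed
    then have "D = C" using C_max CD by blast
    then show False using \<open>z \<in> D\<close> C_CT z(2) by blast
  qed
  ultimately show ?thesis using that C by blast
qed

end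

section \<open>Divisibility of homomorphisms\<close>

lemma linear_homsD:
  assumes "f \<in> linear_homs R M N"
  shows "x \<in> carrier M \<Longrightarrow> f x \<in> carrier N"
    and "x \<in> carrier M \<Longrightarrow> y \<in> carrier M \<Longrightarrow> f (x \<oplus>\<^bsub>M\<^esub> y) = f x \<oplus>\<^bsub>N\<^esub> f y"
    and "a \<in> carrier R \<Longrightarrow> x \<in> carrier M \<Longrightarrow> f (a \<odot>\<^bsub>M\<^esub> x) = a \<odot>\<^bsub>N\<^esub> f x"
  using assms unfolding linear_homs_def by blast+

text \<open>The pullback of \<open>f\<close> along multiplication by \<open>r\<close> on
  \<open>N\<close>; linear \<open>g\<close> with \<open>f = r g\<close> are the linear sections of
  its projection to \<open>M\<close>.\<close>

definition multiple_pairs ::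
  "('a, 'm, 's) module_scheme \<Rightarrow> ('a, 'n, 't) module_scheme \<Rightarrow> ('m \<Rightarrow> 'n) \<Rightarrow> 'a \<Rightarrow> ('a, 'm \<times> 'n) module"
  where "multiple_pairs M N f r =
    \<lparr>carrier = {(m, n). m \<in> carrier M \<and> n \<in> carrier N \<and> f m = r \<odot>\<^bsub>N\<^esub> n},
     mult = undefined, one = undefined, zero = (\<zero>\<^bsub>M\<^esub>, \<zero>\<^bsub>N\<^esub>),
     add = (\<lambda>(m, n) (m', n'). (m \<oplus>\<^bsub>M\<^esub> m', n \<oplus>\<^bsub>N\<^esub> n')),
     smult = (\<lambda>a (m, n). (a \<odot>\<^bsub>M\<^esub> m, a \<odot>\<^bsub>N\<^esub> n))\<rparr>"

lemma multiple_pairs_simps: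
  "(m, n) \<in> carrier (multiple_pairs M N f r) \<longleftrightarrow> m \<in> carrier M \<and> n \<in> carrier N \<and> f m = r \<odot>\<^bsub>N\<^esub> n"
  "\<zero>\<^bsub>multiple_pairs M N f r\<^esub> = (\<zero>\<^bsub>M\<^esub>, \<zero>\<^bsub>N\<^esub>)"
  "(m, n) \<oplus>\<^bsub>multiple_pairs M N f r\<^esub> (m', n') = (m \<oplus>\<^bsub>M\<^esub> m', n \<oplus>\<^bsub>N\<^esub> n')"
  "a \<odot>\<^bsub>multiple_pairs M N f r\<^esub> (m, n) = (a \<odot>\<^bsub>M\<^esub> m, a \<odot>\<^bsub>N\<^esub> n)"
  by (simp_all add: multiple_pairs_def)

lemma module_multiple_pairs:
  fixes R (structure)
  assumes M: "module R M" and N: "module R N" and f: "f \<in> linear_homs R M N" and r: "r \<in> carrier R"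
  shows "module R (multiple_pairs M N f r)"
proof -
  interpret M: module R M by fact
  interpret N: module R N by fact
  note f_closed = linear_homsD(1)[OF f] and f_add = linear_homsD(2)[OF f]
    and f_smult = linear_homsD(3)[OF f]
  have f_zero: "f \<zero>\<^bsub>M\<^esub> = \<zero>\<^bsub>N\<^esub>"
    using f_smult[of "\<zero>" "\<zero>\<^bsub>M\<^esub>"] f_closed by simp
  have comm: "r \<odot>\<^bsub>N\<^esub> (a \<odot>\<^bsub>N\<^esub> n) = a \<odot>\<^bsub>N\<^esub> (r \<odot>\<^bsub>N\<^esub> n)" if "a \<in> carrier R" "n \<in> carrier N" for a n
    using that r by (simp add: N.smult_assoc1[symmetric] M.R.m_comm)
  let ?E = "multiple_pairs M N f r"
  show ?thesis
  proof (rule moduleI)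
    show "cring R" by (rule M.R.is_cring)
    show "abelian_group ?E"
    proof (rule abelian_groupI)
      fix x assume "x \<in> carrier ?E"
      then obtain m n where x: "x = (m, n)" "m \<in> carrier M" "n \<in> carrier N" "f m = r \<odot>\<^bsub>N\<^esub> n"
        by (cases x) (simp add: multiple_pairs_simps)
      have "f (\<ominus>\<^bsub>M\<^esub> m) = r \<odot>\<^bsub>N\<^esub> (\<ominus>\<^bsub>N\<^esub> n)"
        using f_smult[of "\<ominus> \<one>" m] x r by (simp add: M.smult_l_minus N.smult_l_minus N.smult_r_minus)
      then show "\<exists>y\<in>carrier ?E. y \<oplus>\<^bsub>?E\<^esub> x = \<zero>\<^bsub>?E\<^esub>"
        using x by (intro bexI[of _ "(\<ominus>\<^bsub>M\<^esub> m, \<ominus>\<^bsub>N\<^esub> n)"])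
          (simp_all add: multiple_pairs_simps M.M.l_neg N.M.l_neg)
    next
      fix x y z assume "x \<in> carrier ?E" "y \<in> carrier ?E" "z \<in> carrier ?E"
      then show "x \<oplus>\<^bsub>?E\<^esub> y \<oplus>\<^bsub>?E\<^esub> z = x \<oplus>\<^bsub>?E\<^esub> (y \<oplus>\<^bsub>?E\<^esub> z)"
        by (cases x; cases y; cases z) (simp add: multiple_pairs_simps M.M.a_assoc N.M.a_assoc)
    next
      fix x y assume "x \<in> carrier ?E" "y \<in> carrier ?E"
      then show "x \<oplus>\<^bsub>?E\<^esub> y \<in> carrier ?E" "x \<oplus>\<^bsub>?E\<^esub> y = y \<oplus>\<^bsub>?E\<^esub> x"
        using r by (cases x; cases y; simp add: multiple_pairs_simps f_add N.smult_r_distr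
            M.M.a_comm N.M.a_comm)+
    next
      show "\<zero>\<^bsub>?E\<^esub> \<in> carrier ?E" using r by (simp add: multiple_pairs_simps f_zero)
      fix x assume "x \<in> carrier ?E"
      then show "\<zero>\<^bsub>?E\<^esub> \<oplus>\<^bsub>?E\<^esub> x = x" by (cases x) (simp add: multiple_pairs_simps)
    qed
  next
    fix a x assume "a \<in> carrier R" "x \<in> carrier ?E"
    then show "a \<odot>\<^bsub>?E\<^esub> x \<in> carrier ?E"
      by (cases x) (simp add: multiple_pairs_simps f_smult comm)
  next
    fix a b x assume "a \<in> carrier R" "b \<in> carrier R" "x \<in> carrier ?E"
    then show "(a \<oplus> b) \<odot>\<^bsub>?E\<^esub> x = a \<odot>\<^bsub>?E\<^esub> x \<oplus>\<^bsub>?E\<^esub> b \<odot>\<^bsub>?E\<^esub> x"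
      "(a \<otimes> b) \<odot>\<^bsub>?E\<^esub> x = a \<odot>\<^bsub>?E\<^esub> (b \<odot>\<^bsub>?E\<^esub> x)"
      by (cases x; simp add: multiple_pairs_simps M.smult_l_distr N.smult_l_distr
          M.smult_assoc1 N.smult_assoc1)+
  next
    fix a x y assume "a \<in> carrier R" "x \<in> carrier ?E" "y \<in> carrier ?E"
    then show "a \<odot>\<^bsub>?E\<^esub> (x \<oplus>\<^bsub>?E\<^esub> y) = a \<odot>\<^bsub>?E\<^esub> x \<oplus>\<^bsub>?E\<^esub> a \<odot>\<^bsub>?E\<^esub> y"
      by (cases x; cases y) (simp add: multiple_pairs_simps M.smult_r_distr N.smult_r_distr)
  next
    fix x assume "x \<in> carrier ?E"
    then show "\<one> \<odot>\<^bsub>?E\<^esub> x = x" by (cases x) (simp add: multiple_pairs_simps)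
  qed
qed

lemma (in dedekind_domain) seemingly_divisible_divisible:
  assumes r: "r \<in> carrier R" and M: "module R M" and N: "module R N" and f: "f \<in> linear_homs R M N"
    and sd: "seemingly_divisible M N f r"
  shows "\<exists>g\<in>linear_homs R M N. \<forall>m\<in>carrier M. f m = r \<odot>\<^bsub>N\<^esub> g m"
proof -
  interpret M: module R M by fact
  interpret N: module R N by fact
  have f_div: "\<exists>n\<in>carrier N. f m = r \<odot>\<^bsub>N\<^esub> n" if "m \<in> carrier M" for m
    using sd that unfolding seemingly_divisible_def by blast
  have f_tor: "f m = \<zero>\<^bsub>N\<^esub>" if "m \<in> carrier M" "r \<odot>\<^bsub>M\<^esub> m = \<zero>\<^bsub>M\<^esub>" for m
    using sd that unfolding seemingly_divisible_def by blast
  have f_zero: "f \<zero>\<^bsub>M\<^esub> = \<zero>\<^bsub>N\<^esub>" using f_tor r by simp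
  show ?thesis
  proof (cases "r = \<zero>")
    case True
    \<comment> \<open>For \<open>r = \<zero>\<close> every element is \<open>r\<close>-torsion, so
      the second half of seeming divisibility forces \<open>f = 0\<close>.\<close>
    have "(\<lambda>_. \<zero>\<^bsub>N\<^esub>) \<in> linear_homs R M N" by (simp add: linear_homs_def)
    then show ?thesis using f_tor True by (intro bexI[of _ "\<lambda>_. \<zero>\<^bsub>N\<^esub>"]) simp_all
  next
    case False
    define E where "E = multiple_pairs M N f r"
    have E: "module R E" unfolding E_def by (rule module_multiple_pairs[OF M N f r])
    interpret E: module R E by (rule E)
    note E_simps = multiple_pairs_simps[where M = M and N = N and f = f and r = r, folded E_def]
    have E_neg: "\<ominus>\<^bsub>E\<^esub> (m, n) = (\<ominus>\<^bsub>M\<^esub> m, \<ominus>\<^bsub>N\<^esub> n)" if "(m, n) \<in> carrier E" for m n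
    proof -
      have "\<ominus>\<^bsub>E\<^esub> (m, n) = (\<ominus> \<one>) \<odot>\<^bsub>E\<^esub> (m, n)"
        using that by (simp add: E.smult_l_minus)
      also have "\<dots> = (\<ominus>\<^bsub>M\<^esub> m, \<ominus>\<^bsub>N\<^esub> n)"
        using that by (simp add: E_simps M.smult_l_minus N.smult_l_minus)
      finally show ?thesis .
    qed
    define T where "T = {(\<zero>\<^bsub>M\<^esub>, n) |n. n \<in> carrier N \<and> r \<odot>\<^bsub>N\<^esub> n = \<zero>\<^bsub>N\<^esub>}"
    have T_iff: "(m, n) \<in> T \<longleftrightarrow> m = \<zero>\<^bsub>M\<^esub> \<and> n \<in> carrier N \<and> r \<odot>\<^bsub>N\<^esub> n = \<zero>\<^bsub>N\<^esub>" for m n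
      by (auto simp: T_def)
    have T_carr: "T \<subseteq> carrier E" by (auto simp: T_def E_simps f_zero)
    have comm: "r \<odot>\<^bsub>N\<^esub> (a \<odot>\<^bsub>N\<^esub> n) = a \<odot>\<^bsub>N\<^esub> (r \<odot>\<^bsub>N\<^esub> n)" if "a \<in> carrier R" "n \<in> carrier N" for a n
      using that r by (simp add: N.smult_assoc1[symmetric] m_comm)
    have T: "submodule T R E"
    proof (rule E.submoduleI[OF T_carr])
      show "\<zero>\<^bsub>E\<^esub> \<in> T" using r by (simp add: E_simps T_iff)
      fix x assume x: "x \<in> T"
      then obtain n where n: "x = (\<zero>\<^bsub>M\<^esub>, n)" "n \<in> carrier N" "r \<odot>\<^bsub>N\<^esub> n = \<zero>\<^bsub>N\<^esub>" by (auto simp: T_def)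
      have "(\<zero>\<^bsub>M\<^esub>, n) \<in> carrier E" using x T_carr n by blast
      then show "\<ominus>\<^bsub>E\<^esub> x \<in> T" using n r by (simp add: E_neg T_iff N.smult_r_minus)
      show "a \<odot>\<^bsub>E\<^esub> x \<in> T" if "a \<in> carrier R" for a
        using n that by (simp add: E_simps T_iff comm)
      show "x \<oplus>\<^bsub>E\<^esub> y \<in> T" if "y \<in> T" for y
        using n that r by (cases y) (simp add: E_simps T_iff N.smult_r_distr)
    qed
    have rT: "r \<odot>\<^bsub>E\<^esub> t = \<zero>\<^bsub>E\<^esub>" if "t \<in> T" for t
      using that r by (cases t) (simp add: T_iff E_simps)
    \<comment> \<open>If \<open>r (m, n) \<in> T\<close> then \<open>r m = 0\<close>, hence
      \<open>f m = 0\<close> and \<open>(0, n)\<close> is in \<open>T\<close>. It agrees with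
      \<open>(m, n)\<close> under every \<open>a\<close> that kills \<open>m\<close>.\<close>
    have pure: "\<exists>t\<in>T. \<forall>a\<in>carrier R. a \<odot>\<^bsub>E\<^esub> e \<in> T \<longrightarrow> a \<odot>\<^bsub>E\<^esub> e = a \<odot>\<^bsub>E\<^esub> t"
      if e: "e \<in> carrier E" "r \<odot>\<^bsub>E\<^esub> e \<in> T" for e
    proof -
      obtain m n where mn: "e = (m, n)" "m \<in> carrier M" "n \<in> carrier N" "f m = r \<odot>\<^bsub>N\<^esub> n"
        using e(1) by (cases e) (simp add: E_simps)
      have "r \<odot>\<^bsub>M\<^esub> m = \<zero>\<^bsub>M\<^esub>" using e(2) mn(1) by (simp add: E_simps T_iff)
      then have "(\<zero>\<^bsub>M\<^esub>, n) \<in> T" using f_tor mn by (simp add: T_iff)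
      moreover have "\<forall>a\<in>carrier R. a \<odot>\<^bsub>E\<^esub> e \<in> T \<longrightarrow> a \<odot>\<^bsub>E\<^esub> e = a \<odot>\<^bsub>E\<^esub> (\<zero>\<^bsub>M\<^esub>, n)"
        using mn(1) by (simp add: E_simps T_iff)
      ultimately show ?thesis by blast
    qed
    obtain C where C: "submodule C R E" "C \<inter> T \<subseteq> {\<zero>\<^bsub>E\<^esub>}" "C <+>\<^bsub>E\<^esub> T = carrier E"
      by (rule pure_bounded_complement[OF E T r False rT pure])
    have C_carr: "m \<in> carrier M" "n \<in> carrier N" "f m = r \<odot>\<^bsub>N\<^esub> n" if "(m, n) \<in> C" for m n
      using E.submodule_mem_carrier[OF C(1) that] by (simp_all add: E_simps)
    \<comment> \<open>Divisibility of the values of \<open>f\<close> makes the projection of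
      \<open>E\<close> to \<open>M\<close> onto, and elements of \<open>T\<close> have first
      component zero, so \<open>C\<close> alone already projects onto \<open>M\<close>.\<close>
    have C_ex: "\<exists>n. (m, n) \<in> C" if m: "m \<in> carrier M" for m
    proof -
      obtain n where "n \<in> carrier N" "f m = r \<odot>\<^bsub>N\<^esub> n" using f_div[OF m] by blast
      then have "(m, n) \<in> C <+>\<^bsub>E\<^esub> T" using m by (simp add: C(3) E_simps)
      then obtain c t where ct: "c \<in> C" "t \<in> T" "(m, n) = c \<oplus>\<^bsub>E\<^esub> t"
        unfolding E.mem_set_add_iff by blast
      obtain m' n' n'' where c: "c = (m', n')" and t: "t = (\<zero>\<^bsub>M\<^esub>, n'')"
        using ct(2) by (cases c) (auto simp: T_def)
      have "m = m'" using ct(3) C_carr(1)[of m' n'] ct(1) by (simp add: c t E_simps)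
      then show ?thesis using ct(1) c by blast
    qed
    \<comment> \<open>The difference has first component zero and so lies in
      \<open>C \<inter> T\<close>.\<close>
    have C_unique: "n = n'" if n: "(m, n) \<in> C" "(m, n') \<in> C" for m n n'
    proof -
      note carr = C_carr[OF n(1)] C_carr[OF n(2)]
      have "(m, n) \<ominus>\<^bsub>E\<^esub> (m, n') \<in> C" by (rule E.submodule_minus[OF C(1) n])
      moreover have "(m, n) \<ominus>\<^bsub>E\<^esub> (m, n') = (\<zero>\<^bsub>M\<^esub>, n \<ominus>\<^bsub>N\<^esub> n')"
        using carr by (simp add: E.M.minus_eq E_neg E_simps M.M.r_neg N.M.minus_eq)
      moreover have "(\<zero>\<^bsub>M\<^esub>, n \<ominus>\<^bsub>N\<^esub> n') \<in> T"
        using carr r by (simp add: T_iff N.M.minus_eq N.smult_r_distr N.smult_r_minus N.M.r_neg)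
      ultimately have "n \<ominus>\<^bsub>N\<^esub> n' = \<zero>\<^bsub>N\<^esub>" using C(2) by (auto simp: E_simps)
      moreover have "n = (n \<ominus>\<^bsub>N\<^esub> n') \<oplus>\<^bsub>N\<^esub> n'"
        using carr by (simp add: N.M.minus_eq N.M.a_assoc N.M.l_neg)
      ultimately show ?thesis using carr by simp
    qed
    define g where "g m = (SOME n. (m, n) \<in> C)" for m
    have g: "(m, g m) \<in> C" if "m \<in> carrier M" for m
      unfolding g_def using C_ex[OF that] by (rule someI_ex)
    have "g \<in> linear_homs R M N"
    proof -
      have "g (x \<oplus>\<^bsub>M\<^esub> y) = g x \<oplus>\<^bsub>N\<^esub> g y" if xy: "x \<in> carrier M" "y \<in> carrier M" for x y
        using E.submoduleE(5)[OF C(1) g[OF xy(1)] g[OF xy(2)]] g[of "x \<oplus>\<^bsub>M\<^esub> y"] xy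
        by (intro C_unique) (simp_all add: E_simps)
      moreover have "g (a \<odot>\<^bsub>M\<^esub> x) = a \<odot>\<^bsub>N\<^esub> g x" if ax: "a \<in> carrier R" "x \<in> carrier M" for a x
        using E.submoduleE(4)[OF C(1) ax(1) g[OF ax(2)]] g[of "a \<odot>\<^bsub>M\<^esub> x"] ax
        by (intro C_unique) (simp_all add: E_simps)
      ultimately show ?thesis using C_carr(2)[OF g] by (auto simp: linear_homs_def)
    qed
    moreover have "\<forall>m\<in>carrier M. f m = r \<odot>\<^bsub>N\<^esub> g m" using C_carr(3)[OF g] by blast
    ultimately show ?thesis by blast
  qed
qed

text \<open>Detecting Dedekind domains is stated with the hypothesis only on the type of
  \<open>R\<close>, while the consequence is claimed for arbitrary types; this is why there are two
  conjuncts.\<close>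

theorem theorem1p1:
  fixes R :: "('a, 'r) ring_scheme"
  assumes "domain R"
  shows "(seemingly_divisible_imp_divisible R TYPE('a) TYPE('a) \<longleftrightarrow> dedekind_domain R) \<and>
         (dedekind_domain R \<longrightarrow> seemingly_divisible_imp_divisible R TYPE('m) TYPE('n))"
proof -
  interpret domain R by fact
  have "seemingly_divisible_imp_divisible R TYPE('m) TYPE('n)" if "dedekind_domain R"
    unfolding seemingly_divisible_imp_divisible_def
    using dedekind_domain.seemingly_divisible_divisible[OF that] by blast
  moreover have "seemingly_divisible_imp_divisible R TYPE('a) TYPE('a)" if "dedekind_domain R"
    unfolding seemingly_divisible_imp_divisible_def
    using dedekind_domain.seemingly_divisible_divisible[OF that] by blast
  \<comment> \<open>Ideals are invertible in either case, by counting if the carrier is infinite and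
    because all nonzero elements are units if it is finite.\<close>
  moreover have "dedekind_domain R" if "seemingly_divisible_imp_divisible R TYPE('a) TYPE('a)"
    using that finite_domain_ideals_invertible infinite_domain_ideals_invertible
      ideals_invertible_imp_dedekind by blast
  ultimately show ?thesis by blast
qed

end
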